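(* Suppose that $G$ is a locally compact group with the fixed-point property for cones and let $H\leq G$ be a closed subgroup. Then $H$ has the fixed-point property for cones.
   Context: Locally compact groups are Hausdorff; subgroups carry the subspace topology. All vector spaces are real and all locally convex topologies are Hausdorff; $E'$ denotes the topological dual of $E$. A cone $C$ in a vector space is a non-empty subset closed under addition and under multiplication by non-negative scalars (hence convex); it is proper if $C\cap(-C)=\{0\}$. Let $C$ be a cone in a locally convex vector space $E$. A representation of a topological group $G$ on $C$ is a linear representation $\pi$ of $G$ on $E$ (each $\pi(g)$ continuous, so that the adjoint $\pi^*(g)\lambda=\lambda\circ\pi(g^{-1})$ acts on $E'$) such that $\pi(g)C\subset C$ for all $g\in G$. - It is locally bounded right-uniformly continuous if there is a non-zero $x_0\in C$ whose orbit is a bounded subset of $E$ (absorbed by every neighborhood of the origin) and such that for every neighborhood $U\subset E$ of the origin there is a neighborhood $V\subset G$ of the identity with $\pi(ag)x_0-\pi(g)x_0\in U$ for all $a\in V$, $g\in G$. - It is of cobounded type if there is $\lambda\in E'$ such that for every $\lambda'\in E'$ there are $g_1,\dots,g_n\in G$ with $\pm\lambda'\le\sum_{j=1}^n\pi^*(g_j)\lambda$, where $\mu\le\nu$ in $E'$ means $\mu(c)\le\nu(c)$ for all $c\in C$. $G$ has the fixed-point property for cones if every representation of $G$ on a non-empty weakly complete (i.e. complete for the weak topology $\sigma(E,E')$) proper convex cone $C$ in a locally convex vector space $E$ which is locally bounded right-uniformly continuous and of cobounded type has a non-zero fixed point in $C$. *)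

theory Defs
  imports "HOL-Analysis.Analysis" "HOL-Algebra.Module"
begin

text \<open>
  Groups and real vector spaces are carrier-based records (\<open>HOL-Algebra\<close>), topologised by abstract
  topologies on their carriers, so that a subgroup of a topological group is again one.
\<close>

section \<open>Locally compact groups\<close>

locale topological_group = group G for G (structure) +
  fixes T :: "'a topology"
  assumes topspace_eq: "topspace T = carrier G"
    and continuous_mult: "continuous_map (prod_topology T T) T (\<lambda>(x, y). x \<otimes> y)"
    and continuous_inv: "continuous_map T T (\<lambda>x. inv x)"

locale locally_compact_group = topological_group +
  assumes locally_compact: "locally_compact_space T"
    and Hausdorff: "Hausdorff_space T"

section \<open>Locally convex vector spaces\<close>

definition real_ring :: "real ring" where
  "real_ring = \<lparr>carrier = UNIV, mult = (*), one = 1, zero = 0, add = (+)\<rparr>"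

locale locally_convex_space = Module.module real_ring E for E (structure) +
  fixes T :: "'b topology"
  assumes topspace_eq: "topspace T = carrier E"
    and continuous_add: "continuous_map (prod_topology T T) T (\<lambda>(x, y). x \<oplus>\<^bsub>E\<^esub> y)"
    and continuous_smult: "continuous_map (prod_topology euclideanreal T) T (\<lambda>(r, x). r \<odot>\<^bsub>E\<^esub> x)"
    and Hausdorff: "Hausdorff_space T"
    and convex_basis: "\<lbrakk>openin T U; \<zero>\<^bsub>E\<^esub> \<in> U\<rbrakk> \<Longrightarrow>
      \<exists>W. openin T W \<and> \<zero>\<^bsub>E\<^esub> \<in> W \<and> W \<subseteq> U \<and>
        (\<forall>x\<in>W. \<forall>y\<in>W. \<forall>t\<in>{0..1}. (1 - t) \<odot>\<^bsub>E\<^esub> x \<oplus>\<^bsub>E\<^esub> t \<odot>\<^bsub>E\<^esub> y \<in> W)"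

definition linear_operator :: "(real, 'e) module \<Rightarrow> ('e \<Rightarrow> 'e) \<Rightarrow> bool" where
  "linear_operator E f \<longleftrightarrow> f \<in> carrier E \<rightarrow> carrier E \<and>
     (\<forall>x\<in>carrier E. \<forall>y\<in>carrier E. f (x \<oplus>\<^bsub>E\<^esub> y) = f x \<oplus>\<^bsub>E\<^esub> f y) \<and>
     (\<forall>r. \<forall>x\<in>carrier E. f (r \<odot>\<^bsub>E\<^esub> x) = r \<odot>\<^bsub>E\<^esub> f x)"

text \<open>
  Functionals are functions on the whole type \<open>'e\<close>; their values outside \<open>carrier E\<close> are arbitrary
  and never matter below.
\<close>

definition topological_dual :: "(real, 'e) module \<Rightarrow> 'e topology \<Rightarrow> ('e \<Rightarrow> real) set" where
  "topological_dual E T = {l. continuous_map T euclideanreal l \<and>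
     (\<forall>x\<in>carrier E. \<forall>y\<in>carrier E. l (x \<oplus>\<^bsub>E\<^esub> y) = l x + l y) \<and>
     (\<forall>r. \<forall>x\<in>carrier E. l (r \<odot>\<^bsub>E\<^esub> x) = r * l x)}"

definition weak_topology :: "(real, 'e) module \<Rightarrow> 'e topology \<Rightarrow> 'e topology" where
  "weak_topology E T = topology_generated_by
     {{x \<in> carrier E. l x \<in> U} | l U. l \<in> topological_dual E T \<and> open U}"

definition bounded_in :: "(real, 'e) module \<Rightarrow> 'e topology \<Rightarrow> 'e set \<Rightarrow> bool" where
  "bounded_in E T B \<longleftrightarrow> B \<subseteq> carrier E \<and>
     (\<forall>U. openin T U \<and> \<zero>\<^bsub>E\<^esub> \<in> U \<longrightarrow> (\<exists>r>0. \<forall>t. r \<le> \<bar>t\<bar> \<longrightarrow> B \<subseteq> (\<lambda>x. t \<odot>\<^bsub>E\<^esub> x) ` U))"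

text \<open>
  Completeness of a subset with respect to the translation-invariant uniformity of a vector
  topology: every Cauchy filter on the subset converges to one of its points.
\<close>

definition complete_in :: "(real, 'e) module \<Rightarrow> 'e topology \<Rightarrow> 'e set \<Rightarrow> bool" where
  "complete_in E T C \<longleftrightarrow>
     (\<forall>F. F \<noteq> bot \<and> eventually (\<lambda>x. x \<in> C) F \<and>
        (\<forall>U. openin T U \<and> \<zero>\<^bsub>E\<^esub> \<in> U \<longrightarrow>
           (\<exists>S. eventually (\<lambda>x. x \<in> S) F \<and> (\<forall>x\<in>S \<inter> C. \<forall>y\<in>S \<inter> C. x \<ominus>\<^bsub>E\<^esub> y \<in> U)))
      \<longrightarrow> (\<exists>c\<in>C. limitin T (\<lambda>x. x) c F))"

definition weakly_complete :: "(real, 'e) module \<Rightarrow> 'e topology \<Rightarrow> 'e set \<Rightarrow> bool" where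
  "weakly_complete E T C \<longleftrightarrow> complete_in E (weak_topology E T) C"

section \<open>Cones and their representations\<close>

definition cone_in :: "(real, 'e) module \<Rightarrow> 'e set \<Rightarrow> bool" where
  "cone_in E C \<longleftrightarrow> C \<noteq> {} \<and> C \<subseteq> carrier E \<and>
     (\<forall>x\<in>C. \<forall>y\<in>C. x \<oplus>\<^bsub>E\<^esub> y \<in> C) \<and> (\<forall>r\<ge>0. \<forall>x\<in>C. r \<odot>\<^bsub>E\<^esub> x \<in> C)"

definition proper_cone :: "(real, 'e) module \<Rightarrow> 'e set \<Rightarrow> bool" where
  "proper_cone E C \<longleftrightarrow> cone_in E C \<and> C \<inter> (\<lambda>x. \<ominus>\<^bsub>E\<^esub> x) ` C = {\<zero>\<^bsub>E\<^esub>}"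

definition cone_representation ::
  "('g, 'm) monoid_scheme \<Rightarrow> (real, 'e) module \<Rightarrow> 'e topology \<Rightarrow> 'e set \<Rightarrow> ('g \<Rightarrow> 'e \<Rightarrow> 'e) \<Rightarrow> bool" where
  "cone_representation G E T C \<pi> \<longleftrightarrow>
     (\<forall>g\<in>carrier G. linear_operator E (\<pi> g) \<and> continuous_map T T (\<pi> g)) \<and>
     (\<forall>x\<in>carrier E. \<pi> \<one>\<^bsub>G\<^esub> x = x) \<and>
     (\<forall>g\<in>carrier G. \<forall>h\<in>carrier G. \<forall>x\<in>carrier E. \<pi> (g \<otimes>\<^bsub>G\<^esub> h) x = \<pi> g (\<pi> h x)) \<and>
     (\<forall>g\<in>carrier G. \<pi> g ` C \<subseteq> C)"

definition locally_bounded_right_uniformly_continuous ::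
  "('g, 'm) monoid_scheme \<Rightarrow> 'g topology \<Rightarrow> (real, 'e) module \<Rightarrow> 'e topology \<Rightarrow> 'e set
    \<Rightarrow> ('g \<Rightarrow> 'e \<Rightarrow> 'e) \<Rightarrow> bool" where
  "locally_bounded_right_uniformly_continuous G TG E TE C \<pi> \<longleftrightarrow>
     (\<exists>x\<^sub>0\<in>C. x\<^sub>0 \<noteq> \<zero>\<^bsub>E\<^esub> \<and> bounded_in E TE ((\<lambda>g. \<pi> g x\<^sub>0) ` carrier G) \<and>
        (\<forall>U. openin TE U \<and> \<zero>\<^bsub>E\<^esub> \<in> U \<longrightarrow>
           (\<exists>V. openin TG V \<and> \<one>\<^bsub>G\<^esub> \<in> V \<and>
              (\<forall>a\<in>V. \<forall>g\<in>carrier G. \<pi> (a \<otimes>\<^bsub>G\<^esub> g) x\<^sub>0 \<ominus>\<^bsub>E\<^esub> \<pi> g x\<^sub>0 \<in> U))))"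

definition adjoint_rep ::
  "('g, 'm) monoid_scheme \<Rightarrow> ('g \<Rightarrow> 'e \<Rightarrow> 'e) \<Rightarrow> 'g \<Rightarrow> ('e \<Rightarrow> real) \<Rightarrow> 'e \<Rightarrow> real" where
  "adjoint_rep G \<pi> g l = (\<lambda>x. l (\<pi> (inv\<^bsub>G\<^esub> g) x))"

definition dual_le :: "'e set \<Rightarrow> ('e \<Rightarrow> real) \<Rightarrow> ('e \<Rightarrow> real) \<Rightarrow> bool" where
  "dual_le C \<mu> \<nu> \<longleftrightarrow> (\<forall>c\<in>C. \<mu> c \<le> \<nu> c)"

definition cobounded_type ::
  "('g, 'm) monoid_scheme \<Rightarrow> (real, 'e) module \<Rightarrow> 'e topology \<Rightarrow> 'e set \<Rightarrow> ('g \<Rightarrow> 'e \<Rightarrow> 'e) \<Rightarrow> bool" where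
  "cobounded_type G E T C \<pi> \<longleftrightarrow>
     (\<exists>l\<in>topological_dual E T. \<forall>l'\<in>topological_dual E T.
        \<exists>(n::nat) g. (\<forall>j\<in>{1..n}. g j \<in> carrier G) \<and>
          dual_le C l' (\<lambda>x. \<Sum>j=1..n. adjoint_rep G \<pi> (g j) l x) \<and>
          dual_le C (\<lambda>x. - l' x) (\<lambda>x. \<Sum>j=1..n. adjoint_rep G \<pi> (g j) l x))"

text \<open>
  HOL cannot quantify over types inside a formula, so the property carries a type argument: \<open>E\<close>
  ranges over all locally convex spaces whose underlying set is a subset of the type \<open>'e\<close>. Both
  the vector space structure and the topology are arbitrary, so \<open>'e\<close> only bounds the cardinality
  of \<open>E\<close>. The unrestricted property is the conjunction over all types \<open>'e\<close>:
  a conclusion should therefore leave \<open>'e\<close> a type variable, while a hypothesis made at one fixed type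
  is implied by the unrestricted property. The natural fixed type for a group with elements in \<open>'g\<close> is
  \<open>('g \<Rightarrow> real) \<Rightarrow> real\<close>, which holds the algebraic duals of all spaces of functions on the group.
\<close>

definition fixed_point_property_for_cones ::
  "'e itself \<Rightarrow> ('g, 'm) monoid_scheme \<Rightarrow> 'g topology \<Rightarrow> bool" where
  "fixed_point_property_for_cones (_ :: 'e itself) G TG \<longleftrightarrow>
     (\<forall>(E :: (real, 'e) module) TE C \<pi>.
        locally_convex_space E TE \<and> proper_cone E C \<and> weakly_complete E TE C \<and>
        cone_representation G E TE C \<pi> \<and>
        locally_bounded_right_uniformly_continuous G TG E TE C \<pi> \<and>
        cobounded_type G E TE C \<pi>
      \<longrightarrow> (\<exists>x\<in>C. x \<noteq> \<zero>\<^bsub>E\<^esub> \<and> (\<forall>g\<in>carrier G. \<pi> g x = x)))"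

end

theory Submission
  imports Defs
begin

text \<open>
  Let \<open>\<Delta>\<close> be the modular function of \<open>H\<close> and let \<open>\<pi>\<close> represent \<open>H\<close> on a cone \<open>C\<close> in \<open>E\<close>, with base
  point \<open>x\<^sub>0\<close> and with a positive cobounding functional \<open>\<lambda>\<close>. Every \<open>l \<in> E'\<close> gives a bounded right-uniformly
  continuous function \<open>F\<^sub>l(h) = l(\<pi>(h) x\<^sub>0)\<close> on \<open>H\<close> dominated by finitely many translates of \<open>f = F\<^sub>\<lambda>\<close>.
  A non-zero \<open>H\<close>-invariant functional on such functions which is a limit of positive combinations of
  point evaluations produces a fixed point: apply weak completeness to the corresponding combinations of
  the \<open>\<pi>(h) x\<^sub>0\<close>, and separate points of \<open>E\<close> by Hahn-Banach.

  Convolving \<open>p \<in> C\<^sub>c(G)\<close> with \<open>F\<close> times the right Haar measure of \<open>H\<close> gives a right-uniformly continuous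
  function \<open>p * F\<close> on \<open>G\<close>, and the fixed-point property of \<open>G\<close>, used for functionals on the functions
  dominated by translates of \<open>p\<^sub>0 * f\<close>, yields a \<open>G\<close>-invariant functional \<open>M\<close>. The \<open>H\<close>-translate of \<open>F\<close> by
  \<open>k\<close> corresponds to \<open>\<Delta>(k)\<close> times a right translate of \<open>p\<close>. For \<open>F \<ge> 0\<close> the map \<open>p \<mapsto> M(p * F)\<close> is a left
  Haar functional on \<open>G\<close>, so by uniqueness of Haar functionals a right translation of \<open>p\<close> multiplies it by a factor that
  does not depend on \<open>F\<close>. The case \<open>F = 1\<close>, which every translation fixes, shows that this factor is
  \<open>1 / \<Delta>(k)\<close>. Hence \<open>F \<mapsto> M(p\<^sub>0 * F)\<close> is \<open>H\<close>-invariant.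
\<close>

section \<open>Positive functionals on compactly supported functions\<close>

text \<open>Restricting an invariant functional from \<open>G\<close> to \<open>H\<close> would call
  for an extension of functions from \<open>H\<close> to \<open>G\<close> that respects
  translations. Convolution with \<open>p\<close> provides one, but a left translation of
  \<open>F\<close> by \<open>H\<close> reappears as a right translation of \<open>p\<close>, and
  \<open>M\<close> is only left invariant; this is why Haar uniqueness has to enter. The case
  \<open>F = 1\<close> takes a second application of the fixed-point property, with a functional of
  its own, because the constant 1 need not be dominated by translates of \<open>f\<close>. The two
  functionals live on different function spaces and become comparable only as functions of
  \<open>p\<close>.

  Integration is carried by positive functionals on compactly supported functions, so that Fubini
  reduces to uniform approximation by finite sums of products, and Haar uniqueness to two
  evaluations of one double integral.\<close>

definition Cc :: "'a topology \<Rightarrow> ('a \<Rightarrow> real) set" where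
  "Cc X = {f. continuous_map X euclideanreal f \<and>
     (\<exists>K. compactin X K \<and> (\<forall>x\<in>topspace X - K. f x = 0))}"

lemma CcI:
  assumes "continuous_map X euclideanreal f" "compactin X K" "\<And>x. x \<in> topspace X \<Longrightarrow> x \<notin> K \<Longrightarrow> f x = 0"
  shows "f \<in> Cc X"
  using assms unfolding Cc_def by blast

lemma CcE:
  assumes "f \<in> Cc X"
  obtains K where "compactin X K" "\<And>x. x \<in> topspace X \<Longrightarrow> x \<notin> K \<Longrightarrow> f x = 0"
  using assms unfolding Cc_def by blast

lemma Cc_continuous: "f \<in> Cc X \<Longrightarrow> continuous_map X euclideanreal f"
  by (simp add: Cc_def)

lemma Cc_zero: "(\<lambda>x. 0) \<in> Cc X"
  by (rule CcI[of _ _ "{}"]) auto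

lemma Cc_add: assumes "f \<in> Cc X" "g \<in> Cc X" shows "(\<lambda>x. f x + g x) \<in> Cc X"
proof -
  obtain K where K: "compactin X K" "\<And>x. x \<in> topspace X \<Longrightarrow> x \<notin> K \<Longrightarrow> f x = 0"
    using CcE[OF assms(1)] by metis
  obtain L where L: "compactin X L" "\<And>x. x \<in> topspace X \<Longrightarrow> x \<notin> L \<Longrightarrow> g x = 0"
    using CcE[OF assms(2)] by metis
  show ?thesis
    by (rule CcI[of _ _ "K \<union> L"])
      (use K L assms in \<open>auto intro!: continuous_intros compactin_Un dest: Cc_continuous\<close>)
qed

lemma Cc_mult:
  assumes "f \<in> Cc X" "continuous_map X euclideanreal q"
  shows "(\<lambda>x. f x * q x) \<in> Cc X"
proof -
  obtain K where K: "compactin X K" "\<And>x. x \<in> topspace X \<Longrightarrow> x \<notin> K \<Longrightarrow> f x = 0"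
    using CcE[OF assms(1)] by metis
  show ?thesis
    by (rule CcI[of _ _ K])
      (use K assms in \<open>auto intro!: continuous_map_real_mult dest: Cc_continuous\<close>)
qed

lemma Cc_mult':
  assumes "f \<in> Cc X" "continuous_map X euclideanreal q"
  shows "(\<lambda>x. q x * f x) \<in> Cc X"
  using Cc_mult[OF assms] by (simp add: mult.commute)

lemma Cc_scale: "f \<in> Cc X \<Longrightarrow> (\<lambda>x. c * f x) \<in> Cc X"
  by (rule Cc_mult') auto

lemma Cc_uminus: "f \<in> Cc X \<Longrightarrow> (\<lambda>x. - f x) \<in> Cc X"
  using Cc_scale[of f X "-1"] by simp

lemma Cc_diff: "f \<in> Cc X \<Longrightarrow> g \<in> Cc X \<Longrightarrow> (\<lambda>x. f x - g x) \<in> Cc X"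
  using Cc_add[of f X "\<lambda>x. - g x"] Cc_uminus[of g X] by simp

lemma Cc_sum: "finite I \<Longrightarrow> (\<And>i. i \<in> I \<Longrightarrow> f i \<in> Cc X) \<Longrightarrow> (\<lambda>x. \<Sum>i\<in>I. f i x) \<in> Cc X"
  by (induction I rule: finite_induct) (auto intro: Cc_zero Cc_add)

lemma Cc_abs: assumes "f \<in> Cc X" shows "(\<lambda>x. \<bar>f x\<bar>) \<in> Cc X"
proof -
  obtain K where K: "compactin X K" "\<And>x. x \<in> topspace X \<Longrightarrow> x \<notin> K \<Longrightarrow> f x = 0"
    using CcE[OF assms(1)] by metis
  show ?thesis
    by (rule CcI[of _ _ K])
      (use K assms in \<open>auto intro!: continuous_map_real_abs dest: Cc_continuous\<close>)
qed

lemma Cc_max0: assumes "f \<in> Cc X" shows "(\<lambda>x. max (f x) 0) \<in> Cc X"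
proof -
  have "(\<lambda>x. max (f x) 0) = (\<lambda>x. (1 / 2) * (f x + \<bar>f x\<bar>))" by (auto simp: max_def)
  then show ?thesis using Cc_scale[OF Cc_add[OF assms Cc_abs[OF assms]], of "1 / 2"] by simp
qed

section \<open>Bump functions and partitions of unity\<close>

lemma bump:
  assumes "locally_compact_space X" "Hausdorff_space X" "compactin X K" "openin X U" "K \<subseteq> U"
  obtains k where "k \<in> Cc X" "\<And>x. x \<in> topspace X \<Longrightarrow> 0 \<le> k x" "\<And>x. x \<in> topspace X \<Longrightarrow> k x \<le> (1::real)"
    "\<And>x. x \<in> K \<Longrightarrow> k x = 1" "\<And>x. x \<in> topspace X \<Longrightarrow> x \<notin> U \<Longrightarrow> k x = 0"
proof -
  \<comment> \<open>\<open>V\<close> keeps the support of the Urysohn function inside the compact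
    set \<open>L\<close>, so the closed set to avoid is the complement of
    \<open>U \<inter> V\<close>.\<close>
  obtain V L where VL: "openin X V" "compactin X L" "K \<subseteq> V" "V \<subseteq> L"
    using assms locally_compact_space_compact_closed_compact[of X] by blast
  have "completely_regular_space X"
    using assms by (simp add: locally_compact_regular_imp_completely_regular_space)
  moreover have "closedin X (topspace X - (U \<inter> V))"
    using assms VL by blast
  moreover have "disjnt K (topspace X - (U \<inter> V))"
    using assms VL by (auto simp: disjnt_iff)
  ultimately obtain f where f: "continuous_map X (top_of_set {0..1::real}) f" "f ` (topspace X - (U \<inter> V)) \<subseteq> {0}"
      "f ` K \<subseteq> {1}"
    using Urysohn_completely_regular_compact_closed[of 0 1 X K "topspace X - (U \<inter> V)"] assms(3)
    by (metis zero_le_one)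
  show thesis
  proof (rule that)
    show "f \<in> Cc X"
      by (rule CcI[of _ _ L]) (use f VL in \<open>auto simp: continuous_map_in_subtopology image_subset_iff\<close>)
  qed (use f in \<open>auto simp: continuous_map_in_subtopology Pi_iff\<close>)
qed

lemma bump_compact:
  assumes "locally_compact_space X" "Hausdorff_space X" "compactin X K"
  obtains k where "k \<in> Cc X" "\<And>x. x \<in> topspace X \<Longrightarrow> 0 \<le> k x" "\<And>x. x \<in> K \<Longrightarrow> k x = (1::real)"
  using bump[OF assms, of "topspace X"] compactin_subset_topspace[OF assms(3)] by (metis openin_topspace)

text \<open>By the Riesz representation theorem these are the Radon measures on \<open>X\<close>
  when \<open>X\<close> is locally compact Hausdorff.\<close>

definition positive_functional :: "'a topology \<Rightarrow> (('a \<Rightarrow> real) \<Rightarrow> real) \<Rightarrow> bool" where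
  "positive_functional X J \<longleftrightarrow>
     (\<forall>f\<in>Cc X. \<forall>g\<in>Cc X. J (\<lambda>x. f x + g x) = J f + J g) \<and>
     (\<forall>c. \<forall>f\<in>Cc X. J (\<lambda>x. c * f x) = c * J f) \<and>
     (\<forall>f\<in>Cc X. (\<forall>x\<in>topspace X. 0 \<le> f x) \<longrightarrow> 0 \<le> J f)"

context
  fixes X :: "'a topology" and J :: "('a \<Rightarrow> real) \<Rightarrow> real"
  assumes J: "positive_functional X J"
begin

lemma pf_add: "f \<in> Cc X \<Longrightarrow> g \<in> Cc X \<Longrightarrow> J (\<lambda>x. f x + g x) = J f + J g"
  using J by (simp add: positive_functional_def)

lemma pf_scale: "f \<in> Cc X \<Longrightarrow> J (\<lambda>x. c * f x) = c * J f"
  using J by (simp add: positive_functional_def)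

lemma pf_nonneg: "f \<in> Cc X \<Longrightarrow> (\<And>x. x \<in> topspace X \<Longrightarrow> 0 \<le> f x) \<Longrightarrow> 0 \<le> J f"
  using J by (simp add: positive_functional_def)

lemma pf_diff: "f \<in> Cc X \<Longrightarrow> g \<in> Cc X \<Longrightarrow> J (\<lambda>x. f x - g x) = J f - J g"
  using pf_add[of f "\<lambda>x. (-1) * g x"] pf_scale[of g "-1"] Cc_scale[of g X "-1"] by simp

lemma pf_zero: "J (\<lambda>x. 0) = 0"
  using pf_scale[OF Cc_zero, of 0] by simp

lemma pf_mono:
  "f \<in> Cc X \<Longrightarrow> g \<in> Cc X \<Longrightarrow> (\<And>x. x \<in> topspace X \<Longrightarrow> f x \<le> g x) \<Longrightarrow> J f \<le> J g"
  using pf_nonneg[of "\<lambda>x. g x - f x"] pf_diff[of g f] Cc_diff[of g X f] by simp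

text \<open>Members of \<open>Cc X\<close> are total on the type; positivity tested on
  \<open>topspace X\<close> alone already prevents \<open>J\<close> from seeing values
  elsewhere.\<close>

lemma pf_cong:
  "f \<in> Cc X \<Longrightarrow> g \<in> Cc X \<Longrightarrow> (\<And>x. x \<in> topspace X \<Longrightarrow> f x = g x) \<Longrightarrow> J f = J g"
  using pf_mono[of f g] pf_mono[of g f] by force

lemma pf_abs_le:
  assumes "f \<in> Cc X" "g \<in> Cc X" "\<And>x. x \<in> topspace X \<Longrightarrow> \<bar>f x\<bar> \<le> g x"
  shows "\<bar>J f\<bar> \<le> J g"
proof -
  have "J f \<le> J g" using assms by (intro pf_mono) force+
  moreover have "J (\<lambda>x. (-1) * f x) \<le> J g" using assms by (intro pf_mono Cc_scale) force+
  ultimately show ?thesis using pf_scale[OF assms(1), of "-1"] by linarith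
qed

lemma pf_sum:
  "finite I \<Longrightarrow> (\<And>i. i \<in> I \<Longrightarrow> f i \<in> Cc X) \<Longrightarrow> J (\<lambda>x. \<Sum>i\<in>I. f i x) = (\<Sum>i\<in>I. J (f i))"
  by (induction I rule: finite_induct) (auto simp: pf_zero pf_add Cc_sum)

lemma pf_lincomb:
  assumes "finite I" "\<And>i. i \<in> I \<Longrightarrow> f i \<in> Cc X"
  shows "J (\<lambda>x. \<Sum>i\<in>I. c i * f i x) = (\<Sum>i\<in>I. c i * J (f i))"
  using pf_sum[OF assms(1), of "\<lambda>i x. c i * f i x"] assms(2) by (simp add: Cc_scale pf_scale)

end

text \<open>Finitely many bumps subordinate to the sets \<open>N x\<close> are divided by their sum
  and multiplied by \<open>k\<close>. Majorising the sum by \<open>k\<close> is what later turns a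
  pointwise error \<open>d\<close> into \<open>d * k\<close>, whose integral is controlled.\<close>

lemma partition_of_unity:
  assumes X: "locally_compact_space X" "Hausdorff_space X" and K: "compactin X K"
    and N: "\<And>x. x \<in> K \<Longrightarrow> openin X (N x) \<and> x \<in> N x"
    and k: "k \<in> Cc X" "\<And>x. x \<in> topspace X \<Longrightarrow> 0 \<le> k x" "\<And>x. x \<in> K \<Longrightarrow> k x = (1::real)"
  shows "\<exists>I p. finite I \<and> I \<subseteq> K \<and>
    (\<forall>i\<in>I. p i \<in> Cc X \<and> (\<forall>x\<in>topspace X. 0 \<le> p i x \<and> (x \<notin> N i \<longrightarrow> p i x = 0))) \<and>
    (\<forall>x\<in>topspace X. (\<Sum>i\<in>I. p i x) \<le> k x) \<and> (\<forall>x\<in>K. (\<Sum>i\<in>I. p i x) = (1::real))"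
proof -
  have Ktop: "K \<subseteq> topspace X" using K by (rule compactin_subset_topspace)
  have "\<exists>b. x \<in> K \<longrightarrow> b \<in> Cc X \<and> (\<forall>y\<in>topspace X. 0 \<le> b y) \<and> b x = (1::real) \<and>
      (\<forall>y\<in>topspace X. y \<notin> N x \<longrightarrow> b y = 0)" for x
  proof (cases "x \<in> K")
    case True
    have "compactin X {x}" using True Ktop by (simp add: subset_eq)
    from bump[OF X this, of "N x"] N[OF True] show ?thesis by (metis empty_subsetI insert_subset singletonI)
  qed auto
  then obtain b where b: "\<And>x. x \<in> K \<Longrightarrow> b x \<in> Cc X" "\<And>x y. x \<in> K \<Longrightarrow> y \<in> topspace X \<Longrightarrow> 0 \<le> b x y"
     "\<And>x. x \<in> K \<Longrightarrow> b x x = (1::real)" "\<And>x y. x \<in> K \<Longrightarrow> y \<in> topspace X \<Longrightarrow> y \<notin> N x \<Longrightarrow> b x y = 0"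
    by metis
  define V where "V x = {y \<in> topspace X. b x y \<in> {1/2<..}}" for x
  have V: "openin X (V x)" if "x \<in> K" for x
    unfolding V_def using Cc_continuous[OF b(1)[OF that]] by (rule openin_continuous_map_preimage) auto
  have "\<exists>F. finite F \<and> F \<subseteq> V ` K \<and> K \<subseteq> \<Union>F"
    using K V b(3) Ktop by (intro compactinD[of X K]) (fastforce simp: V_def)+
  then obtain I where I: "finite I" "I \<subseteq> K" "K \<subseteq> \<Union>(V ` I)"
    by (metis finite_subset_image)
  define s where "s x = (\<Sum>i\<in>I. b i x)" for x
  have s_cont: "continuous_map X euclideanreal s"
    unfolding s_def using I Cc_continuous[OF b(1)] by (intro continuous_map_sum) auto
  have s0: "0 \<le> s x" if "x \<in> topspace X" for x
    unfolding s_def using I b(2)[OF _ that] by (intro sum_nonneg) auto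
  have sK: "1/2 < s x" if xK: "x \<in> K" for x
  proof -
    obtain i where i: "i \<in> I" "x \<in> V i" using I xK by blast
    have "b i x \<le> s x" unfolding s_def
      by (rule member_le_sum) (use i I b(2) Ktop xK in blast)+
    then show ?thesis using i by (simp add: V_def)
  qed
  \<comment> \<open>On \<open>K\<close> the sum \<open>s\<close> exceeds 1/2 by the choice of
    \<open>V\<close>, so the maximum equals \<open>s\<close> and the \<open>p i\<close> add up to
    \<open>k\<close>, that is to 1. Elsewhere the maximum keeps the quotients continuous and their
    sum at most 1.\<close>
  define p where "p i x = k x * (b i x / max (s x) (1/2))" for i x
  have psum: "(\<Sum>i\<in>I. p i x) = k x * (s x / max (s x) (1/2))" for x
    unfolding p_def s_def by (simp add: sum_distrib_left sum_divide_distrib)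
  show ?thesis
  proof (intro exI[of _ I] exI[of _ p] conjI ballI impI)
    fix i assume i: "i \<in> I"
    have "continuous_map X euclideanreal (\<lambda>x. b i x / max (s x) (1/2))"
      using Cc_continuous[OF b(1)] i I(2) s_cont by (intro continuous_map_real_divide continuous_map_real_max) auto
    with k(1) show "p i \<in> Cc X" unfolding p_def[abs_def] by (rule Cc_mult)
    fix x assume x: "x \<in> topspace X"
    show "0 \<le> p i x" unfolding p_def using k(2)[OF x] b(2)[of i x] i x I(2)
      by (intro mult_nonneg_nonneg divide_nonneg_nonneg) auto
    show "p i x = 0" if "x \<notin> N i" using that unfolding p_def using b(4)[of i x] i x I by auto
  next
    fix x assume x: "x \<in> topspace X"
    show "(\<Sum>i\<in>I. p i x) \<le> k x" unfolding psum
      using k(2)[OF x] s0[OF x] by (intro mult_left_le) (auto simp: divide_le_eq)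
  next
    fix x assume x: "x \<in> K"
    show "(\<Sum>i\<in>I. p i x) = 1" unfolding psum using sK[OF x] k(3)[OF x] by (simp add: max_def)
  qed (use I in auto)
qed

text \<open>A Riemann sum. The partition of unity is so fine that every \<open>q\<close> in
  \<open>Q\<close> stays within \<open>d\<close> of its value at the node of each piece, and the
  mass \<open>w i\<close> of a piece is the integral of \<open>p i * f\<close>. One choice of nodes
  and nonnegative weights serves all of \<open>Q\<close>, as membership in a cone of limits
  requires.\<close>

lemma positive_functional_approx:
  assumes X: "locally_compact_space X" "Hausdorff_space X" and J: "positive_functional X J"
    and f: "f \<in> Cc X" "\<And>x. x \<in> topspace X \<Longrightarrow> 0 \<le> f x"
    and Q: "finite Q" "\<And>q. q \<in> Q \<Longrightarrow> continuous_map X euclideanreal q" and e: "e > 0"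
  obtains I w where "finite I" "I \<subseteq> topspace X" "\<And>i. i \<in> I \<Longrightarrow> 0 \<le> w i"
    "\<And>q. q \<in> Q \<Longrightarrow> \<bar>J (\<lambda>x. f x * q x) - (\<Sum>i\<in>I. w i * q i)\<bar> < e"
proof -
  obtain K where K: "compactin X K" "\<And>x. x \<in> topspace X \<Longrightarrow> x \<notin> K \<Longrightarrow> f x = 0"
    using CcE[OF f(1)] by metis
  obtain k where k: "k \<in> Cc X" "\<And>x. x \<in> topspace X \<Longrightarrow> 0 \<le> k x" "\<And>x. x \<in> K \<Longrightarrow> k x = (1::real)"
    using bump_compact[OF X K(1)] by metis
  have Ktop: "K \<subseteq> topspace X" using K(1) by (rule compactin_subset_topspace)
  have Jf: "0 \<le> J f" using pf_nonneg[OF J f(1)] f(2) by auto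
  \<comment> \<open>The summand 1 avoids division by zero when \<open>J f = 0\<close> and makes
    \<open>d * J f < e\<close> strict.\<close>
  define d where "d = e / (J f + 1)"
  have d: "d > 0" "d * J f < e" using e Jf by (auto simp: d_def field_simps)
  define N where "N x = topspace X \<inter> (\<Inter>q\<in>Q. {y\<in>topspace X. q y \<in> {q x - d<..<q x + d}})" for x
  have N: "openin X (N x) \<and> x \<in> N x" if "x \<in> K" for x
  proof
    show "openin X (N x)"
      using Q unfolding N_def
      by (intro openin_Int_Inter[of "(\<lambda>q. {y\<in>topspace X. q y \<in> {q x - d<..<q x + d}}) ` Q"])
         (auto simp del: greaterThanLessThan_iff intro!: openin_continuous_map_preimage)
    show "x \<in> N x" using that Ktop d by (auto simp: N_def)
  qed
  have "\<exists>I p. finite I \<and> I \<subseteq> K \<and>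
    (\<forall>i\<in>I. p i \<in> Cc X \<and> (\<forall>x\<in>topspace X. 0 \<le> p i x \<and> (x \<notin> N i \<longrightarrow> p i x = 0))) \<and>
    (\<forall>x\<in>topspace X. (\<Sum>i\<in>I. p i x) \<le> k x) \<and> (\<forall>x\<in>K. (\<Sum>i\<in>I. p i x) = (1::real))"
    using N k by (intro partition_of_unity[OF X K(1)]) auto
  then obtain I p where p0: "finite I" "I \<subseteq> K"
      "\<forall>i\<in>I. p i \<in> Cc X \<and> (\<forall>x\<in>topspace X. 0 \<le> p i x \<and> (x \<notin> N i \<longrightarrow> p i x = 0))"
      "\<forall>x\<in>topspace X. (\<Sum>i\<in>I. p i x) \<le> k x" "\<forall>x\<in>K. (\<Sum>i\<in>I. p i x) = (1::real)"
    by (elim exE conjE) (rule that)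
  have p: "finite I" "I \<subseteq> K" "\<And>i. i \<in> I \<Longrightarrow> p i \<in> Cc X"
    "\<And>i x. i \<in> I \<Longrightarrow> x \<in> topspace X \<Longrightarrow> 0 \<le> p i x"
    "\<And>i x. i \<in> I \<Longrightarrow> x \<in> topspace X \<Longrightarrow> x \<notin> N i \<Longrightarrow> p i x = 0"
    "\<And>x. x \<in> topspace X \<Longrightarrow> (\<Sum>i\<in>I. p i x) \<le> k x"
    "\<And>x. x \<in> K \<Longrightarrow> (\<Sum>i\<in>I. p i x) = (1::real)"
    using p0 by auto
  define w where "w i = J (\<lambda>x. p i x * f x)" for i
  have pf: "(\<lambda>x. p i x * f x) \<in> Cc X" if "i \<in> I" for i
    using p(3)[OF that] f(1) by (intro Cc_mult Cc_continuous)
  show thesis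
  proof (rule that[of I w])
    show "0 \<le> w i" if "i \<in> I" for i unfolding w_def
      using pf[OF that] by (rule pf_nonneg[OF J]) (use p(4)[OF that] f(2) in auto)
  next
    fix q assume q: "q \<in> Q"
    let ?r = "\<lambda>x. \<Sum>i\<in>I. q i * (p i x * f x)"
    have r: "?r \<in> Cc X" using p(1) pf by (intro Cc_sum Cc_scale)
    have "J ?r = (\<Sum>i\<in>I. w i * q i)"
      using pf_lincomb[OF J p(1) pf] by (simp add: w_def mult.commute)
    moreover have fq: "(\<lambda>x. f x * q x) \<in> Cc X" using f(1) Q(2)[OF q] by (rule Cc_mult)
    moreover have "\<bar>J (\<lambda>x. f x * q x - ?r x)\<bar> \<le> J (\<lambda>x. d * f x)"
    proof (rule pf_abs_le[OF J])
      fix x assume x: "x \<in> topspace X"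
      show "\<bar>f x * q x - ?r x\<bar> \<le> d * f x"
      proof (cases "x \<in> K")
        case True
        have "f x * q x - ?r x = f x * (q x * (\<Sum>i\<in>I. p i x) - (\<Sum>i\<in>I. q i * p i x))"
          using p(7)[OF True] by (simp add: algebra_simps sum_distrib_left)
        also have "\<dots> = f x * (\<Sum>i\<in>I. p i x * (q x - q i))"
          by (simp add: sum_distrib_left algebra_simps sum_subtractf)
        finally have *: "\<bar>f x * q x - ?r x\<bar> = f x * \<bar>\<Sum>i\<in>I. p i x * (q x - q i)\<bar>"
          using f(2)[OF x] by (simp add: abs_mult)
        have "\<bar>\<Sum>i\<in>I. p i x * (q x - q i)\<bar> \<le> (\<Sum>i\<in>I. p i x * d)"
        proof (rule order_trans[OF sum_abs sum_mono])
          fix i assume i: "i \<in> I"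
          have "\<bar>q x - q i\<bar> \<le> d" if "x \<in> N i" using that q by (fastforce simp: N_def)
          then show "\<bar>p i x * (q x - q i)\<bar> \<le> p i x * d"
            using p(4)[OF i x] p(5)[OF i x] by (cases "x \<in> N i") (auto simp: abs_mult intro!: mult_left_mono)
        qed
        also have "\<dots> = d" using p(7)[OF True] by (simp add: sum_distrib_right[symmetric])
        finally show ?thesis unfolding * mult.commute[of d] using f(2)[OF x] by (rule mult_left_mono)
      next
        case False
        then show ?thesis using K(2)[OF x] by simp
      qed
    qed (use fq r f in \<open>auto intro: Cc_diff Cc_scale\<close>)
    ultimately show "\<bar>J (\<lambda>x. f x * q x) - (\<Sum>i\<in>I. w i * q i)\<bar> < e"
      using d(2) pf_diff[OF J fq r] pf_scale[OF J f(1)] by simp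
  qed (use p Ktop in auto)
qed

section \<open>Integrals of sections and Fubini\<close>

lemma continuous_map_section:
  assumes "continuous_map (prod_topology X Y) euclideanreal (\<lambda>(x, y). \<Phi> x y)" "x \<in> topspace X"
  shows "continuous_map Y euclideanreal (\<Phi> x)"
  using continuous_map_compose[of Y "prod_topology X Y" "\<lambda>y. (x, y)" euclideanreal "\<lambda>(x, y). \<Phi> x y"] assms
  by (simp add: o_def continuous_map_paired)

lemma continuous_map_section':
  assumes "continuous_map (prod_topology X Y) euclideanreal (\<lambda>(x, y). \<Phi> x y)" "y \<in> topspace Y"
  shows "continuous_map X euclideanreal (\<lambda>x. \<Phi> x y)"
  using continuous_map_compose[of X "prod_topology X Y" "\<lambda>x. (x, y)" euclideanreal "\<lambda>(x, y). \<Phi> x y"] assms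
  by (simp add: o_def continuous_map_paired)

text \<open>The tube lemma along \<open>{x} \<times> L\<close> gives the bound for \<open>y\<close>
  in \<open>L\<close>; off \<open>L\<close> both sections vanish.\<close>

lemma uniform_section:
  assumes \<Phi>: "continuous_map (prod_topology X Y) euclideanreal (\<lambda>(x, y). \<Phi> x y)"
    and L: "compactin Y L" "\<And>x y. x \<in> topspace X \<Longrightarrow> y \<in> topspace Y \<Longrightarrow> y \<notin> L \<Longrightarrow> \<Phi> x y = 0"
    and x: "x \<in> topspace X" and d: "d > (0::real)"
  shows "\<exists>N. openin X N \<and> x \<in> N \<and> (\<forall>x'\<in>N. \<forall>y\<in>topspace Y. \<bar>\<Phi> x' y - \<Phi> x y\<bar> \<le> d)"
proof -
  let ?f = "\<lambda>z. \<Phi> (fst z) (snd z) - \<Phi> x (snd z)"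
  have "continuous_map (prod_topology X Y) euclideanreal ?f"
    using \<Phi> continuous_map_compose[OF continuous_map_snd continuous_map_section[OF \<Phi> x], of X]
    by (intro continuous_map_diff) (auto simp: case_prod_unfold o_def)
  then have "openin (prod_topology X Y) {z \<in> topspace (prod_topology X Y). ?f z \<in> {-d<..<d}}"
    by (rule openin_continuous_map_preimage) auto
  from tube_lemma_right[OF this L(1) x]
  obtain U V where UV: "openin X U" "x \<in> U" "L \<subseteq> V"
      "U \<times> V \<subseteq> {z \<in> topspace (prod_topology X Y). ?f z \<in> {-d<..<d}}"
    using compactin_subset_topspace[OF L(1)] x d by (fastforce)
  show ?thesis
  proof (intro exI[of _ U] conjI ballI UV)
    fix x' y assume *: "x' \<in> U" "y \<in> topspace Y"
    then have "x' \<in> topspace X" using UV(1) openin_subset by blast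
    then show "\<bar>\<Phi> x' y - \<Phi> x y\<bar> \<le> d"
      using * UV(3,4) L(2)[of x' y] L(2)[OF x, of y] d by (cases "y \<in> L") fastforce+
  qed
qed

lemma continuous_map_realI:
  fixes f :: "'a \<Rightarrow> real"
  assumes "\<And>x e. x \<in> topspace X \<Longrightarrow> e > 0 \<Longrightarrow> \<exists>U. openin X U \<and> x \<in> U \<and> (\<forall>x'\<in>U. \<bar>f x' - f x\<bar> < e)"
  shows "continuous_map X euclideanreal f"
  unfolding continuous_map_def
proof (intro conjI allI impI)
  fix W :: "real set" assume W: "openin euclideanreal W"
  show "openin X {x \<in> topspace X. f x \<in> W}"
  proof (subst openin_subopen, clarify)
    fix x assume x: "x \<in> topspace X" "f x \<in> W"
    obtain e where e: "e > 0" "\<And>t. \<bar>t - f x\<bar> < e \<Longrightarrow> t \<in> W"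
      using W x(2) by (auto simp: open_dist dist_real_def)
    obtain U where "openin X U" "x \<in> U" "\<forall>x'\<in>U. \<bar>f x' - f x\<bar> < e" using assms[OF x(1) e(1)] by blast
    then show "\<exists>U. openin X U \<and> x \<in> U \<and> U \<subseteq> {x \<in> topspace X. f x \<in> W}"
      using e(2) openin_subset[of X U] by (intro exI[of _ U]) blast
  qed
qed auto

text \<open>A uniform bound \<open>d\<close> on the difference of two sections becomes
  \<open>d * k\<close> with a fixed bump \<open>k\<close> over \<open>L\<close>, so the integrals
  differ by at most \<open>d * n k\<close>.\<close>

lemma section_integral_Cc:
  assumes Y: "locally_compact_space Y" "Hausdorff_space Y" and n: "positive_functional Y n"
    and \<Phi>: "continuous_map (prod_topology X Y) euclideanreal (\<lambda>(x, y). \<Phi> x y)"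
    and K: "compactin X K" "\<And>x y. x \<in> topspace X \<Longrightarrow> y \<in> topspace Y \<Longrightarrow> x \<notin> K \<Longrightarrow> \<Phi> x y = 0"
    and L: "compactin Y L" "\<And>x y. x \<in> topspace X \<Longrightarrow> y \<in> topspace Y \<Longrightarrow> y \<notin> L \<Longrightarrow> \<Phi> x y = 0"
  shows "(\<lambda>x. n (\<Phi> x)) \<in> Cc X"
proof -
  obtain k where k: "k \<in> Cc Y" "\<And>x. x \<in> topspace Y \<Longrightarrow> 0 \<le> k x" "\<And>x. x \<in> L \<Longrightarrow> k x = (1::real)"
    using bump_compact[OF Y L(1)] by metis
  have sec: "\<Phi> x \<in> Cc Y" if "x \<in> topspace X" for x
    using CcI[OF continuous_map_section[OF \<Phi> that] L(1)] L(2) that by blast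
  have nk: "0 \<le> n k" using k by (intro pf_nonneg[OF n])
  show ?thesis
  proof (rule CcI[OF _ K(1)])
    show "continuous_map X euclideanreal (\<lambda>x. n (\<Phi> x))"
    proof -
      have "\<exists>U. openin X U \<and> x \<in> U \<and> (\<forall>x'\<in>U. \<bar>n (\<Phi> x') - n (\<Phi> x)\<bar> < e)"
        if x: "x \<in> topspace X" and e: "e > 0" for x e
      proof -
        define d where "d = e / (n k + 1)"
        have d: "d > 0" "d * n k < e" using e nk by (auto simp: d_def field_simps)
        have "\<exists>N. openin X N \<and> x \<in> N \<and> (\<forall>x'\<in>N. \<forall>y\<in>topspace Y. \<bar>\<Phi> x' y - \<Phi> x y\<bar> \<le> d)"
          by (rule uniform_section[OF \<Phi> L(1) _ x d(1)]) (rule L(2))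
        then obtain N where N: "openin X N" "x \<in> N" "\<And>x' y. x' \<in> N \<Longrightarrow> y \<in> topspace Y \<Longrightarrow> \<bar>\<Phi> x' y - \<Phi> x y\<bar> \<le> d"
          by blast
        have "\<bar>n (\<Phi> x') - n (\<Phi> x)\<bar> < e" if x': "x' \<in> N" for x'
        proof -
          have x'X: "x' \<in> topspace X" using N(1) x' openin_subset by blast
          have "\<bar>n (\<lambda>y. \<Phi> x' y - \<Phi> x y)\<bar> \<le> n (\<lambda>y. d * k y)"
          proof (rule pf_abs_le[OF n])
            fix y assume y: "y \<in> topspace Y"
            show "\<bar>\<Phi> x' y - \<Phi> x y\<bar> \<le> d * k y"
              using N(3)[OF x' y] k(3)[of y] k(2)[OF y] L(2)[OF x'X y] L(2)[OF x y] d(1)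
              by (cases "y \<in> L") auto
          qed (use sec x x'X k in \<open>auto intro!: Cc_diff Cc_scale\<close>)
          then show ?thesis using d(2) pf_diff[OF n sec[OF x'X] sec[OF x]] pf_scale[OF n k(1)] by simp
        qed
        then show ?thesis using N by blast
      qed
      then show ?thesis by (rule continuous_map_realI)
    qed
    fix x assume x: "x \<in> topspace X" "x \<notin> K"
    have "n (\<Phi> x) = n (\<lambda>y. 0)"
      using sec[OF x(1)] K(2) x by (intro pf_cong[OF n] Cc_zero) auto
    then show "n (\<Phi> x) = 0" using pf_zero[OF n] by simp
  qed
qed

text \<open>\<open>\<Phi>\<close> is approximated by the sum \<open>r x y\<close> of the products
  \<open>p i x * \<Phi> i y\<close>, for which exchanging the functionals is linearity. The error is
  at most \<open>d * k x * k' y\<close>, a product, hence small whichever variable is integrated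
  first.\<close>

lemma positive_functional_Fubini:
  assumes X: "locally_compact_space X" "Hausdorff_space X" and J: "positive_functional X J"
    and Y: "locally_compact_space Y" "Hausdorff_space Y" and n: "positive_functional Y n"
    and \<Phi>: "continuous_map (prod_topology X Y) euclideanreal (\<lambda>(x, y). \<Phi> x y)"
    and K: "compactin X K" "\<And>x y. x \<in> topspace X \<Longrightarrow> y \<in> topspace Y \<Longrightarrow> x \<notin> K \<Longrightarrow> \<Phi> x y = 0"
    and L: "compactin Y L" "\<And>x y. x \<in> topspace X \<Longrightarrow> y \<in> topspace Y \<Longrightarrow> y \<notin> L \<Longrightarrow> \<Phi> x y = 0"
  shows "J (\<lambda>x. n (\<lambda>y. \<Phi> x y)) = n (\<lambda>y. J (\<lambda>x. \<Phi> x y))"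
proof -
  obtain k where k: "k \<in> Cc X" "\<And>x. x \<in> topspace X \<Longrightarrow> 0 \<le> k x" "\<And>x. x \<in> K \<Longrightarrow> k x = (1::real)"
    using bump_compact[OF X K(1)] by metis
  obtain k' where k': "k' \<in> Cc Y" "\<And>x. x \<in> topspace Y \<Longrightarrow> 0 \<le> k' x" "\<And>x. x \<in> L \<Longrightarrow> k' x = (1::real)"
    using bump_compact[OF Y L(1)] by metis
  have Ktop: "K \<subseteq> topspace X" using K(1) by (rule compactin_subset_topspace)
  have secY: "\<Phi> x \<in> Cc Y" if "x \<in> topspace X" for x
    using CcI[OF continuous_map_section[OF \<Phi> that] L(1)] L(2) that by blast
  have secX: "(\<lambda>x. \<Phi> x y) \<in> Cc X" if "y \<in> topspace Y" for y
    using CcI[OF continuous_map_section'[OF \<Phi> that] K(1)] K(2) that by blast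
  have \<Phi>': "continuous_map (prod_topology Y X) euclideanreal (\<lambda>(y, x). \<Phi> x y)"
    using continuous_map_compose[OF continuous_map_pairedI[OF continuous_map_snd[of Y X] continuous_map_fst[of Y X]] \<Phi>]
    by (simp add: o_def case_prod_unfold)
  have intX: "(\<lambda>x. n (\<Phi> x)) \<in> Cc X" by (rule section_integral_Cc[OF Y n \<Phi> K L])
  have intY: "(\<lambda>y. J (\<lambda>x. \<Phi> x y)) \<in> Cc Y"
    by (rule section_integral_Cc[OF X J \<Phi>' L(1) _ K(1)]) (use K L in auto)
  have nk: "0 \<le> n k'" "0 \<le> J k" using k k' by (auto intro: pf_nonneg[OF n] pf_nonneg[OF J])
  have "\<bar>J (\<lambda>x. n (\<lambda>y. \<Phi> x y)) - n (\<lambda>y. J (\<lambda>x. \<Phi> x y))\<bar> \<le> e" if e: "e > 0" for e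
  proof -
    define c where "c = J k * n k'"
    have c: "0 \<le> c" unfolding c_def using nk by simp
    \<comment> \<open>Each order of integration contributes an error of at most
      \<open>d * c\<close>.\<close>
    define d where "d = e / (2 * c + 1)"
    have d0: "d > 0" "2 * (d * c) \<le> e" using e c by (auto simp: d_def field_simps)
    then have d: "d > 0" "2 * (d * J k * n k') \<le> e" by (simp_all add: c_def mult.assoc)
    have "\<exists>N. x \<in> K \<longrightarrow> openin X N \<and> x \<in> N \<and> (\<forall>x'\<in>N. \<forall>y\<in>topspace Y. \<bar>\<Phi> x' y - \<Phi> x y\<bar> \<le> d)" for x
      using uniform_section[OF \<Phi> L(1) L(2) _ d(1), of x] Ktop by blast
    then obtain N where N: "\<And>x. x \<in> K \<Longrightarrow> openin X (N x) \<and> x \<in> N x"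
        "\<And>x x' y. x \<in> K \<Longrightarrow> x' \<in> N x \<Longrightarrow> y \<in> topspace Y \<Longrightarrow> \<bar>\<Phi> x' y - \<Phi> x y\<bar> \<le> d"
      by metis
    have "\<exists>I p. finite I \<and> I \<subseteq> K \<and>
      (\<forall>i\<in>I. p i \<in> Cc X \<and> (\<forall>x\<in>topspace X. 0 \<le> p i x \<and> (x \<notin> N i \<longrightarrow> p i x = 0))) \<and>
      (\<forall>x\<in>topspace X. (\<Sum>i\<in>I. p i x) \<le> k x) \<and> (\<forall>x\<in>K. (\<Sum>i\<in>I. p i x) = (1::real))"
      using N(1) k by (intro partition_of_unity[OF X K(1)]) auto
    then obtain I p where p0: "finite I" "I \<subseteq> K"
        "\<forall>i\<in>I. p i \<in> Cc X \<and> (\<forall>x\<in>topspace X. 0 \<le> p i x \<and> (x \<notin> N i \<longrightarrow> p i x = 0))"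
        "\<forall>x\<in>topspace X. (\<Sum>i\<in>I. p i x) \<le> k x" "\<forall>x\<in>K. (\<Sum>i\<in>I. p i x) = (1::real)"
      by (elim exE conjE) (rule that)
    have p: "finite I" "I \<subseteq> K" "\<And>i. i \<in> I \<Longrightarrow> p i \<in> Cc X"
      "\<And>i x. i \<in> I \<Longrightarrow> x \<in> topspace X \<Longrightarrow> 0 \<le> p i x"
      "\<And>i x. i \<in> I \<Longrightarrow> x \<in> topspace X \<Longrightarrow> x \<notin> N i \<Longrightarrow> p i x = 0"
      "\<And>x. x \<in> topspace X \<Longrightarrow> (\<Sum>i\<in>I. p i x) \<le> k x"
      "\<And>x. x \<in> K \<Longrightarrow> (\<Sum>i\<in>I. p i x) = (1::real)"
      using p0 by auto
    have IX: "i \<in> topspace X" if "i \<in> I" for i using that p(2) Ktop by blast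
    have secI: "\<Phi> i \<in> Cc Y" if "i \<in> I" for i using secY IX that by blast
    define r where "r x y = (\<Sum>i\<in>I. p i x * \<Phi> i y)" for x y
    have rY: "r x \<in> Cc Y" for x unfolding r_def[abs_def] using p(1) secI by (intro Cc_sum Cc_scale)
    have rX: "(\<lambda>x. r x y) \<in> Cc X" for y unfolding r_def[abs_def] using p(1,3) by (intro Cc_sum Cc_mult) auto
    have err: "\<bar>\<Phi> x y - r x y\<bar> \<le> d * k x * k' y" if x: "x \<in> topspace X" and y: "y \<in> topspace Y" for x y
    proof (cases "y \<in> L")
      case True
      have "\<Phi> x y = (\<Sum>i\<in>I. p i x * \<Phi> x y)"
        using p(7)[of x] K(2)[OF x y] by (cases "x \<in> K") (auto simp: sum_distrib_right[symmetric])
      then have "\<bar>\<Phi> x y - r x y\<bar> = \<bar>\<Sum>i\<in>I. p i x * (\<Phi> x y - \<Phi> i y)\<bar>"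
        unfolding r_def by (simp add: right_diff_distrib sum_subtractf)
      also have "\<dots> \<le> (\<Sum>i\<in>I. p i x * d)"
      proof (rule order_trans[OF sum_abs sum_mono])
        fix i assume i: "i \<in> I"
        then have iK: "i \<in> K" using p(2) by blast
        show "\<bar>p i x * (\<Phi> x y - \<Phi> i y)\<bar> \<le> p i x * d"
          using p(4)[OF i x] p(5)[OF i x] N(2)[OF iK _ y, of x]
          by (cases "x \<in> N i") (auto simp: abs_mult intro!: mult_left_mono)
      qed
      also have "\<dots> \<le> k x * d" using p(6)[OF x] d(1) by (simp add: sum_distrib_right[symmetric])
      finally show ?thesis using k'(3)[OF True] by (simp add: mult.commute)
    next
      case False
      then have "\<Phi> x y = 0" "r x y = 0" using L(2) x y IX by (auto simp: r_def)
      then show ?thesis using k(2)[OF x] k'(2)[OF y] d(1) by simp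
    qed
    have r': "r x y = (\<Sum>i\<in>I. \<Phi> i y * p i x)" for x y
      by (simp add: r_def mult.commute)
    have nr': "n (r x) = (\<Sum>i\<in>I. p i x * n (\<Phi> i))" for x
      unfolding r_def[abs_def] by (rule pf_lincomb[OF n p(1) secI])
    have nr: "n (r x) = (\<Sum>i\<in>I. n (\<Phi> i) * p i x)" for x
      by (simp add: nr' mult.commute)
    have Jr': "J (\<lambda>x. r x y) = (\<Sum>i\<in>I. \<Phi> i y * J (p i))" for y
      unfolding r' by (rule pf_lincomb[OF J p(1,3)])
    have Jr: "J (\<lambda>x. r x y) = (\<Sum>i\<in>I. J (p i) * \<Phi> i y)" for y
      by (simp add: Jr' mult.commute)
    have eq: "J (\<lambda>x. n (r x)) = n (\<lambda>y. J (\<lambda>x. r x y))"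
    proof -
      have "J (\<lambda>x. n (r x)) = (\<Sum>i\<in>I. n (\<Phi> i) * J (p i))"
        unfolding nr by (rule pf_lincomb[OF J p(1,3)])
      moreover have "n (\<lambda>y. J (\<lambda>x. r x y)) = (\<Sum>i\<in>I. J (p i) * n (\<Phi> i))"
        unfolding Jr by (rule pf_lincomb[OF n p(1) secI])
      ultimately show ?thesis by (simp add: mult.commute)
    qed
    have nrC: "(\<lambda>x. n (r x)) \<in> Cc X" unfolding nr using p by (intro Cc_sum Cc_scale) auto
    have JrC: "(\<lambda>y. J (\<lambda>x. r x y)) \<in> Cc Y" unfolding Jr using p secI by (intro Cc_sum Cc_scale) auto
    have "\<bar>J (\<lambda>x. n (\<Phi> x) - n (r x))\<bar> \<le> J (\<lambda>x. (d * n k') * k x)"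
    proof (rule pf_abs_le[OF J])
      fix x assume x: "x \<in> topspace X"
      have "\<bar>n (\<lambda>y. \<Phi> x y - r x y)\<bar> \<le> n (\<lambda>y. (d * k x) * k' y)"
        using err[OF x] by (intro pf_abs_le[OF n] Cc_diff Cc_scale secY rY k' x) auto
      then show "\<bar>n (\<Phi> x) - n (r x)\<bar> \<le> (d * n k') * k x"
        unfolding pf_diff[OF n secY[OF x] rY] pf_scale[OF n k'(1)] by (simp add: mult_ac)
    qed (use intX nrC k in \<open>auto intro: Cc_diff Cc_scale\<close>)
    moreover have "\<bar>n (\<lambda>y. J (\<lambda>x. \<Phi> x y) - J (\<lambda>x. r x y))\<bar> \<le> n (\<lambda>y. (d * J k) * k' y)"
    proof (rule pf_abs_le[OF n])
      fix y assume y: "y \<in> topspace Y"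
      have "\<bar>J (\<lambda>x. \<Phi> x y - r x y)\<bar> \<le> J (\<lambda>x. (d * k' y) * k x)"
        using err[OF _ y] by (intro pf_abs_le[OF J] Cc_diff Cc_scale secX rX k y) (auto simp: mult_ac)
      then show "\<bar>J (\<lambda>x. \<Phi> x y) - J (\<lambda>x. r x y)\<bar> \<le> (d * J k) * k' y"
        unfolding pf_diff[OF J secX[OF y] rX] pf_scale[OF J k(1)] by (simp add: mult_ac)
    qed (use intY JrC k' in \<open>auto intro: Cc_diff Cc_scale\<close>)
    ultimately show ?thesis
      using eq d(2) unfolding pf_diff[OF J intX nrC] pf_diff[OF n intY JrC] pf_scale[OF J k(1)] pf_scale[OF n k'(1)]
      by (simp add: mult_ac)
  qed
  then have "\<bar>J (\<lambda>x. n (\<lambda>y. \<Phi> x y)) - n (\<lambda>y. J (\<lambda>x. \<Phi> x y))\<bar> \<le> 0"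
    by (rule field_le_epsilon) simp
  then show ?thesis by simp
qed


section \<open>Haar functionals\<close>

lemma Cc_cong:
  assumes "f \<in> Cc X" "\<And>x. x \<in> topspace X \<Longrightarrow> f x = g x"
  shows "g \<in> Cc X"
proof -
  obtain K where "compactin X K" "\<And>x. x \<in> topspace X \<Longrightarrow> x \<notin> K \<Longrightarrow> f x = 0" using CcE[OF assms(1)] by metis
  then show ?thesis
    using continuous_map_eq[OF Cc_continuous[OF assms(1)] assms(2)] assms(2) by (intro CcI[of X g K]) auto
qed

lemma Cc_bounded:
  assumes "f \<in> Cc X"
  obtains M where "M > 0" "\<And>x. x \<in> topspace X \<Longrightarrow> \<bar>f x\<bar> \<le> M"
proof -
  obtain K where K: "compactin X K" "\<And>x. x \<in> topspace X \<Longrightarrow> x \<notin> K \<Longrightarrow> f x = 0"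
    using CcE[OF assms(1)] by metis
  have "compact (f ` K)" using image_compactin[OF K(1) Cc_continuous[OF assms]] by simp
  then obtain M where M: "\<And>x. x \<in> K \<Longrightarrow> \<bar>f x\<bar> \<le> M" using compact_imp_bounded bounded_real by (metis imageI)
  show thesis
  proof (rule that[of "max M 1"])
    show "\<bar>f x\<bar> \<le> max M 1" if "x \<in> topspace X" for x
      using M[of x] K(2)[OF that] by (cases "x \<in> K") auto
  qed simp
qed

section \<open>Translates of compactly supported functions\<close>

context topological_group
begin

lemma continuous_map_mult:
  assumes "continuous_map X T f" "continuous_map X T g"
  shows "continuous_map X T (\<lambda>x. f x \<otimes> g x)"
  using continuous_map_compose[OF continuous_map_pairedI[OF assms] continuous_mult] by (simp add: o_def)

lemma continuous_map_inv: "continuous_map X T f \<Longrightarrow> continuous_map X T (\<lambda>x. inv (f x))"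
  using continuous_map_compose[OF _ continuous_inv, of X f] by (simp add: o_def)

lemma continuous_map_ltrans: "a \<in> carrier G \<Longrightarrow> continuous_map T T (\<lambda>x. a \<otimes> x)"
  by (intro continuous_map_mult) (auto simp: topspace_eq)

lemma continuous_map_rtrans: "a \<in> carrier G \<Longrightarrow> continuous_map T T (\<lambda>x. x \<otimes> a)"
  by (intro continuous_map_mult) (auto simp: topspace_eq)

lemma continuous_map_compose_real:
  "continuous_map X T h \<Longrightarrow> continuous_map T euclideanreal f \<Longrightarrow> continuous_map X euclideanreal (\<lambda>x. f (h x))"
  using continuous_map_compose[of X T h euclideanreal f] by (simp add: o_def)

lemma Cc_ltrans:
  assumes f: "f \<in> Cc T" and a: "a \<in> carrier G" shows "(\<lambda>x. f (a \<otimes> x)) \<in> Cc T"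
proof -
  obtain K where K: "compactin T K" "\<And>x. x \<in> topspace T \<Longrightarrow> x \<notin> K \<Longrightarrow> f x = 0" using CcE[OF f] by metis
  have "compactin T ((\<lambda>x. inv a \<otimes> x) ` K)"
    using image_compactin[OF K(1) continuous_map_ltrans[OF inv_closed[OF a]]] .
  then show ?thesis
  proof (rule CcI[rotated])
    show "continuous_map T euclideanreal (\<lambda>x. f (a \<otimes> x))"
      using continuous_map_compose_real[OF continuous_map_ltrans[OF a] Cc_continuous[OF f]] .
    fix x assume x: "x \<in> topspace T" "x \<notin> (\<lambda>x. inv a \<otimes> x) ` K"
    then have "x = inv a \<otimes> (a \<otimes> x)" using a by (simp add: topspace_eq inv_solve_left)
    then have "a \<otimes> x \<notin> K" using x by blast
    then show "f (a \<otimes> x) = 0" using K(2) a x by (simp add: topspace_eq)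
  qed
qed

lemma Cc_rtrans:
  assumes f: "f \<in> Cc T" and a: "a \<in> carrier G" shows "(\<lambda>x. f (x \<otimes> a)) \<in> Cc T"
proof -
  obtain K where K: "compactin T K" "\<And>x. x \<in> topspace T \<Longrightarrow> x \<notin> K \<Longrightarrow> f x = 0" using CcE[OF f] by metis
  have "compactin T ((\<lambda>x. x \<otimes> inv a) ` K)"
    using image_compactin[OF K(1) continuous_map_rtrans[OF inv_closed[OF a]]] .
  then show ?thesis
  proof (rule CcI[rotated])
    show "continuous_map T euclideanreal (\<lambda>x. f (x \<otimes> a))"
      using continuous_map_compose_real[OF continuous_map_rtrans[OF a] Cc_continuous[OF f]] .
    fix x assume x: "x \<in> topspace T" "x \<notin> (\<lambda>x. x \<otimes> inv a) ` K"
    then have "x = (x \<otimes> a) \<otimes> inv a" using a by (simp add: topspace_eq m_assoc)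
    then have "x \<otimes> a \<notin> K" using x by blast
    then show "f (x \<otimes> a) = 0" using K(2) a x by (simp add: topspace_eq)
  qed
qed

lemma Cc_inv:
  assumes f: "f \<in> Cc T" shows "(\<lambda>x. f (inv x)) \<in> Cc T"
proof -
  obtain K where K: "compactin T K" "\<And>x. x \<in> topspace T \<Longrightarrow> x \<notin> K \<Longrightarrow> f x = 0" using CcE[OF f] by metis
  have "compactin T ((\<lambda>x. inv x) ` K)" using image_compactin[OF K(1) continuous_inv] .
  then show ?thesis
  proof (rule CcI[rotated])
    show "continuous_map T euclideanreal (\<lambda>x. f (inv x))"
      using continuous_map_compose_real[OF continuous_inv Cc_continuous[OF f]] .
    fix x assume x: "x \<in> topspace T" "x \<notin> (\<lambda>x. inv x) ` K"
    then have "x = inv (inv x)" by (simp add: topspace_eq)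
    then have "inv x \<notin> K" using x by blast
    then show "f (inv x) = 0" using K(2) x by (simp add: topspace_eq)
  qed
qed

lemma compactin_mult_inv:
  assumes "compactin T K" "compactin T L"
  shows "compactin T ((\<lambda>(x, y). x \<otimes> inv y) ` (K \<times> L))" "compactin T ((\<lambda>(x, y). inv x \<otimes> y) ` (K \<times> L))"
proof -
  have KL: "compactin (prod_topology T T) (K \<times> L)" using assms by (simp add: compactin_Times)
  have "continuous_map (prod_topology T T) T (\<lambda>z. fst z \<otimes> inv (snd z))"
       "continuous_map (prod_topology T T) T (\<lambda>z. inv (fst z) \<otimes> snd z)"
    by (intro continuous_map_mult continuous_map_inv continuous_map_fst continuous_map_snd)+
  from this[THEN image_compactin[OF KL]]
  show "compactin T ((\<lambda>(x, y). x \<otimes> inv y) ` (K \<times> L))" "compactin T ((\<lambda>(x, y). inv x \<otimes> y) ` (K \<times> L))"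
    by (simp_all add: case_prod_unfold)
qed

text \<open>The sets where a translate of \<open>g\<close> exceeds \<open>g t / 2\<close> are open.
  The translate by \<open>t \<otimes> inv k\<close> has the value \<open>g t\<close> at
  \<open>k\<close>, so these sets cover the support of \<open>f\<close>, and finitely many
  suffice.\<close>

lemma finite_translates_cover:
  assumes f: "f \<in> Cc T" and g: "continuous_map T euclideanreal g" "\<And>x. x \<in> carrier G \<Longrightarrow> 0 \<le> g x"
    and t: "t \<in> carrier G" "0 < g t"
  obtains ss where "set ss \<subseteq> carrier G" "\<And>x. x \<in> carrier G \<Longrightarrow> f x \<le> (\<Sum>s\<leftarrow>ss. g (s \<otimes> x))"
proof -
  obtain K where K: "compactin T K" "\<And>x. x \<in> topspace T \<Longrightarrow> x \<notin> K \<Longrightarrow> f x = 0" using CcE[OF f] by metis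
  obtain M where M: "M > 0" "\<And>x. x \<in> topspace T \<Longrightarrow> \<bar>f x\<bar> \<le> M" using Cc_bounded[OF f] by metis
  have KG: "K \<subseteq> carrier G" using compactin_subset_topspace[OF K(1)] by (simp add: topspace_eq)
  define V where "V k = {x \<in> topspace T. g ((t \<otimes> inv k) \<otimes> x) \<in> {g t / 2<..}}" for k
  have V: "openin T (V k)" if "k \<in> K" for k
    unfolding V_def
    by (intro openin_continuous_map_preimage[OF continuous_map_compose_real[OF continuous_map_ltrans g(1)]])
      (use that KG t in auto)
  have "k \<in> V k" if "k \<in> K" for k
    using that KG t by (auto simp: V_def topspace_eq m_assoc subset_eq)
  then have "\<exists>F. finite F \<and> F \<subseteq> V ` K \<and> K \<subseteq> \<Union>F"
    using K V by (intro compactinD[of T K]) auto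
  then obtain I where I: "finite I" "I \<subseteq> K" "K \<subseteq> \<Union>(V ` I)" by (metis finite_subset_image)
  obtain is0 where is0: "set is0 = I" using finite_list[OF I(1)] by blast
  \<comment> \<open>A list of translates carries no coefficients; repeating it \<open>N\<close>
    times raises the lower bound \<open>g t / 2\<close> to the bound \<open>M\<close> of
    \<open>f\<close>.\<close>
  obtain N where N: "M \<le> real N * (g t / 2)"
    using reals_Archimedean3[of "g t / 2"] t(2) by (meson half_gt_zero less_imp_le)
  define ss where "ss = concat (replicate N (map (\<lambda>k. t \<otimes> inv k) is0))"
  show thesis
  proof (rule that[of ss])
    show ss: "set ss \<subseteq> carrier G" using is0 I KG t by (auto simp: ss_def)
    fix x assume x: "x \<in> carrier G"
    have eq: "(\<Sum>s\<leftarrow>ss. g (s \<otimes> x)) = real N * (\<Sum>k\<leftarrow>is0. g ((t \<otimes> inv k) \<otimes> x))"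
      unfolding ss_def by (induction N) (auto simp: o_def algebra_simps)
    have nn: "0 \<le> g ((t \<otimes> inv k) \<otimes> x)" if "k \<in> set is0" for k
      using that is0 I KG t x by (intro g(2)) auto
    show "f x \<le> (\<Sum>s\<leftarrow>ss. g (s \<otimes> x))"
    proof (cases "x \<in> K")
      case True
      then obtain k where k: "k \<in> I" "x \<in> V k" using I by blast
      then have "g t / 2 \<le> g ((t \<otimes> inv k) \<otimes> x)" by (simp add: V_def)
      also have "\<dots> \<le> (\<Sum>k\<leftarrow>is0. g ((t \<otimes> inv k) \<otimes> x))"
        using nn k(1) is0 by (intro member_le_sum_list) auto
      finally have "real N * (g t / 2) \<le> (\<Sum>s\<leftarrow>ss. g (s \<otimes> x))"
        unfolding eq by (intro mult_left_mono) auto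
      then show ?thesis using M(2)[of x] N x by (simp add: topspace_eq)
    next
      case False
      have "0 \<le> (\<Sum>k\<leftarrow>is0. g ((t \<otimes> inv k) \<otimes> x))" using nn by (intro sum_list_nonneg) auto
      then show ?thesis using K(2)[OF _ False] x unfolding eq by (simp add: topspace_eq)
    qed
  qed
qed

text \<open>The zero functional qualifies. Functionals built from an invariant \<open>M\<close> can
  therefore be compared before it is known whether they vanish, and uniqueness takes a
  cross-multiplied form.\<close>

definition left_Haar :: "(('a \<Rightarrow> real) \<Rightarrow> real) \<Rightarrow> bool" where
  "left_Haar J \<longleftrightarrow> positive_functional T J \<and> (\<forall>a\<in>carrier G. \<forall>f\<in>Cc T. J (\<lambda>x. f (a \<otimes> x)) = J f)"

lemma left_HaarD:
  assumes "left_Haar J"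
  shows "positive_functional T J" "\<And>a f. a \<in> carrier G \<Longrightarrow> f \<in> Cc T \<Longrightarrow> J (\<lambda>x. f (a \<otimes> x)) = J f"
  using assms by (auto simp: left_Haar_def)

text \<open>A finite sum of translates of \<open>f\<close> dominates \<open>\<bar>h\<bar>\<close>,
  and its integral is a multiple of \<open>J f\<close>; so \<open>J f = 0\<close> would force
  \<open>J h = 0\<close>.\<close>

lemma left_Haar_faithful:
  assumes J: "left_Haar J" "h \<in> Cc T" "J h \<noteq> 0"
    and f: "f \<in> Cc T" "\<And>x. x \<in> carrier G \<Longrightarrow> 0 \<le> f x" and t: "t \<in> carrier G" "0 < f t"
  shows "0 < J f"
proof -
  note pf = left_HaarD(1)[OF J(1)]
  obtain ss where ss: "set ss \<subseteq> carrier G" "\<And>x. x \<in> carrier G \<Longrightarrow> \<bar>h x\<bar> \<le> (\<Sum>s\<leftarrow>ss. f (s \<otimes> x))"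
    using finite_translates_cover[OF Cc_abs[OF J(2)] Cc_continuous[OF f(1)] f(2) t] by metis
  have *: "(\<lambda>x. \<Sum>s\<leftarrow>ss. f (s \<otimes> x)) \<in> Cc T \<and> J (\<lambda>x. \<Sum>s\<leftarrow>ss. f (s \<otimes> x)) = real (length ss) * J f"
    using ss(1)
  proof (induction ss)
    case Nil
    then show ?case using pf_zero[OF pf] by (simp add: Cc_zero)
  next
    case (Cons s ss)
    then show ?case using f(1) left_HaarD(2)[OF J(1)]
      by (simp add: Cc_add Cc_ltrans pf_add[OF pf] algebra_simps)
  qed
  have "\<bar>J h\<bar> \<le> J (\<lambda>x. \<Sum>s\<leftarrow>ss. f (s \<otimes> x))"
    using * J(2) ss(2) by (intro pf_abs_le[OF pf]) (auto simp: topspace_eq)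
  moreover have "0 \<le> J f" using f by (intro pf_nonneg[OF pf]) (auto simp: topspace_eq)
  ultimately show ?thesis using * J(3) by (cases "J f = 0") auto
qed

end

section \<open>Uniform continuity of translation and uniqueness of the Haar functional\<close>

context locally_compact_group
begin

lemma compact_nhd_one:
  obtains W L where "openin T W" "\<one> \<in> W" "compactin T L" "W \<subseteq> L"
  using locally_compact unfolding locally_compact_space_def by (metis one_closed topspace_eq)

text \<open>Multiplying by a bump \<open>k u\<close> confines \<open>u\<close> to a compact set
  \<open>M\<close>. The sections then vanish for \<open>x\<close> outside the compact set of all
  \<open>inv u \<otimes> y\<close>, respectively \<open>y \<otimes> inv u\<close>, with
  \<open>u\<close> in \<open>M\<close> and \<open>y\<close> in a compact set \<open>K\<close> off
  which \<open>f\<close> vanishes, so the uniform estimate for sections applies at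
  \<open>u = \<one>\<close>.\<close>

lemma uniform_translate_near_one:
  assumes f: "f \<in> Cc T" and e: "e > (0::real)"
  shows "\<exists>U. openin T U \<and> \<one> \<in> U \<and> (\<forall>u\<in>U. \<forall>x\<in>carrier G. \<bar>f (u \<otimes> x) - f x\<bar> \<le> e)"
    and "\<exists>U. openin T U \<and> \<one> \<in> U \<and> (\<forall>u\<in>U. \<forall>x\<in>carrier G. \<bar>f (x \<otimes> u) - f x\<bar> \<le> e)"
proof -
  obtain W L where WL: "openin T W" "\<one> \<in> W" "compactin T L" "W \<subseteq> L" by (rule compact_nhd_one)
  obtain k where k: "k \<in> Cc T" "\<And>x. x \<in> L \<Longrightarrow> k x = (1::real)"
    using bump_compact[OF locally_compact Hausdorff WL(3)] by metis
  obtain M where M: "compactin T M" "\<And>x. x \<in> topspace T \<Longrightarrow> x \<notin> M \<Longrightarrow> k x = 0" using CcE[OF k(1)] by metis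
  obtain K where K: "compactin T K" "\<And>x. x \<in> topspace T \<Longrightarrow> x \<notin> K \<Longrightarrow> f x = 0" using CcE[OF f] by metis
  have LG: "L \<subseteq> carrier G" using compactin_subset_topspace[OF WL(3)] by (simp add: topspace_eq)
  have 1: "\<one> \<in> topspace T" by (simp add: topspace_eq)
  have cont: "continuous_map (prod_topology T T) euclideanreal (\<lambda>(u, x). f (u \<otimes> x) * k u)"
     "continuous_map (prod_topology T T) euclideanreal (\<lambda>(u, x). f (x \<otimes> u) * k u)"
    unfolding case_prod_unfold
    by (intro continuous_map_real_mult continuous_map_compose_real[OF _ Cc_continuous[OF f]]
       continuous_map_compose_real[OF _ Cc_continuous[OF k(1)]] continuous_map_mult continuous_map_fst continuous_map_snd)+
  have "\<exists>N. openin T N \<and> \<one> \<in> N \<and> (\<forall>u\<in>N. \<forall>x\<in>topspace T. \<bar>f (u \<otimes> x) * k u - f (\<one> \<otimes> x) * k \<one>\<bar> \<le> e)"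
  proof (rule uniform_section[OF cont(1) compactin_mult_inv(2)[OF M(1) K(1)] _ 1 e])
    fix u x assume ux: "u \<in> topspace T" "x \<in> topspace T" "x \<notin> (\<lambda>(x, y). inv x \<otimes> y) ` (M \<times> K)"
    have "x = inv u \<otimes> (u \<otimes> x)" using ux by (simp add: topspace_eq inv_solve_left)
    then have "u \<notin> M \<or> u \<otimes> x \<notin> K" using ux(3) by force
    then show "f (u \<otimes> x) * k u = 0" using M(2) K(2) ux by (auto simp: topspace_eq)
  qed
  then obtain N where "openin T N" "\<one> \<in> N" "\<forall>u\<in>N. \<forall>x\<in>topspace T. \<bar>f (u \<otimes> x) * k u - f (\<one> \<otimes> x) * k \<one>\<bar> \<le> e"
    by blast
  then show "\<exists>U. openin T U \<and> \<one> \<in> U \<and> (\<forall>u\<in>U. \<forall>x\<in>carrier G. \<bar>f (u \<otimes> x) - f x\<bar> \<le> e)"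
    using WL k(2) by (intro exI[of _ "N \<inter> W"]) (auto simp: topspace_eq subset_eq)
  have "\<exists>N. openin T N \<and> \<one> \<in> N \<and> (\<forall>u\<in>N. \<forall>x\<in>topspace T. \<bar>f (x \<otimes> u) * k u - f (x \<otimes> \<one>) * k \<one>\<bar> \<le> e)"
  proof (rule uniform_section[OF cont(2) compactin_mult_inv(1)[OF K(1) M(1)] _ 1 e])
    fix u x assume ux: "u \<in> topspace T" "x \<in> topspace T" "x \<notin> (\<lambda>(x, y). x \<otimes> inv y) ` (K \<times> M)"
    have "x = (x \<otimes> u) \<otimes> inv u" using ux by (simp add: topspace_eq m_assoc)
    then have "u \<notin> M \<or> x \<otimes> u \<notin> K" using ux(3) by force
    then show "f (x \<otimes> u) * k u = 0" using M(2) K(2) ux by (auto simp: topspace_eq)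
  qed
  then obtain N where "openin T N" "\<one> \<in> N" "\<forall>u\<in>N. \<forall>x\<in>topspace T. \<bar>f (x \<otimes> u) * k u - f (x \<otimes> \<one>) * k \<one>\<bar> \<le> e"
    by blast
  then show "\<exists>U. openin T U \<and> \<one> \<in> U \<and> (\<forall>u\<in>U. \<forall>x\<in>carrier G. \<bar>f (x \<otimes> u) - f x\<bar> \<le> e)"
    using WL k(2) by (intro exI[of _ "N \<inter> W"]) (auto simp: topspace_eq subset_eq)
qed

text \<open>The double integral of \<open>f x * g (inv y \<otimes> x)\<close> in two ways.
  Integrating over \<open>y\<close> first and using invariance of \<open>n\<close> separates the
  variables; integrating over \<open>x\<close> first and replacing \<open>x\<close> by
  \<open>y \<otimes> x\<close> gives the right-hand side. There the inner integral involves only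
  \<open>n\<close>, so the same function of \<open>x\<close> occurs for every
  \<open>J\<close>.\<close>

lemma left_Haar_swap:
  assumes J: "left_Haar J" and n: "left_Haar n" and f: "f \<in> Cc T" and g: "g \<in> Cc T"
  shows "(\<lambda>x. g x * n (\<lambda>y. f (y \<otimes> x))) \<in> Cc T"
    and "J f * n (\<lambda>y. g (inv y)) = J (\<lambda>x. g x * n (\<lambda>y. f (y \<otimes> x)))"
proof -
  note Jp = left_HaarD(1)[OF J] and np = left_HaarD(1)[OF n]
  obtain K where K: "compactin T K" "\<And>x. x \<in> topspace T \<Longrightarrow> x \<notin> K \<Longrightarrow> f x = 0" using CcE[OF f] by metis
  obtain M where M: "compactin T M" "\<And>x. x \<in> topspace T \<Longrightarrow> x \<notin> M \<Longrightarrow> g x = 0" using CcE[OF g] by metis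
  define L where "L = (\<lambda>(x, y). x \<otimes> inv y) ` (K \<times> M)"
  have L: "compactin T L" unfolding L_def by (rule compactin_mult_inv(1)[OF K(1) M(1)])
  have cont: "continuous_map (prod_topology T T) euclideanreal (\<lambda>(x, y). f x * g (inv y \<otimes> x))"
     "continuous_map (prod_topology T T) euclideanreal (\<lambda>(x, y). g x * f (y \<otimes> x))"
    unfolding case_prod_unfold
    by (intro continuous_map_real_mult continuous_map_compose_real[OF _ Cc_continuous[OF f]]
       continuous_map_compose_real[OF _ Cc_continuous[OF g]] continuous_map_mult continuous_map_inv
       continuous_map_fst continuous_map_snd)+
  have L1: "f x * g (inv y \<otimes> x) = 0" if "x \<in> topspace T" "y \<in> topspace T" "y \<notin> L" for x y
  proof -
    have "y = x \<otimes> inv (inv y \<otimes> x)" using that by (simp add: topspace_eq inv_mult_group m_assoc[symmetric])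
    then have "x \<notin> K \<or> inv y \<otimes> x \<notin> M" using that unfolding L_def by force
    then show ?thesis using K(2) M(2) that by (auto simp: topspace_eq)
  qed
  have L2: "g x * f (y \<otimes> x) = 0" if "x \<in> topspace T" "y \<in> topspace T" "y \<notin> L" for x y
  proof -
    have "y = (y \<otimes> x) \<otimes> inv x" using that by (simp add: topspace_eq m_assoc)
    then have "y \<otimes> x \<notin> K \<or> x \<notin> M" using that unfolding L_def by force
    then show ?thesis using K(2) M(2) that by (auto simp: topspace_eq)
  qed
  have cs: "(\<lambda>y. f (y \<otimes> x)) \<in> Cc T" if "x \<in> topspace T" for x
    using Cc_rtrans[OF f] that by (simp add: topspace_eq)
  have cs': "(\<lambda>x. g (inv y \<otimes> x)) \<in> Cc T" if "y \<in> topspace T" for y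
    using Cc_ltrans[OF g] that by (simp add: topspace_eq)
  have gi: "(\<lambda>y. g (inv y)) \<in> Cc T" using g by (rule Cc_inv)
  have "(\<lambda>x. n (\<lambda>y. g x * f (y \<otimes> x))) \<in> Cc T"
    by (rule section_integral_Cc[OF locally_compact Hausdorff np cont(2) M(1) _ L]) (use M L2 in auto)
  then show C: "(\<lambda>x. g x * n (\<lambda>y. f (y \<otimes> x))) \<in> Cc T"
    by (rule Cc_cong) (use pf_scale[OF np cs] in auto)
  have in1: "n (\<lambda>y. f x * g (inv y \<otimes> x)) = n (\<lambda>y. g (inv y)) * f x" if x: "x \<in> topspace T" for x
  proof -
    have ix: "inv x \<in> carrier G" using x by (simp add: topspace_eq)
    have c: "(\<lambda>y. g (inv (inv x \<otimes> y))) \<in> Cc T" using Cc_ltrans[OF gi ix] .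
    have "n (\<lambda>y. f x * g (inv y \<otimes> x)) = n (\<lambda>y. f x * g (inv (inv x \<otimes> y)))"
    proof (rule pf_cong[OF np])
      show eq: "f x * g (inv y \<otimes> x) = f x * g (inv (inv x \<otimes> y))" if "y \<in> topspace T" for y
        using x that by (simp add: topspace_eq inv_mult_group)
      show "(\<lambda>y. f x * g (inv y \<otimes> x)) \<in> Cc T"
        by (rule Cc_cong[OF Cc_scale[OF c, of "f x"]]) (rule eq[symmetric])
    qed (rule Cc_scale[OF c])
    also have "\<dots> = f x * n (\<lambda>y. g (inv y))"
      unfolding pf_scale[OF np c] using left_HaarD(2)[OF n ix gi] by simp
    finally show ?thesis by (simp add: mult.commute)
  qed
  have in2: "J (\<lambda>x. f x * g (inv y \<otimes> x)) = J (\<lambda>x. g x * f (y \<otimes> x))" if y: "y \<in> topspace T" for y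
  proof -
    have c: "(\<lambda>x. f x * g (inv y \<otimes> x)) \<in> Cc T" using f cs'[OF y] Cc_continuous by (intro Cc_mult) auto
    have yG: "y \<in> carrier G" using y by (simp add: topspace_eq)
    have "J (\<lambda>x. f x * g (inv y \<otimes> x)) = J (\<lambda>x. f (y \<otimes> x) * g (inv y \<otimes> (y \<otimes> x)))"
      using left_HaarD(2)[OF J yG c] by simp
    also have "\<dots> = J (\<lambda>x. g x * f (y \<otimes> x))"
    proof (rule pf_cong[OF Jp])
      show "(\<lambda>x. f (y \<otimes> x) * g (inv y \<otimes> (y \<otimes> x))) \<in> Cc T" using Cc_ltrans[OF c yG] .
      show "(\<lambda>x. g x * f (y \<otimes> x)) \<in> Cc T"
        using g Cc_ltrans[OF f yG] Cc_continuous by (intro Cc_mult) auto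
    qed (use yG in \<open>simp add: topspace_eq m_assoc[symmetric]\<close>)
    finally show ?thesis .
  qed
  have c1: "(\<lambda>x. n (\<lambda>y. f x * g (inv y \<otimes> x))) \<in> Cc T"
    by (rule section_integral_Cc[OF locally_compact Hausdorff np cont(1) K(1) _ L]) (use K L1 in auto)
  have cont': "continuous_map (prod_topology T T) euclideanreal (\<lambda>(y, x). f x * g (inv y \<otimes> x))"
     "continuous_map (prod_topology T T) euclideanreal (\<lambda>(y, x). g x * f (y \<otimes> x))"
    unfolding case_prod_unfold
    by (intro continuous_map_real_mult continuous_map_compose_real[OF _ Cc_continuous[OF f]]
       continuous_map_compose_real[OF _ Cc_continuous[OF g]] continuous_map_mult continuous_map_inv
       continuous_map_fst continuous_map_snd)+
  have c3: "(\<lambda>y. J (\<lambda>x. f x * g (inv y \<otimes> x))) \<in> Cc T"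
    by (rule section_integral_Cc[OF locally_compact Hausdorff Jp cont'(1) L _ K(1)]) (use K L1 in auto)
  have c4: "(\<lambda>y. J (\<lambda>x. g x * f (y \<otimes> x))) \<in> Cc T"
    by (rule section_integral_Cc[OF locally_compact Hausdorff Jp cont'(2) L _ M(1)]) (use M L2 in auto)
  have c2: "(\<lambda>x. n (\<lambda>y. g x * f (y \<otimes> x))) \<in> Cc T"
    by (rule section_integral_Cc[OF locally_compact Hausdorff np cont(2) M(1) _ L]) (use M L2 in auto)
  have "J f * n (\<lambda>y. g (inv y)) = J (\<lambda>x. n (\<lambda>y. g (inv y)) * f x)"
    unfolding pf_scale[OF Jp f] by (rule mult.commute)
  also have "\<dots> = J (\<lambda>x. n (\<lambda>y. f x * g (inv y \<otimes> x)))"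
    using in1 by (intro pf_cong[OF Jp] Cc_scale f c1) auto
  also have "\<dots> = n (\<lambda>y. J (\<lambda>x. f x * g (inv y \<otimes> x)))"
    by (rule positive_functional_Fubini[OF locally_compact Hausdorff Jp locally_compact Hausdorff np cont(1) K(1) _ L])
      (use K L1 in auto)
  also have "\<dots> = n (\<lambda>y. J (\<lambda>x. g x * f (y \<otimes> x)))"
    using in2 by (intro pf_cong[OF np] c3 c4) auto
  also have "\<dots> = J (\<lambda>x. n (\<lambda>y. g x * f (y \<otimes> x)))"
    by (rule positive_functional_Fubini[OF locally_compact Hausdorff Jp locally_compact Hausdorff np cont(2) M(1) _ L, symmetric])
      (use M L2 in auto)
  also have "\<dots> = J (\<lambda>x. g x * n (\<lambda>y. f (y \<otimes> x)))"
    using pf_scale[OF np cs] by (intro pf_cong[OF Jp] c2 C) auto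
  finally show "J f * n (\<lambda>y. g (inv y)) = J (\<lambda>x. g x * n (\<lambda>y. f (y \<otimes> x)))" .
qed

text \<open>\<open>D u x\<close> stands for the modular function at \<open>x\<close> times
  \<open>n u\<close>, before that function is available. The swap identity with \<open>J = n\<close>
  makes \<open>p * (n g * D f - n f * D g)\<close> integrate to zero for all \<open>p\<close>;
  faithfulness of \<open>n\<close> then gives \<open>D f * n g = D g * n f\<close> pointwise, and
  the swap identity with \<open>J\<close> carries this over to \<open>J\<close>.\<close>

theorem left_Haar_unique:
  assumes J: "left_Haar J" and n: "left_Haar n" and f: "f \<in> Cc T" and g: "g \<in> Cc T"
  shows "J f * n g = n f * J g"
proof (cases "\<exists>h\<in>Cc T. n h \<noteq> 0")
  case False
  then show ?thesis using f g by simp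
next
  case True
  then obtain h where h: "h \<in> Cc T" "n h \<noteq> 0" by blast
  note Jp = left_HaarD(1)[OF J] and np = left_HaarD(1)[OF n]
  define D where "D u x = n (\<lambda>y. u (y \<otimes> x))" for u x
  have DC: "(\<lambda>x. p x * D u x) \<in> Cc T" if "u \<in> Cc T" "p \<in> Cc T" for u p
    unfolding D_def using left_Haar_swap(1)[OF n n that] .
  have key: "D f t * n g = D g t * n f" if t: "t \<in> carrier G" for t
  proof (rule ccontr)
    assume neq: "D f t * n g \<noteq> D g t * n f"
    have "compactin T {t}" using t by (simp add: topspace_eq)
    then obtain k where k: "k \<in> Cc T" "k t = (1::real)"
      using bump_compact[OF locally_compact Hausdorff] by (metis singletonI)
    \<comment> \<open>Taking \<open>p = k * w\<close> below turns the vanishing integral into that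
      of the square of \<open>w\<close>; the bump \<open>k\<close> brings \<open>w\<close> into
      \<open>Cc T\<close>.\<close>
    define w where "w x = n g * (k x * D f x) - n f * (k x * D g x)" for x
    have w: "w \<in> Cc T" unfolding w_def[abs_def] using DC f g k by (intro Cc_diff Cc_scale)
    define p where "p x = k x * w x" for x
    have p: "p \<in> Cc T" unfolding p_def[abs_def] using k w Cc_continuous by (intro Cc_mult) auto
    have ww: "(\<lambda>x. w x * w x) \<in> Cc T" using w Cc_continuous by (intro Cc_mult) auto
    have eq: "(\<lambda>x. w x * w x) = (\<lambda>x. n g * (p x * D f x) - n f * (p x * D g x))"
      by (auto simp: fun_eq_iff p_def w_def algebra_simps)
    have "n (\<lambda>x. w x * w x) = n g * n (\<lambda>x. p x * D f x) - n f * n (\<lambda>x. p x * D g x)"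
      unfolding eq pf_diff[OF np Cc_scale[OF DC[OF f p]] Cc_scale[OF DC[OF g p]]]
        pf_scale[OF np DC[OF f p]] pf_scale[OF np DC[OF g p]] ..
    also have "\<dots> = 0"
      unfolding D_def left_Haar_swap(2)[OF n n f p, symmetric] left_Haar_swap(2)[OF n n g p, symmetric] by simp
    finally have "n (\<lambda>x. w x * w x) = 0" .
    moreover have "w t \<noteq> 0" using neq k(2) by (simp add: w_def mult.commute)
    then have "0 < n (\<lambda>x. w x * w x)"
      using t by (intro left_Haar_faithful[OF n h ww]) (auto simp: zero_less_mult_iff)
    ultimately show False by simp
  qed
  \<comment> \<open>The non-zero value \<open>n h\<close> is moved to the reflected argument by
    taking \<open>p\<close> to be \<open>h\<close> composed with inversion.\<close>
  obtain p where p: "p \<in> Cc T" "n (\<lambda>y. p (inv y)) \<noteq> 0"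
  proof (rule that)
    show "(\<lambda>x. h (inv x)) \<in> Cc T" by (rule Cc_inv[OF h(1)])
    have "n (\<lambda>y. h (inv (inv y))) = n h"
      using h(1) by (intro pf_cong[OF np] Cc_inv[OF Cc_inv]) (auto simp: topspace_eq)
    then show "n (\<lambda>y. h (inv (inv y))) \<noteq> 0" using h by simp
  qed
  have "J (\<lambda>x. n g * (p x * D f x)) = J (\<lambda>x. n f * (p x * D g x))"
    using key by (intro pf_cong[OF Jp] Cc_scale DC f g p) (auto simp: topspace_eq mult_ac)
  then have "n g * (J f * n (\<lambda>y. p (inv y))) = n f * (J g * n (\<lambda>y. p (inv y)))"
    unfolding pf_scale[OF Jp DC[OF f p(1)]] pf_scale[OF Jp DC[OF g p(1)]]
    using left_Haar_swap(2)[OF J n f p(1)] left_Haar_swap(2)[OF J n g p(1)] by (simp add: D_def)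
  then show ?thesis using p(2) by (simp add: mult.commute)
qed

end


section \<open>Existence of a Haar functional by covering numbers\<close>

definition Ccp :: "'a topology \<Rightarrow> ('a \<Rightarrow> real) set" where
  "Ccp X = {f \<in> Cc X. \<forall>x\<in>topspace X. 0 \<le> f x}"

lemma Ccp_add: "f \<in> Ccp X \<Longrightarrow> g \<in> Ccp X \<Longrightarrow> (\<lambda>x. f x + g x) \<in> Ccp X"
  by (auto simp: Ccp_def Cc_add)

lemma Ccp_scale: "f \<in> Ccp X \<Longrightarrow> 0 \<le> c \<Longrightarrow> (\<lambda>x. c * f x) \<in> Ccp X"
  by (auto simp: Ccp_def Cc_scale)

lemma Ccp_pos: "f \<in> Cc X \<Longrightarrow> (\<lambda>x. max (f x) 0) \<in> Ccp X"
  by (auto simp: Ccp_def Cc_max0)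

lemma Ccp_neg: "f \<in> Cc X \<Longrightarrow> (\<lambda>x. max (- f x) 0) \<in> Ccp X"
  by (auto intro: Ccp_pos Cc_uminus)

text \<open>Normalised covering numbers become additive in the limit on nonnegative functions only,
  so the limit is extended to all of \<open>Cc X\<close> by positive and negative parts.\<close>

lemma positive_functional_extension:
  fixes I :: "('a \<Rightarrow> real) \<Rightarrow> real"
  assumes add: "\<And>f g. f \<in> Ccp X \<Longrightarrow> g \<in> Ccp X \<Longrightarrow> I (\<lambda>x. f x + g x) = I f + I g"
    and scale: "\<And>f c. f \<in> Ccp X \<Longrightarrow> 0 < c \<Longrightarrow> I (\<lambda>x. c * f x) = c * I f"
    and nonneg: "\<And>f. f \<in> Ccp X \<Longrightarrow> 0 \<le> I f"
    and cong: "\<And>f g. f \<in> Ccp X \<Longrightarrow> g \<in> Ccp X \<Longrightarrow> (\<And>x. x \<in> topspace X \<Longrightarrow> f x = g x) \<Longrightarrow> I f = I g"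
  shows "positive_functional X (\<lambda>f. I (\<lambda>x. max (f x) 0) - I (\<lambda>x. max (- f x) 0))"
    (is "positive_functional X ?J")
proof -
  have z: "(\<lambda>x. 0) \<in> Ccp X" by (simp add: Ccp_def Cc_zero)
  have I0: "I (\<lambda>x. 0) = 0" using add[OF z z] by simp
  show ?thesis
    unfolding positive_functional_def
  proof (intro conjI ballI allI impI)
    fix f g assume f: "f \<in> Cc X" and g: "g \<in> Cc X"
    note fg = Cc_add[OF f g]
    \<comment> \<open>The positive part of a sum is not the sum of the positive parts; in this
      rearrangement all terms are nonnegative, so additivity applies on both sides.\<close>
    have "(\<lambda>x. (max (f x + g x) 0 + max (- f x) 0) + max (- g x) 0) =
          (\<lambda>x. (max (f x) 0 + max (g x) 0) + max (- (f x + g x)) 0)"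
      by (auto simp: fun_eq_iff max_def)
    then have "I (\<lambda>x. (max (f x + g x) 0 + max (- f x) 0) + max (- g x) 0) =
          I (\<lambda>x. (max (f x) 0 + max (g x) 0) + max (- (f x + g x)) 0)" by (rule arg_cong)
    then have "I (\<lambda>x. max (f x + g x) 0) + I (\<lambda>x. max (- f x) 0) + I (\<lambda>x. max (- g x) 0) =
       I (\<lambda>x. max (f x) 0) + I (\<lambda>x. max (g x) 0) + I (\<lambda>x. max (- (f x + g x)) 0)"
      unfolding add[OF Ccp_add[OF Ccp_pos[OF fg] Ccp_neg[OF f]] Ccp_neg[OF g]] add[OF Ccp_pos[OF fg] Ccp_neg[OF f]]
        add[OF Ccp_add[OF Ccp_pos[OF f] Ccp_pos[OF g]] Ccp_neg[OF fg]] add[OF Ccp_pos[OF f] Ccp_pos[OF g]] .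
    then show "?J (\<lambda>x. f x + g x) = ?J f + ?J g" by simp
  next
    fix c :: real and f assume f: "f \<in> Cc X"
    consider "c = 0" | "c > 0" | "c < 0" by linarith
    then show "?J (\<lambda>x. c * f x) = c * ?J f"
    proof cases
      case 1 then show ?thesis using I0 by simp
    next
      case 2
      have "(\<lambda>x. max (c * f x) 0) = (\<lambda>x. c * max (f x) 0)" "(\<lambda>x. max (- (c * f x)) 0) = (\<lambda>x. c * max (- f x) 0)"
        using 2 by (auto simp: fun_eq_iff max_def zero_le_mult_iff mult_le_0_iff)
      then show ?thesis using scale[OF Ccp_pos[OF f] 2] scale[OF Ccp_neg[OF f] 2] by (simp add: algebra_simps)
    next
      case 3
      have eq: "(\<lambda>x. max (c * f x) 0) = (\<lambda>x. (- c) * max (- f x) 0)" "(\<lambda>x. max (- (c * f x)) 0) = (\<lambda>x. (- c) * max (f x) 0)"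
        using 3 by (auto simp: fun_eq_iff max_def zero_le_mult_iff mult_le_0_iff)
      show ?thesis unfolding eq using scale[OF Ccp_pos[OF f], of "-c"] scale[OF Ccp_neg[OF f], of "-c"] 3
        by (simp add: algebra_simps)
    qed
  next
    fix f assume f: "f \<in> Cc X" "\<forall>x\<in>topspace X. 0 \<le> f x"
    have "I (\<lambda>x. max (- f x) 0) = I (\<lambda>x. 0)"
      using f by (intro cong Ccp_neg z) auto
    then show "0 \<le> ?J f" using I0 nonneg[OF Ccp_pos[OF f(1)]] by simp
  qed
qed

context locally_compact_group
begin

definition covers :: "('a \<Rightarrow> real) \<Rightarrow> ('a \<Rightarrow> real) \<Rightarrow> (real \<times> 'a) list \<Rightarrow> bool" where
  "covers f p cs \<longleftrightarrow> (\<forall>q\<in>set cs. 0 \<le> fst q \<and> snd q \<in> carrier G) \<and>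
     (\<forall>x\<in>carrier G. f x \<le> (\<Sum>q\<leftarrow>cs. fst q * p (snd q \<otimes> x)))"

text \<open>Weil's covering number \<open>(f : p)\<close>.\<close>

definition cov :: "('a \<Rightarrow> real) \<Rightarrow> ('a \<Rightarrow> real) \<Rightarrow> real" where
  "cov f p = Inf {sum_list (map fst cs) | cs. covers f p cs}"

definition nontrivial :: "('a \<Rightarrow> real) \<Rightarrow> bool" where
  "nontrivial p \<longleftrightarrow> p \<in> Ccp T \<and> (\<exists>t\<in>carrier G. 0 < p t)"

lemma covers_nonneg: "covers f p cs \<Longrightarrow> 0 \<le> sum_list (map fst cs)"
  by (intro sum_list_nonneg) (auto simp: covers_def)

lemma cov_le: "covers f p cs \<Longrightarrow> cov f p \<le> sum_list (map fst cs)"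
  unfolding cov_def by (intro cInf_lower bdd_belowI[of _ 0]) (auto intro: covers_nonneg)

lemma covers_exists:
  assumes "f \<in> Cc T" "nontrivial p"
  shows "\<exists>cs. covers f p cs"
proof -
  obtain t where t: "t \<in> carrier G" "0 < p t" using assms(2) by (auto simp: nontrivial_def)
  have p: "p \<in> Cc T" "\<And>x. x \<in> carrier G \<Longrightarrow> 0 \<le> p x"
    using assms(2) by (auto simp: nontrivial_def Ccp_def topspace_eq)
  obtain ss where "set ss \<subseteq> carrier G" "\<And>x. x \<in> carrier G \<Longrightarrow> f x \<le> (\<Sum>s\<leftarrow>ss. p (s \<otimes> x))"
    using finite_translates_cover[OF assms(1) Cc_continuous[OF p(1)] p(2) t] by metis
  then have "covers f p (map (Pair 1) ss)" by (auto simp: covers_def o_def)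
  then show ?thesis by blast
qed

lemma cov_ge:
  assumes "f \<in> Cc T" "nontrivial p" "\<And>cs. covers f p cs \<Longrightarrow> z \<le> sum_list (map fst cs)"
  shows "z \<le> cov f p"
  unfolding cov_def using covers_exists[OF assms(1,2)] assms(3) by (intro cInf_greatest) auto

lemma cov_nonneg: "f \<in> Cc T \<Longrightarrow> nontrivial p \<Longrightarrow> 0 \<le> cov f p"
  by (rule cov_ge) (auto intro: covers_nonneg)

lemma cov_cong: "(\<And>x. x \<in> carrier G \<Longrightarrow> f x = g x) \<Longrightarrow> cov f p = cov g p"
  unfolding cov_def covers_def by simp

lemma cov_ltrans_le:
  assumes f: "f \<in> Cc T" and p: "nontrivial p" and a: "a \<in> carrier G"
  shows "cov (\<lambda>x. f (a \<otimes> x)) p \<le> cov f p"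
proof (rule cov_ge[OF f p])
  fix cs assume cs: "covers f p cs"
  let ?ds = "map (\<lambda>q. (fst q, snd q \<otimes> a)) cs"
  have "covers (\<lambda>x. f (a \<otimes> x)) p ?ds"
    unfolding covers_def
  proof (intro conjI ballI)
    fix x assume x: "x \<in> carrier G"
    have "f (a \<otimes> x) \<le> (\<Sum>q\<leftarrow>cs. fst q * p (snd q \<otimes> (a \<otimes> x)))" using cs a x by (simp add: covers_def)
    also have "\<dots> = (\<Sum>q\<leftarrow>cs. fst q * p (snd q \<otimes> a \<otimes> x))"
      using cs a x by (intro arg_cong[of _ _ sum_list] map_cong) (auto simp: covers_def m_assoc)
    finally show "f (a \<otimes> x) \<le> (\<Sum>q\<leftarrow>?ds. fst q * p (snd q \<otimes> x))" by (simp add: o_def)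
  qed (use cs a in \<open>auto simp: covers_def\<close>)
  from cov_le[OF this] show "cov (\<lambda>x. f (a \<otimes> x)) p \<le> sum_list (map fst cs)" by (simp add: o_def)
qed

lemma cov_ltrans:
  assumes f: "f \<in> Cc T" and p: "nontrivial p" and a: "a \<in> carrier G"
  shows "cov (\<lambda>x. f (a \<otimes> x)) p = cov f p"
proof (rule antisym[OF cov_ltrans_le[OF assms]])
  have "cov (\<lambda>x. f (a \<otimes> (inv a \<otimes> x))) p \<le> cov (\<lambda>x. f (a \<otimes> x)) p"
    using a by (intro cov_ltrans_le[OF Cc_ltrans[OF f a] p]) auto
  then show "cov f p \<le> cov (\<lambda>x. f (a \<otimes> x)) p"
    using cov_cong[of f "\<lambda>x. f (a \<otimes> (inv a \<otimes> x))" p] a by (simp add: m_assoc[symmetric])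
qed

lemma cov_add:
  assumes f: "f \<in> Cc T" and g: "g \<in> Cc T" and p: "nontrivial p"
  shows "cov (\<lambda>x. f x + g x) p \<le> cov f p + cov g p"
proof -
  have "cov (\<lambda>x. f x + g x) p \<le> sum_list (map fst cs) + sum_list (map fst ds)"
    if "covers f p cs" "covers g p ds" for cs ds
  proof -
    have "covers (\<lambda>x. f x + g x) p (cs @ ds)"
      using that by (auto simp: covers_def intro!: add_mono)
    from cov_le[OF this] show ?thesis by simp
  qed
  then have "cov (\<lambda>x. f x + g x) p - sum_list (map fst ds) \<le> cov f p" if "covers g p ds" for ds
    using that by (intro cov_ge[OF f p]) (simp add: le_diff_eq diff_le_eq)
  then have "cov (\<lambda>x. f x + g x) p - cov f p \<le> cov g p"
    by (intro cov_ge[OF g p]) (simp add: diff_le_eq add.commute)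
  then show ?thesis by simp
qed

lemma cov_scale_le:
  assumes f: "f \<in> Cc T" and p: "nontrivial p" and c: "0 < c"
  shows "cov (\<lambda>x. c * f x) p \<le> c * cov f p"
proof -
  have "cov (\<lambda>x. c * f x) p / c \<le> cov f p"
  proof (rule cov_ge[OF f p])
    fix cs assume cs: "covers f p cs"
    let ?ds = "map (\<lambda>q. (c * fst q, snd q)) cs"
    have "covers (\<lambda>x. c * f x) p ?ds"
      using cs c by (auto simp: covers_def o_def mult.assoc sum_list_const_mult intro!: mult_left_mono)
    from cov_le[OF this] show "cov (\<lambda>x. c * f x) p / c \<le> sum_list (map fst cs)"
      using c by (simp add: o_def sum_list_const_mult divide_le_eq mult.commute)
  qed
  then show ?thesis using c by (simp add: divide_le_eq mult.commute)
qed

lemma cov_scale: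
  assumes f: "f \<in> Cc T" and p: "nontrivial p" and c: "0 < c"
  shows "cov (\<lambda>x. c * f x) p = c * cov f p"
proof (rule antisym[OF cov_scale_le[OF assms]])
  have "cov (\<lambda>x. (1 / c) * (c * f x)) p \<le> (1 / c) * cov (\<lambda>x. c * f x) p"
    using c by (intro cov_scale_le[OF Cc_scale[OF f] p]) auto
  then show "c * cov f p \<le> cov (\<lambda>x. c * f x) p" using c by (simp add: field_simps)
qed

text \<open>Inserting a cover of \<open>p\<close> by \<open>q\<close> into a cover of
  \<open>f\<close> by \<open>p\<close> multiplies the totals.\<close>

lemma cov_trans:
  assumes f: "f \<in> Cc T" and p: "nontrivial p" and q: "nontrivial q"
  shows "cov f q \<le> cov f p * cov p q"
proof -
  have pC: "p \<in> Cc T" using p by (simp add: nontrivial_def Ccp_def)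
  have *: "cov f q \<le> sum_list (map fst cs) * sum_list (map fst ds)"
    if cs: "covers f p cs" and ds: "covers p q ds" for cs ds
  proof -
    let ?es = "concat (map (\<lambda>u. map (\<lambda>v. (fst u * fst v, snd v \<otimes> snd u)) ds) cs)"
    have "covers f q ?es"
      unfolding covers_def
    proof (intro conjI ballI)
      fix w assume "w \<in> set ?es"
      then obtain u v where "u \<in> set cs" "v \<in> set ds" "w = (fst u * fst v, snd v \<otimes> snd u)" by auto
      then show "0 \<le> fst w" "snd w \<in> carrier G" using cs ds by (auto simp: covers_def)
    next
      fix x assume x: "x \<in> carrier G"
      have "f x \<le> (\<Sum>u\<leftarrow>cs. fst u * p (snd u \<otimes> x))" using cs x by (simp add: covers_def)
      also have "\<dots> \<le> (\<Sum>u\<leftarrow>cs. fst u * (\<Sum>v\<leftarrow>ds. fst v * q (snd v \<otimes> (snd u \<otimes> x))))"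
        using cs ds x by (intro sum_list_mono mult_left_mono) (auto simp: covers_def)
      also have "\<dots> = (\<Sum>u\<leftarrow>cs. \<Sum>v\<leftarrow>ds. fst u * fst v * q (snd v \<otimes> snd u \<otimes> x))"
      proof (intro arg_cong[of _ _ sum_list] map_cong refl)
        fix u assume u: "u \<in> set cs"
        have "fst u * (\<Sum>v\<leftarrow>ds. fst v * q (snd v \<otimes> (snd u \<otimes> x))) =
            (\<Sum>v\<leftarrow>ds. fst u * (fst v * q (snd v \<otimes> (snd u \<otimes> x))))" by (simp add: sum_list_const_mult)
        also have "\<dots> = (\<Sum>v\<leftarrow>ds. fst u * fst v * q (snd v \<otimes> snd u \<otimes> x))"
          using cs ds u x by (intro arg_cong[of _ _ sum_list] map_cong) (auto simp: covers_def m_assoc)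
        finally show "fst u * (\<Sum>v\<leftarrow>ds. fst v * q (snd v \<otimes> (snd u \<otimes> x))) =
            (\<Sum>v\<leftarrow>ds. fst u * fst v * q (snd v \<otimes> snd u \<otimes> x))" .
      qed
      also have "\<dots> = (\<Sum>w\<leftarrow>?es. fst w * q (snd w \<otimes> x))"
        by (induction cs) (auto simp: o_def)
      finally show "f x \<le> (\<Sum>w\<leftarrow>?es. fst w * q (snd w \<otimes> x))" .
    qed
    from cov_le[OF this] have "cov f q \<le> sum_list (map fst ?es)" .
    also have "\<dots> = sum_list (map fst cs) * sum_list (map fst ds)"
      by (induction cs) (auto simp: o_def algebra_simps sum_list_const_mult)
    finally show ?thesis .
  qed
  \<comment> \<open>Passes to the infimum \<open>d\<close> of the second factor; for
    \<open>c = 0\<close> the existence of one admissible \<open>e\<close> replaces the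
    division.\<close>
  have le_mult: "x \<le> c * d" if "0 \<le> (c::real)" "0 \<le> d" "\<And>e. P e \<Longrightarrow> x \<le> c * e" "\<And>z. (\<And>e. P e \<Longrightarrow> z \<le> e) \<Longrightarrow> z \<le> d"
      "\<exists>e. P e" for x c d :: real and P
  proof (cases "c = 0")
    case True then show ?thesis using that by auto
  next
    case False
    then have "x / c \<le> d" using that(1,3) by (intro that(4)) (auto simp: divide_le_eq mult.commute)
    then show ?thesis using False that(1) by (simp add: divide_le_eq mult.commute)
  qed
  have 1: "cov f q \<le> sum_list (map fst cs) * cov p q" if cs: "covers f p cs" for cs
    by (rule le_mult[where P = "\<lambda>e. \<exists>ds. covers p q ds \<and> e = sum_list (map fst ds)"])
      (use covers_nonneg[OF cs] cov_nonneg[OF pC q] *[OF cs] cov_ge[OF pC q] covers_exists[OF pC q] in blast)+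
  have 2: "cov f q \<le> cov p q * sum_list (map fst cs)" if "covers f p cs" for cs
    using 1[OF that] by (simp add: mult.commute)
  have "cov f q \<le> cov p q * cov f p"
    by (rule le_mult[where P = "\<lambda>e. \<exists>ds. covers f p ds \<and> e = sum_list (map fst ds)"])
      (use cov_nonneg[OF f p] cov_nonneg[OF pC q] 2 cov_ge[OF f p] covers_exists[OF f p] in blast)+
  then show ?thesis by (simp add: mult.commute)
qed

text \<open>Evaluated at a point \<open>t\<close> where \<open>f\<close> is positive, a cover with
  total \<open>S\<close> gives \<open>f t \<le> S * M\<close>, with \<open>M\<close> a bound for
  \<open>p\<close>.\<close>

lemma cov_pos:
  assumes f: "nontrivial f" and p: "nontrivial p"
  shows "0 < cov f p"
proof -
  obtain t where t: "t \<in> carrier G" "0 < f t" using f by (auto simp: nontrivial_def)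
  obtain M where M: "M > 0" "\<And>x. x \<in> topspace T \<Longrightarrow> \<bar>p x\<bar> \<le> M"
    using Cc_bounded[of p T] p by (auto simp: nontrivial_def Ccp_def)
  have "f t / M \<le> cov f p"
  proof (rule cov_ge[OF _ p])
    fix cs assume cs: "covers f p cs"
    have "f t \<le> (\<Sum>q\<leftarrow>cs. fst q * p (snd q \<otimes> t))" using cs t by (simp add: covers_def)
    also have "\<dots> \<le> (\<Sum>q\<leftarrow>cs. fst q * M)"
    proof (intro sum_list_mono mult_left_mono)
      fix q assume "q \<in> set cs"
      then show "p (snd q \<otimes> t) \<le> M" "0 \<le> fst q" using cs t M(2)[of "snd q \<otimes> t"] by (auto simp: covers_def topspace_eq)
    qed
    finally show "f t / M \<le> sum_list (map fst cs)"
      using M(1) by (simp add: sum_list_mult_const divide_le_eq)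
  qed (use f in \<open>simp add: nontrivial_def Ccp_def\<close>)
  then show ?thesis using t M by (meson divide_pos_pos less_le_trans)
qed

text \<open>Weil's splitting. Dividing by \<open>F\<close>, which is slightly larger than
  \<open>f + g\<close>, gives \<open>q f\<close> and \<open>q g\<close> with sum at most 1. If
  \<open>p\<close> lives near the identity, each of them is almost constant on a translate of
  \<open>p\<close>, so a cover of \<open>F\<close> splits into covers of \<open>f\<close> and
  \<open>g\<close> whose weights add up to little more than the original ones. The error is measured
  by \<open>cov h p\<close> because the functionals are later normalised by it.\<close>

lemma cov_approx_additive:
  assumes f: "f \<in> Ccp T" and g: "g \<in> Ccp T" and h: "nontrivial h" and e: "0 < e"
  obtains U where "openin T U" "\<one> \<in> U"
    "\<And>p. nontrivial p \<Longrightarrow> (\<And>x. x \<in> carrier G \<Longrightarrow> x \<notin> U \<Longrightarrow> p x = 0) \<Longrightarrow>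
       cov f p + cov g p \<le> cov (\<lambda>x. f x + g x) p + e * cov h p"
proof -
  have fC: "f \<in> Cc T" "\<And>x. x \<in> carrier G \<Longrightarrow> 0 \<le> f x" and gC: "g \<in> Cc T" "\<And>x. x \<in> carrier G \<Longrightarrow> 0 \<le> g x"
    using f g by (auto simp: Ccp_def topspace_eq)
  have hC: "h \<in> Cc T" using h by (simp add: nontrivial_def Ccp_def)
  obtain K where K: "compactin T K" "\<And>x. x \<in> topspace T \<Longrightarrow> x \<notin> K \<Longrightarrow> f x = 0" using CcE[OF fC(1)] by metis
  obtain L where L: "compactin T L" "\<And>x. x \<in> topspace T \<Longrightarrow> x \<notin> L \<Longrightarrow> g x = 0" using CcE[OF gC(1)] by metis
  obtain k where k: "k \<in> Cc T" "\<And>x. x \<in> topspace T \<Longrightarrow> 0 \<le> k x" "\<And>x. x \<in> K \<union> L \<Longrightarrow> k x = (1::real)"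
    using bump_compact[OF locally_compact Hausdorff compactin_Un[OF K(1) L(1)]] by metis
  define s where "s x = f x + g x" for x
  have s: "s \<in> Cc T" unfolding s_def[abs_def] using fC gC by (intro Cc_add)
  define A where "A = cov s h"
  define B where "B = cov k h"
  have AB: "0 \<le> A" "0 \<le> B" unfolding A_def B_def using cov_nonneg s k(1) h by auto
  \<comment> \<open>Makes the final excess fit into \<open>e * cov h p\<close>: expanding
    \<open>(1 + 2 * d) * (cov s p + d * cov k p)\<close> and using \<open>d \<le> 1\<close> leaves
    at most \<open>d * (2 * A + 3 * B) * cov h p\<close> beyond \<open>cov s p\<close>.\<close>
  define d where "d = min 1 (e / (2 * A + 3 * B + 1))"
  have d: "0 < d" "d \<le> 1" unfolding d_def using e AB by auto
  have "d * (2 * A + 3 * B + 1) \<le> e"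
  proof -
    have "d \<le> e / (2 * A + 3 * B + 1)" by (simp add: d_def)
    then show ?thesis using AB by (simp add: field_simps)
  qed
  then have de: "d * (2 * A + 3 * B) \<le> e" using d by (simp add: algebra_simps)
  define F where "F x = s x + d * k x" for x
  have F: "F \<in> Cc T" unfolding F_def[abs_def] using s k by (intro Cc_add Cc_scale)
  \<comment> \<open>On \<open>K \<union> L\<close>, where \<open>f\<close> or \<open>g\<close> can
    be non-zero, \<open>k = 1\<close> gives \<open>F \<ge> d\<close>, so the maximum changes
    nothing; elsewhere it keeps the inverse continuous.\<close>
  define q where "q u x = u x * inverse (max (F x) d)" for u x
  have qC: "q u \<in> Cc T" if "u \<in> Cc T" for u
    unfolding q_def[abs_def] using that Cc_continuous[OF F] d
    by (intro Cc_mult continuous_map_real_inverse continuous_map_real_max) auto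
  have Fd: "d \<le> F x" if "x \<in> carrier G" "x \<in> K \<union> L" for x
    using that fC(2) gC(2) k(3) by (simp add: F_def s_def add_nonneg_nonneg)
  have qF: "u x = q u x * F x" if "x \<in> carrier G" "u = f \<or> u = g" for u x
  proof (cases "x \<in> K \<union> L")
    case True
    then show ?thesis using Fd[OF that(1) True] d by (simp add: q_def max_def)
  next
    case False
    then show ?thesis using that K(2) L(2) by (auto simp: q_def topspace_eq)
  qed
  have q0: "0 \<le> q u x" if "x \<in> carrier G" "u = f \<or> u = g" for u x
    using that fC(2) gC(2) d by (auto simp: q_def intro!: mult_nonneg_nonneg)
  have F0: "s x \<le> F x" if "x \<in> carrier G" for x
    using that k(2) d by (simp add: F_def topspace_eq)
  have q1: "q f x + q g x \<le> 1" if x: "x \<in> carrier G" for x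
  proof -
    have "q f x + q g x = s x / max (F x) d" by (simp add: q_def s_def divide_inverse algebra_simps)
    also have "\<dots> \<le> 1" using F0[OF x] d by (simp add: divide_le_eq le_max_iff_disj)
    finally show ?thesis .
  qed
  obtain U1 where U1: "openin T U1" "\<one> \<in> U1" "\<And>u x. u \<in> U1 \<Longrightarrow> x \<in> carrier G \<Longrightarrow> \<bar>q f (x \<otimes> u) - q f x\<bar> \<le> d"
    using uniform_translate_near_one(2)[OF qC[OF fC(1)] d(1)] by blast
  obtain U2 where U2: "openin T U2" "\<one> \<in> U2" "\<And>u x. u \<in> U2 \<Longrightarrow> x \<in> carrier G \<Longrightarrow> \<bar>q g (x \<otimes> u) - q g x\<bar> \<le> d"
    using uniform_translate_near_one(2)[OF qC[OF gC(1)] d(1)] by blast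
  show thesis
  proof (rule that[of "U1 \<inter> U2"])
    fix p assume p: "nontrivial p" and supp: "\<And>x. x \<in> carrier G \<Longrightarrow> x \<notin> U1 \<inter> U2 \<Longrightarrow> p x = 0"
    have p0: "0 \<le> p x" if "x \<in> carrier G" for x using p that by (auto simp: nontrivial_def Ccp_def topspace_eq)
    have one: "cov u p \<le> (\<Sum>c\<leftarrow>cs. fst c * (q u (inv (snd c)) + d))"
      if cs: "covers F p cs" and u: "u = f \<or> u = g" for u cs
    proof -
      let ?ds = "map (\<lambda>c. (fst c * (q u (inv (snd c)) + d), snd c)) cs"
      have "covers u p ?ds"
        unfolding covers_def
      proof (intro conjI ballI)
        fix x assume x: "x \<in> carrier G"
        have "u x = q u x * F x" using qF[OF x u] .
        also have "\<dots> \<le> q u x * (\<Sum>c\<leftarrow>cs. fst c * p (snd c \<otimes> x))"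
          using cs x q0[OF x u] by (intro mult_left_mono) (auto simp: covers_def)
        also have "\<dots> = (\<Sum>c\<leftarrow>cs. fst c * q u x * p (snd c \<otimes> x))"
          by (simp add: sum_list_const_mult[symmetric] mult_ac)
        also have "\<dots> \<le> (\<Sum>c\<leftarrow>cs. fst c * (q u (inv (snd c)) + d) * p (snd c \<otimes> x))"
        proof (rule sum_list_mono)
          fix c assume c: "c \<in> set cs"
          then have sc: "snd c \<in> carrier G" "0 \<le> fst c" using cs by (auto simp: covers_def)
          show "fst c * q u x * p (snd c \<otimes> x) \<le> fst c * (q u (inv (snd c)) + d) * p (snd c \<otimes> x)"
          proof (cases "snd c \<otimes> x \<in> U1 \<inter> U2")
            case True
            \<comment> \<open>The point \<open>x\<close> is the right translate of
              \<open>inv (snd c)\<close> by \<open>snd c \<otimes> x\<close>, an element of the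
              small neighbourhood; this is why right translates have to be uniformly close.\<close>
            have "inv (snd c) \<otimes> (snd c \<otimes> x) = x" using sc x by (simp add: m_assoc[symmetric])
            then have "\<bar>q u x - q u (inv (snd c))\<bar> \<le> d"
              using U1(3)[of "snd c \<otimes> x" "inv (snd c)"] U2(3)[of "snd c \<otimes> x" "inv (snd c)"] True sc u by auto
            then have "q u x \<le> q u (inv (snd c)) + d" by linarith
            then show ?thesis using sc p0[of "snd c \<otimes> x"] x by (intro mult_right_mono mult_left_mono) auto
          next
            case False
            then show ?thesis using supp sc x by simp
          qed
        qed
        finally show "u x \<le> (\<Sum>c\<leftarrow>?ds. fst c * p (snd c \<otimes> x))" by (simp add: o_def)
      qed (use cs q0[OF _ u] d in \<open>auto simp: covers_def intro!: mult_nonneg_nonneg add_nonneg_nonneg\<close>)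
      from cov_le[OF this] show ?thesis by (simp add: o_def)
    qed
    have "(cov f p + cov g p) / (1 + 2 * d) \<le> cov F p"
    proof (rule cov_ge[OF F p])
      fix cs assume cs: "covers F p cs"
      have "cov f p + cov g p \<le> (\<Sum>c\<leftarrow>cs. fst c * (q f (inv (snd c)) + d)) + (\<Sum>c\<leftarrow>cs. fst c * (q g (inv (snd c)) + d))"
        using one[OF cs] by (intro add_mono) auto
      also have "\<dots> = (\<Sum>c\<leftarrow>cs. fst c * (q f (inv (snd c)) + q g (inv (snd c)) + 2 * d))"
        by (simp add: sum_list_addf[symmetric] algebra_simps)
      also have "\<dots> \<le> (\<Sum>c\<leftarrow>cs. fst c * (1 + 2 * d))"
        using cs q1 by (intro sum_list_mono mult_left_mono add_right_mono) (auto simp: covers_def)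
      finally show "(cov f p + cov g p) / (1 + 2 * d) \<le> sum_list (map fst cs)"
        using d by (simp add: sum_list_mult_const divide_le_eq)
    qed
    then have "cov f p + cov g p \<le> (1 + 2 * d) * cov F p" using d by (simp add: divide_le_eq mult.commute)
    also have "cov F p \<le> cov s p + d * cov k p"
      unfolding F_def[abs_def] using cov_add[OF s Cc_scale[OF k(1)] p, of d] cov_scale[OF k(1) p d(1)] by simp
    also have "(1 + 2 * d) * (cov s p + d * cov k p) = cov s p + d * (2 * cov s p) + (d * (1 + 2 * d)) * cov k p"
      by (simp add: algebra_simps)
    also have "\<dots> \<le> cov s p + d * (2 * cov s p) + (d * 3) * cov k p"
      using d cov_nonneg[OF k(1) p] by (intro add_mono mult_right_mono mult_left_mono) auto
    also have "\<dots> = cov s p + d * (2 * cov s p + 3 * cov k p)" by (simp add: algebra_simps)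
    also have "\<dots> \<le> cov s p + d * (2 * (A * cov h p) + 3 * (B * cov h p))"
      unfolding A_def B_def using d cov_trans[OF s h p] cov_trans[OF k(1) h p]
      by (intro add_mono mult_left_mono) auto
    also have "\<dots> = cov s p + (d * (2 * A + 3 * B)) * cov h p" by (simp add: algebra_simps)
    also have "\<dots> \<le> cov s p + e * cov h p"
      using de cov_nonneg[OF hC p] by (intro add_mono mult_right_mono) auto
    finally show "cov f p + cov g p \<le> cov (\<lambda>x. f x + g x) p + e * cov h p"
      using d by (simp add: s_def[abs_def])
  qed (use U1 U2 in auto)
qed

text \<open>The normalised functionals \<open>I p\<close> lie in a product of intervals, compact by
  Tychonoff. A point \<open>J\<close> that is in the closure of the \<open>I p\<close> with
  \<open>p\<close> supported in \<open>U\<close>, for every neighbourhood \<open>U\<close> of the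
  identity, inherits each closed condition valid for all sufficiently concentrated \<open>p\<close>.
  Approximate additivity with arbitrary \<open>e\<close> then becomes additivity.\<close>

theorem left_Haar_exists: "\<exists>J h. left_Haar J \<and> h \<in> Cc T \<and> J h \<noteq> 0"
proof -
  have 1: "compactin T {\<one>}" by (simp add: topspace_eq)
  obtain h where h: "h \<in> Cc T" "\<And>x. x \<in> topspace T \<Longrightarrow> 0 \<le> h x" "h \<one> = (1::real)"
    using bump_compact[OF locally_compact Hausdorff 1] by (metis singletonI)
  have hN: "nontrivial h" using h by (auto simp: nontrivial_def Ccp_def intro!: bexI[of _ \<one>])
  have CcpC: "f \<in> Cc T" if "f \<in> Ccp T" for f using that by (simp add: Ccp_def)
  define I where "I p f = (if f \<in> Ccp T then cov f p / cov h p else 0)" for p f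
  \<comment> \<open>\<open>cov_trans\<close> bounds \<open>cov f p / cov h p\<close> by
    \<open>cov f h\<close>, independently of \<open>p\<close>.\<close>
  define b where "b f = (if f \<in> Ccp T then cov f h else 0)" for f
  define S where "S = {J. \<forall>f. J f \<in> {0..b f}}"
  have S: "compact S"
  proof -
    have "compactin (product_topology (\<lambda>_. euclideanreal) UNIV) (PiE UNIV (\<lambda>f. {0..b f}))"
      by (subst compactin_PiE) auto
    moreover have "PiE UNIV (\<lambda>f. {0..b f}) = S" by (auto simp: S_def PiE_def Pi_def)
    ultimately show ?thesis by (simp add: euclidean_product_topology)
  qed
  define N where "N = {U. openin T U \<and> \<one> \<in> U}"
  define A where "A U = {I p |p. nontrivial p \<and> (\<forall>x\<in>carrier G. x \<notin> U \<longrightarrow> p x = 0)}" for U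
  have IS: "I p \<in> S" if p: "nontrivial p" for p
    using cov_nonneg[OF CcpC p] cov_pos[OF hN p] cov_trans[OF CcpC hN p]
    by (auto simp: S_def I_def b_def divide_le_eq)
  \<comment> \<open>Finite intersections are non-empty because a bump at the identity can be
    supported in any finite intersection of neighbourhoods.\<close>
  have "S \<inter> (\<Inter>U\<in>N. closure (A U)) \<noteq> {}"
  proof (rule compact_imp_fip_image[OF S])
    fix M assume M: "finite M" "M \<subseteq> N"
    have V: "openin T (topspace T \<inter> \<Inter>M)" using M by (intro openin_Int_Inter) (auto simp: N_def)
    have V1: "{\<one>} \<subseteq> topspace T \<inter> \<Inter>M" using M by (auto simp: N_def topspace_eq)
    obtain p where p: "p \<in> Cc T" "\<And>x. x \<in> topspace T \<Longrightarrow> 0 \<le> p x" "p \<one> = (1::real)"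
       "\<And>x. x \<in> topspace T \<Longrightarrow> x \<notin> topspace T \<inter> \<Inter>M \<Longrightarrow> p x = 0"
      using bump[OF locally_compact Hausdorff 1 V V1] by (metis singletonI)
    have pN: "nontrivial p" using p by (auto simp: nontrivial_def Ccp_def intro!: bexI[of _ \<one>])
    have "I p \<in> A U" if "U \<in> M" for U
      unfolding A_def using pN p(4) that by (auto simp: topspace_eq)
    then have "I p \<in> S \<inter> (\<Inter>U\<in>M. closure (A U))" using IS[OF pN] closure_subset by blast
    then show "S \<inter> (\<Inter>U\<in>M. closure (A U)) \<noteq> {}" by blast
  qed auto
  then obtain J where J: "J \<in> S" "\<And>U. U \<in> N \<Longrightarrow> J \<in> closure (A U)" by blast
  have lim: "J \<in> Z" if "closed Z" "U \<in> N" "\<And>p. nontrivial p \<Longrightarrow> (\<And>x. x \<in> carrier G \<Longrightarrow> x \<notin> U \<Longrightarrow> p x = 0) \<Longrightarrow> I p \<in> Z" for Z U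
  proof -
    have "A U \<subseteq> Z" using that(3) by (auto simp: A_def)
    then show ?thesis using closure_minimal[of "A U" Z] that(1) J(2)[OF that(2)] by blast
  qed
  have ev: "continuous_on UNIV (\<lambda>J::('a \<Rightarrow> real) \<Rightarrow> real. J f)" for f by simp
  have top: "topspace T \<in> N"
    unfolding N_def using openin_topspace[of T] one_closed unfolding topspace_eq by simp
  have lim_eq: "a J = b J"
    if "continuous_on UNIV a" "continuous_on UNIV b" "\<And>p. nontrivial p \<Longrightarrow> a (I p) = b (I p)"
    for a b :: "(('a \<Rightarrow> real) \<Rightarrow> real) \<Rightarrow> real"
    using lim[OF closed_Collect_eq[OF that(1,2)] top] that(3) by simp
  have J0: "0 \<le> J f" for f using J(1) by (auto simp: S_def)
  have Jcong: "J f = J g" if "f \<in> Ccp T" "g \<in> Ccp T" "\<And>x. x \<in> topspace T \<Longrightarrow> f x = g x" for f g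
    by (rule lim_eq[of "\<lambda>J. J f" "\<lambda>J. J g", OF ev ev]) (use that cov_cong[of f g] in \<open>auto simp: I_def topspace_eq\<close>)
  have Jscale: "J (\<lambda>x. c * f x) = c * J f" if "f \<in> Ccp T" "0 < c" for f c
    by (rule lim_eq[of "\<lambda>J. J (\<lambda>x. c * f x)" "\<lambda>J. c * J f", OF ev continuous_on_mult[OF continuous_on_const ev]])
      (use that Ccp_scale[of f T c] cov_scale[OF CcpC] in \<open>auto simp: I_def\<close>)
  have Jadd: "J (\<lambda>x. f x + g x) = J f + J g" if f: "f \<in> Ccp T" and g: "g \<in> Ccp T" for f g
  proof (rule antisym)
    have "J \<in> {J. J (\<lambda>x. f x + g x) \<le> J f + J g}"
    proof (rule lim[OF closed_Collect_le[OF ev continuous_on_add[OF ev ev]] top])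
      fix p assume p: "nontrivial p"
      show "I p \<in> {J. J (\<lambda>x. f x + g x) \<le> J f + J g}"
        using f g Ccp_add[OF f g] cov_add[OF CcpC[OF f] CcpC[OF g] p] cov_pos[OF hN p]
        by (simp add: I_def add_divide_distrib[symmetric] divide_right_mono)
    qed
    then show "J (\<lambda>x. f x + g x) \<le> J f + J g" by simp
    show "J f + J g \<le> J (\<lambda>x. f x + g x)"
    proof (rule field_le_epsilon)
      fix e :: real assume e: "0 < e"
      obtain U where U: "openin T U" "\<one> \<in> U"
        "\<And>p. nontrivial p \<Longrightarrow> (\<And>x. x \<in> carrier G \<Longrightarrow> x \<notin> U \<Longrightarrow> p x = 0) \<Longrightarrow>
         cov f p + cov g p \<le> cov (\<lambda>x. f x + g x) p + e * cov h p"
        using cov_approx_additive[OF f g hN e] by metis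
      have "U \<in> N" using U by (simp add: N_def)
      then have "J \<in> {J. J f + J g \<le> J (\<lambda>x. f x + g x) + e}"
      proof (rule lim[OF closed_Collect_le[OF continuous_on_add[OF ev ev] continuous_on_add[OF ev continuous_on_const]]])
        fix p assume p: "nontrivial p" "\<And>x. x \<in> carrier G \<Longrightarrow> x \<notin> U \<Longrightarrow> p x = 0"
        have "(cov f p + cov g p) / cov h p \<le> (cov (\<lambda>x. f x + g x) p + e * cov h p) / cov h p"
          using U(3)[OF p] cov_pos[OF hN p(1)] by (intro divide_right_mono) auto
        also have "\<dots> = cov (\<lambda>x. f x + g x) p / cov h p + e"
          using cov_pos[OF hN p(1)] by (simp add: add_divide_distrib)
        finally show "I p \<in> {J. J f + J g \<le> J (\<lambda>x. f x + g x) + e}"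
          using f g Ccp_add[OF f g] by (simp add: I_def add_divide_distrib)
      qed
      then show "J f + J g \<le> J (\<lambda>x. f x + g x) + e" by simp
    qed
  qed
  have Jinv: "J (\<lambda>x. f (a \<otimes> x)) = J f" if f: "f \<in> Ccp T" and a: "a \<in> carrier G" for f a
  proof (rule lim_eq[of "\<lambda>J. J (\<lambda>x. f (a \<otimes> x))" "\<lambda>J. J f", OF ev ev])
    have "(\<lambda>x. f (a \<otimes> x)) \<in> Ccp T" using f a Cc_ltrans[of f a] by (auto simp: Ccp_def topspace_eq)
    then show "I p (\<lambda>x. f (a \<otimes> x)) = I p f" if "nontrivial p" for p
      using f cov_ltrans[OF CcpC[OF f] that a] by (simp add: I_def)
  qed
  \<comment> \<open>The normalisation survives the limit and keeps \<open>J\<close> from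
    vanishing.\<close>
  have Jh: "J h = 1"
    by (rule lim_eq[of "\<lambda>J. J h" "\<lambda>_. 1", OF ev continuous_on_const])
      (use h less_imp_neq[OF cov_pos[OF hN]] in \<open>auto simp: I_def Ccp_def\<close>)
  define J' where "J' f = J (\<lambda>x. max (f x) 0) - J (\<lambda>x. max (- f x) 0)" for f
  have "positive_functional T J'"
    unfolding J'_def[abs_def]
    by (rule positive_functional_extension) (erule (1) Jadd | erule (1) Jscale | rule J0 | (rule Jcong; blast))+
  moreover have "J' (\<lambda>x. f (a \<otimes> x)) = J' f" if "f \<in> Cc T" "a \<in> carrier G" for f a
    unfolding J'_def using Jinv[OF Ccp_pos[OF that(1)] that(2)] Jinv[OF Ccp_neg[OF that(1)] that(2)] by simp
  ultimately have "left_Haar J'" by (auto simp: left_Haar_def)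
  moreover have "J' h \<noteq> 0"
  proof -
    have z: "(\<lambda>x. 0) \<in> Ccp T" by (simp add: Ccp_def Cc_zero)
    have "J (\<lambda>x. max (h x) 0) = J h" "J (\<lambda>x. max (- h x) 0) = J (\<lambda>x. 0)"
      using h z by (auto intro!: Jcong Ccp_pos Ccp_neg simp: Ccp_def)
    moreover have "J (\<lambda>x. 0) = 0" using Jadd[OF z z] by simp
    ultimately show ?thesis using Jh by (simp add: J'_def)
  qed
  ultimately show ?thesis using h(1) by blast
qed

end


section \<open>Initial topologies\<close>

text \<open>Serves twice: with the whole dual it is the weak topology, with point evaluations it is
  the topology of the spaces of functionals.\<close>

definition initial_topology :: "'b set \<Rightarrow> ('b \<Rightarrow> real) set \<Rightarrow> 'b topology" where
  "initial_topology A \<Phi> = topology_generated_by {{x \<in> A. l x \<in> U} | l U. l \<in> \<Phi> \<and> open U}"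

lemma weak_topology_initial: "weak_topology E T = initial_topology (carrier E) (topological_dual E T)"
  by (simp add: weak_topology_def initial_topology_def)

lemma topspace_initial: "\<Phi> \<noteq> {} \<Longrightarrow> topspace (initial_topology A \<Phi>) = A"
  unfolding initial_topology_def topology_generated_by_topspace by (auto intro!: exI[of _ UNIV] exI[of _ A])

lemma initial_topology_basis:
  assumes "openin (initial_topology A \<Phi>) W" "x \<in> W"
  shows "\<exists>L e. finite L \<and> L \<subseteq> \<Phi> \<and> 0 < e \<and> {y \<in> A. \<forall>l\<in>L. \<bar>l y - l x\<bar> < e} \<subseteq> W"
proof -
  have "generate_topology_on {{x \<in> A. l x \<in> U} | l U. l \<in> \<Phi> \<and> open U} W"
    using assms(1) by (simp add: initial_topology_def openin_topology_generated_by_iff)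
  then show ?thesis
    using assms(2)
  proof (induction arbitrary: x)
    case (Int V W)
    from Int.IH(1)[of x] Int.prems obtain L e where 1: "finite L" "L \<subseteq> \<Phi>" "0 < e" "{y \<in> A. \<forall>l\<in>L. \<bar>l y - l x\<bar> < e} \<subseteq> V"
      by blast
    from Int.IH(2)[of x] Int.prems obtain M d where 2: "finite M" "M \<subseteq> \<Phi>" "0 < d" "{y \<in> A. \<forall>l\<in>M. \<bar>l y - l x\<bar> < d} \<subseteq> W"
      by blast
    show ?case
      using 1 2 by (intro exI[of _ "L \<union> M"] exI[of _ "min e d"]) auto
  next
    case (UN K)
    then obtain k where k: "k \<in> K" "x \<in> k" by blast
    from UN.IH[OF k] show ?case using k(1) by (meson Union_upper subset_trans)
  next
    case (Basis S)
    then obtain l U where lU: "S = {x \<in> A. l x \<in> U}" "l \<in> \<Phi>" "open U" by blast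
    then obtain e where e: "e > 0" "\<And>t. \<bar>t - l x\<bar> < e \<Longrightarrow> t \<in> U"
      using Basis by (auto simp: open_dist dist_real_def)
    show ?case by (rule exI[of _ "{l}"], rule exI[of _ e]) (use lU e in auto)
  qed auto
qed

lemma continuous_map_initial:
  assumes "l \<in> \<Phi>"
  shows "continuous_map (initial_topology A \<Phi>) euclideanreal l"
proof -
  have "openin (initial_topology A \<Phi>) {x \<in> topspace (initial_topology A \<Phi>). l x \<in> U}" if "open U" for U
  proof -
    have "topspace (initial_topology A \<Phi>) = A" using assms by (intro topspace_initial) auto
    moreover have "openin (initial_topology A \<Phi>) {x \<in> A. l x \<in> U}"
      unfolding initial_topology_def by (rule topology_generated_by_Basis) (use assms that in blast)
    ultimately show ?thesis by simp
  qed
  then show ?thesis by (simp add: continuous_map_def)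
qed

lemma openin_initial_basic:
  assumes "\<Phi> \<noteq> {}" "finite L" "L \<subseteq> \<Phi>"
  shows "openin (initial_topology A \<Phi>) {y \<in> A. \<forall>l\<in>L. \<bar>l y - c l\<bar> < e}"
proof -
  have "openin (initial_topology A \<Phi>) (topspace (initial_topology A \<Phi>) \<inter>
     \<Inter>((\<lambda>l. {y \<in> topspace (initial_topology A \<Phi>). \<bar>l y - c l\<bar> \<in> {..<e}}) ` L))"
  proof (rule openin_Int_Inter)
    fix W assume "W \<in> (\<lambda>l. {y \<in> topspace (initial_topology A \<Phi>). \<bar>l y - c l\<bar> \<in> {..<e}}) ` L"
    then obtain l where l: "l \<in> L" "W = {y \<in> topspace (initial_topology A \<Phi>). \<bar>l y - c l\<bar> \<in> {..<e}}" by blast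
    have "continuous_map (initial_topology A \<Phi>) euclideanreal (\<lambda>y. \<bar>l y - c l\<bar>)"
      using continuous_map_initial[of l \<Phi> A] l(1) assms(3)
      by (intro continuous_map_real_abs continuous_map_diff continuous_map_canonical_const) auto
    then show "openin (initial_topology A \<Phi>) W"
      unfolding l(2) by (rule openin_continuous_map_preimage) auto
  qed (use assms in auto)
  moreover have "topspace (initial_topology A \<Phi>) \<inter>
     \<Inter>((\<lambda>l. {y \<in> topspace (initial_topology A \<Phi>). \<bar>l y - c l\<bar> \<in> {..<e}}) ` L) = {y \<in> A. \<forall>l\<in>L. \<bar>l y - c l\<bar> < e}"
    using topspace_initial[OF assms(1)] by auto
  ultimately show ?thesis by simp
qed

lemma continuous_map_into_initial:
  assumes "\<Phi> \<noteq> {}" "f ` topspace X \<subseteq> A" "\<And>l. l \<in> \<Phi> \<Longrightarrow> continuous_map X euclideanreal (\<lambda>x. l (f x))"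
  shows "continuous_map X (initial_topology A \<Phi>) f"
  unfolding initial_topology_def
proof (rule continuous_on_generated_topo)
  fix W assume "W \<in> {{x \<in> A. l x \<in> U} | l U. l \<in> \<Phi> \<and> open U}"
  then obtain l U where lU: "W = {x \<in> A. l x \<in> U}" "l \<in> \<Phi>" "open U" by blast
  have "openin X {x \<in> topspace X. l (f x) \<in> U}"
    using openin_continuous_map_preimage[OF assms(3)[OF lU(2)]] lU(3) by simp
  moreover have "{x \<in> topspace X. l (f x) \<in> U} = f -` W \<inter> topspace X" using lU(1) assms(2) by auto
  ultimately show "openin X (f -` W \<inter> topspace X)" by simp
next
  have "\<Union>{{x \<in> A. l x \<in> U} | l U. l \<in> \<Phi> \<and> open U} = A"
    using topspace_initial[OF assms(1), of A] by (simp add: initial_topology_def)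
  then show "f ` topspace X \<subseteq> \<Union>{{x \<in> A. l x \<in> U} | l U. l \<in> \<Phi> \<and> open U}" using assms(2) by simp
qed

lemma limitin_initial:
  assumes "\<Phi> \<noteq> {}" "c \<in> A" "eventually (\<lambda>x. g x \<in> A) F" "\<And>l. l \<in> \<Phi> \<Longrightarrow> ((\<lambda>x. l (g x)) \<longlongrightarrow> l c) F"
  shows "limitin (initial_topology A \<Phi>) g c F"
  unfolding limitin_def
proof (intro conjI allI impI)
  show "c \<in> topspace (initial_topology A \<Phi>)" using assms(1,2) by (simp add: topspace_initial)
  fix W assume W: "openin (initial_topology A \<Phi>) W \<and> c \<in> W"
  obtain L e where L: "finite L" "L \<subseteq> \<Phi>" "0 < e" "{y \<in> A. \<forall>l\<in>L. \<bar>l y - l c\<bar> < e} \<subseteq> W"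
    using initial_topology_basis[of A \<Phi> W c] W by blast
  have "eventually (\<lambda>x. \<forall>l\<in>L. \<bar>l (g x) - l c\<bar> < e) F"
    using L assms(4) by (intro eventually_ball_finite) (auto simp: tendsto_iff dist_real_def)
  with assms(3) show "eventually (\<lambda>x. g x \<in> W) F"
    by eventually_elim (use L in auto)
qed

section \<open>The Hahn-Banach theorem\<close>

context locally_convex_space
begin

lemma smult_closed' [simp, intro]: "x \<in> carrier E \<Longrightarrow> r \<odot> x \<in> carrier E"
  by (rule smult_closed) (auto simp: real_ring_def)

lemma smult_add_left: "x \<in> carrier E \<Longrightarrow> (r + s) \<odot> x = r \<odot> x \<oplus> s \<odot> x"
  using smult_l_distr[of r s x] by (simp add: real_ring_def)

lemma smult_add_right: "x \<in> carrier E \<Longrightarrow> y \<in> carrier E \<Longrightarrow> r \<odot> (x \<oplus> y) = r \<odot> x \<oplus> r \<odot> y"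
  using smult_r_distr[of r x y] by (simp add: real_ring_def)

lemma smult_smult: "x \<in> carrier E \<Longrightarrow> r \<odot> (s \<odot> x) = (r * s) \<odot> x"
  using smult_assoc1[of r s x] by (simp add: real_ring_def)

lemma one_smult [simp]: "x \<in> carrier E \<Longrightarrow> 1 \<odot> x = x"
  using smult_one[of x] by (simp add: real_ring_def)

lemma zero_smult [simp]: "x \<in> carrier E \<Longrightarrow> 0 \<odot> x = \<zero>"
  using smult_l_null[of x] by (simp add: real_ring_def)

lemma smult_zero [simp]: "r \<odot> \<zero> = \<zero>"
  using smult_r_null[of r] by (simp add: real_ring_def)

lemma uminus_smult: "x \<in> carrier E \<Longrightarrow> \<ominus> x = (-1) \<odot> x"
  by (rule M.minus_equality) (use smult_add_left[of x "-1" 1] in auto)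

text \<open>Fixing the values off \<open>carrier E\<close> lets the pointwise order of the function
  type be used in Zorn's lemma, with comparisons decided on the carrier alone.\<close>

definition sublinear :: "('b \<Rightarrow> real) \<Rightarrow> bool" where
  "sublinear p \<longleftrightarrow> (\<forall>x\<in>carrier E. \<forall>y\<in>carrier E. p (x \<oplus> y) \<le> p x + p y) \<and>
     (\<forall>r\<ge>0. \<forall>x\<in>carrier E. p (r \<odot> x) = r * p x) \<and> (\<forall>x. x \<notin> carrier E \<longrightarrow> p x = 0)"

lemma sublinear_add: "sublinear p \<Longrightarrow> x \<in> carrier E \<Longrightarrow> y \<in> carrier E \<Longrightarrow> p (x \<oplus> y) \<le> p x + p y"
  by (simp add: sublinear_def)

lemma sublinear_smult: "sublinear p \<Longrightarrow> x \<in> carrier E \<Longrightarrow> 0 \<le> r \<Longrightarrow> p (r \<odot> x) = r * p x"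
  by (simp add: sublinear_def)

lemma sublinear_zero: "sublinear p \<Longrightarrow> p \<zero> = 0"
  using sublinear_smult[of p "\<zero>" 0] by simp

lemma sublinear_neg_ge: "sublinear p \<Longrightarrow> x \<in> carrier E \<Longrightarrow> - p (\<ominus> x) \<le> p x"
  using sublinear_add[of p x "\<ominus> x"] by (simp add: M.r_neg sublinear_zero)

lemma sublinearI:
  assumes "\<And>x y. x \<in> carrier E \<Longrightarrow> y \<in> carrier E \<Longrightarrow> p (x \<oplus> y) \<le> p x + p y"
    and "\<And>r x. 0 < r \<Longrightarrow> x \<in> carrier E \<Longrightarrow> p (r \<odot> x) \<le> r * p x"
    and "p \<zero> = 0" "\<And>x. x \<notin> carrier E \<Longrightarrow> p x = 0"
  shows "sublinear p"
  unfolding sublinear_def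
proof (intro conjI ballI allI impI)
  fix r :: real and x assume r: "0 \<le> r" and x: "x \<in> carrier E"
  show "p (r \<odot> x) = r * p x"
  proof (cases "r = 0")
    case False
    then have r: "0 < r" using r by simp
    have "p ((1 / r) \<odot> (r \<odot> x)) \<le> (1 / r) * p (r \<odot> x)"
      using r x by (intro assms(2)) auto
    then have "r * p x \<le> p (r \<odot> x)" using r x by (simp add: smult_smult field_simps)
    then show ?thesis using assms(2)[OF r x] by simp
  qed (use x assms in simp)
qed (use assms in auto)

text \<open>A minimal sublinear functional is fixed by the modification below for every \<open>y\<close>, hence odd, hence linear.\<close>

lemma sublinear_modification:
  assumes p: "sublinear p" and y: "y \<in> carrier E"
  obtains q where "sublinear q" "\<And>x. q x \<le> p x" "q (\<ominus> y) \<le> - p y"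
proof -
  \<comment> \<open>The choice \<open>t = 0\<close> gives \<open>q \<le> p\<close>, and
    \<open>t = 1\<close> at the point \<open>\<ominus> y\<close> gives
    \<open>q (\<ominus> y) \<le> - p y\<close>.\<close>
  define S where "S x = {p (x \<oplus> t \<odot> y) - t * p y | t. 0 \<le> t}" for x
  define q where "q x = (if x \<in> carrier E then Inf (S x) else 0)" for x
  have lower: "- p (\<ominus> x) \<le> p (x \<oplus> t \<odot> y) - t * p y" if x: "x \<in> carrier E" and t: "0 \<le> t" for x t
  proof -
    have "t \<odot> y = \<ominus> x \<oplus> (x \<oplus> t \<odot> y)" using x y by (simp add: M.r_neg1)
    then have "p (t \<odot> y) \<le> p (\<ominus> x) + p (x \<oplus> t \<odot> y)"
      using sublinear_add[OF p, of "\<ominus> x" "x \<oplus> t \<odot> y"] x y by simp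
    then show ?thesis using sublinear_smult[OF p y t] by simp
  qed
  have bdd: "bdd_below (S x)" if "x \<in> carrier E" for x
    by (rule bdd_belowI[of _ "- p (\<ominus> x)"]) (use lower[OF that] in \<open>auto simp: S_def\<close>)
  have q_le: "q x \<le> p (x \<oplus> t \<odot> y) - t * p y" if "x \<in> carrier E" "0 \<le> t" for x t
  proof -
    have "p (x \<oplus> t \<odot> y) - t * p y \<in> S x" using that by (auto simp: S_def)
    from cInf_lower[OF this bdd[OF that(1)]] show ?thesis using that by (simp add: q_def)
  qed
  have q_ge: "z \<le> q x" if "x \<in> carrier E" "\<And>t. 0 \<le> t \<Longrightarrow> z \<le> p (x \<oplus> t \<odot> y) - t * p y" for x z
  proof -
    have "S x \<noteq> {}" by (auto simp: S_def)
    then have "z \<le> Inf (S x)"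
    proof (rule cInf_greatest)
      fix s assume "s \<in> S x"
      then obtain t where "0 \<le> t" "s = p (x \<oplus> t \<odot> y) - t * p y" unfolding S_def by blast
      then show "z \<le> s" using that(2) by simp
    qed
    then show ?thesis using that by (simp add: q_def)
  qed
  show thesis
  proof (rule that)
    show "q x \<le> p x" for x
      using q_le[of x 0] y p by (cases "x \<in> carrier E") (auto simp: q_def sublinear_def)
    show "q (\<ominus> y) \<le> - p y"
      using q_le[of "\<ominus> y" 1] y sublinear_zero[OF p] by (simp add: M.l_neg)
    show "sublinear q"
    proof (rule sublinearI)
      fix u v assume u: "u \<in> carrier E" and v: "v \<in> carrier E"
      have *: "q (u \<oplus> v) \<le> (p (u \<oplus> t \<odot> y) - t * p y) + (p (v \<oplus> s \<odot> y) - s * p y)"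
        if "0 \<le> t" "0 \<le> s" for s t
      proof -
        have "(u \<oplus> v) \<oplus> (t + s) \<odot> y = (u \<oplus> t \<odot> y) \<oplus> (v \<oplus> s \<odot> y)"
          using u v y by (simp add: smult_add_left M.a_ac)
        then have "p ((u \<oplus> v) \<oplus> (t + s) \<odot> y) \<le> p (u \<oplus> t \<odot> y) + p (v \<oplus> s \<odot> y)"
          using u v y by (simp add: sublinear_add[OF p])
        then show ?thesis using q_le[of "u \<oplus> v" "t + s"] u v that by (simp add: algebra_simps)
      qed
      have "q (u \<oplus> v) - (p (v \<oplus> s \<odot> y) - s * p y) \<le> q u" if "0 \<le> s" for s
        using *[OF _ that] by (intro q_ge u) (simp add: algebra_simps)
      then have "q (u \<oplus> v) - q u \<le> q v"
        by (intro q_ge v) (simp add: algebra_simps)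
      then show "q (u \<oplus> v) \<le> q u + q v" by simp
    next
      fix r x assume r: "0 < (r::real)" and x: "x \<in> carrier E"
      have "q (r \<odot> x) / r \<le> q x"
      proof (rule q_ge[OF x])
        fix t :: real assume t: "0 \<le> t"
        have "r \<odot> x \<oplus> (r * t) \<odot> y = r \<odot> (x \<oplus> t \<odot> y)"
          using x y by (simp add: smult_add_right smult_smult)
        then have "q (r \<odot> x) \<le> r * p (x \<oplus> t \<odot> y) - r * t * p y"
          using q_le[of "r \<odot> x" "r * t"] sublinear_smult[OF p, of "x \<oplus> t \<odot> y" r] x y r t by simp
        then show "q (r \<odot> x) / r \<le> p (x \<oplus> t \<odot> y) - t * p y"
          unfolding pos_divide_le_eq[OF r] by (simp add: algebra_simps)
      qed
      then show "q (r \<odot> x) \<le> r * q x" using r by (simp add: divide_le_eq mult.commute)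
    next
      have "q \<zero> \<le> 0" using q_le[of "\<zero>" 0] y sublinear_zero[OF p] by simp
      moreover have "0 \<le> q \<zero>" using sublinear_smult[OF p y] y by (intro q_ge) auto
      ultimately show "q \<zero> = 0" by simp
    qed (simp add: q_def)
  qed
qed

text \<open>Zorn's lemma. The infimum of a chain stays sublinear because, of two members, the
  smaller one can serve in both terms of the triangle inequality; on the carrier it is bounded below
  by \<open>- p (\<ominus> x)\<close>.\<close>

lemma sublinear_minimal:
  assumes p: "sublinear p"
  shows "\<exists>m. sublinear m \<and> (\<forall>x. m x \<le> p x) \<and> (\<forall>q. sublinear q \<and> (\<forall>x. q x \<le> m x) \<longrightarrow> q = m)"
proof -
  define A where "A = {q. sublinear q \<and> q \<le> p}"
  have "\<exists>m\<in>A. \<forall>a\<in>A. a \<le> m \<longrightarrow> a = m"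
  proof (rule predicate_Zorn)
    show "partial_order_on A (relation_of (\<lambda>x y. y \<le> x) A)"
      by (rule partial_order_on_relation_ofI) auto
    fix C assume "C \<in> Chains (relation_of (\<lambda>x y. y \<le> x) A)"
    then have C: "C \<subseteq> A" "\<And>a b. a \<in> C \<Longrightarrow> b \<in> C \<Longrightarrow> a \<le> b \<or> b \<le> a"
      by (auto simp: Chains_def relation_of_def)
    show "\<exists>u\<in>A. \<forall>a\<in>C. u \<le> a"
    proof (cases "C = {}")
      case True
      then show ?thesis using p by (auto simp: A_def)
    next
      case False
      then obtain c0 where c0: "c0 \<in> C" by blast
      define u where "u x = (INF q\<in>C. q x)" for x
      have sub: "sublinear q" if "q \<in> C" for q
        using subsetD[OF C(1) that] by (simp add: A_def)
      have lep: "q x \<le> p x" if "q \<in> C" for q x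
      proof -
        have "q \<le> p" using subsetD[OF C(1) that] by (simp add: A_def)
        then show ?thesis by (rule le_funD)
      qed
      \<comment> \<open>The minimum with 0 covers points off the carrier, where every
        \<open>q\<close> vanishes.\<close>
      have lower: "min 0 (- p (\<ominus> x)) \<le> q x" if q: "q \<in> C" for q x
      proof (cases "x \<in> carrier E")
        case True
        then show ?thesis using sublinear_neg_ge[OF sub[OF q] True] lep[OF q, of "\<ominus> x"] by linarith
      next
        case False
        then show ?thesis using sub[OF q] by (simp add: sublinear_def)
      qed
      have u_le: "u x \<le> q x" if "q \<in> C" for q x
        unfolding u_def using lower that by (intro cINF_lower bdd_belowI2) auto
      have u_ge: "z \<le> u x" if "\<And>q. q \<in> C \<Longrightarrow> z \<le> q x" for x z
        unfolding u_def using False that by (intro cINF_greatest) auto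
      have "sublinear u"
      proof (rule sublinearI)
        fix x y assume x: "x \<in> carrier E" and y: "y \<in> carrier E"
        have *: "u (x \<oplus> y) \<le> q x + r y" if q: "q \<in> C" and r: "r \<in> C" for q r
        proof (cases "q \<le> r")
          case True
          then show ?thesis
            using u_le[OF q, of "x \<oplus> y"] sublinear_add[OF sub[OF q] x y] le_funD[OF True, of y] by linarith
        next
          case False
          then have "r \<le> q" using C q r by blast
          then show ?thesis
            using u_le[OF r, of "x \<oplus> y"] sublinear_add[OF sub[OF r] x y] le_funD[OF \<open>r \<le> q\<close>, of x] by linarith
        qed
        have "u (x \<oplus> y) - r y \<le> u x" if "r \<in> C" for r
          using *[OF _ that] by (intro u_ge) (simp add: algebra_simps)
        then have "u (x \<oplus> y) - u x \<le> u y" by (intro u_ge) (simp add: algebra_simps)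
        then show "u (x \<oplus> y) \<le> u x + u y" by simp
      next
        fix r x assume r: "0 < (r::real)" and x: "x \<in> carrier E"
        have "u (r \<odot> x) / r \<le> u x"
        proof (rule u_ge)
          fix q assume q: "q \<in> C"
          show "u (r \<odot> x) / r \<le> q x"
            using u_le[OF q, of "r \<odot> x"] sublinear_smult[OF sub[OF q] x, of r] r
            by (simp add: divide_le_eq mult.commute)
        qed
        then show "u (r \<odot> x) \<le> r * u x" using r by (simp add: divide_le_eq mult.commute)
      next
        have "u \<zero> \<le> 0" using u_le[OF c0, of "\<zero>"] sublinear_zero[OF sub[OF c0]] by simp
        moreover have "0 \<le> u \<zero>" by (rule u_ge) (simp add: sublinear_zero[OF sub])
        ultimately show "u \<zero> = 0" by simp
      next
        fix x assume x: "x \<notin> carrier E"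
        have q0: "q x = 0" if "q \<in> C" for q using sub[OF that] x by (simp add: sublinear_def)
        have "u x \<le> 0" using u_le[OF c0, of x] q0[OF c0] by simp
        moreover have "0 \<le> u x" by (rule u_ge) (simp add: q0)
        ultimately show "u x = 0" by simp
      qed
      moreover have "u \<le> p" using u_le[OF c0] lep[OF c0] by (auto simp: le_fun_def intro: order_trans)
      ultimately show ?thesis using u_le by (auto simp: A_def le_fun_def)
    qed
  qed
  then obtain m where m: "m \<in> A" "\<And>a. a \<in> A \<Longrightarrow> a \<le> m \<Longrightarrow> a = m" by blast
  have m1: "sublinear m" "m \<le> p" using m(1) by (simp_all add: A_def)
  show ?thesis
  proof (intro exI conjI allI impI)
    show "sublinear m" by (rule m1)
    show "m x \<le> p x" for x using m1(2) by (rule le_funD)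
    fix q assume q: "sublinear q \<and> (\<forall>x. q x \<le> m x)"
    then have "q \<le> m" by (simp add: le_fun_def)
    moreover from this have "q \<le> p" using m1(2) by (rule order_trans)
    ultimately show "q = m" using m(2) q by (simp add: A_def)
  qed
qed

text \<open>Modifying \<open>p\<close> at \<open>z\<close> before minimising secures the value:
  \<open>m (\<ominus> z) \<le> - p z\<close>, and oddness of \<open>m\<close> gives
  \<open>p z \<le> m z\<close>.\<close>

theorem Hahn_Banach:
  assumes p: "sublinear p" and z: "z \<in> carrier E"
  obtains l where "\<And>x y. x \<in> carrier E \<Longrightarrow> y \<in> carrier E \<Longrightarrow> l (x \<oplus> y) = l x + l y"
    "\<And>r x. x \<in> carrier E \<Longrightarrow> l (r \<odot> x) = r * l x" "\<And>x. l x \<le> p x" "p z \<le> l z"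
proof -
  obtain p' where p': "sublinear p'" "\<And>x. p' x \<le> p x" "p' (\<ominus> z) \<le> - p z"
    using sublinear_modification[OF assms] by metis
  obtain m where m0: "sublinear m" "\<forall>x. m x \<le> p' x" "\<forall>q. sublinear q \<and> (\<forall>x. q x \<le> m x) \<longrightarrow> q = m"
    using sublinear_minimal[OF p'(1)] by (elim exE conjE) (rule that)
  then have m: "sublinear m" "\<And>x. m x \<le> p' x" "\<And>q. sublinear q \<Longrightarrow> (\<And>x. q x \<le> m x) \<Longrightarrow> q = m"
    by simp_all
  have odd: "m (\<ominus> y) = - m y" if y: "y \<in> carrier E" for y
  proof -
    obtain q where q: "sublinear q" "\<And>x. q x \<le> m x" "q (\<ominus> y) \<le> - m y"
      using sublinear_modification[OF m(1) y] by metis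
    then have "m (\<ominus> y) \<le> - m y" using m(3)[OF q(1,2)] by simp
    then show ?thesis using sublinear_neg_ge[OF m(1) y] by simp
  qed
  show thesis
  proof (rule that[of m])
    fix x y assume x: "x \<in> carrier E" and y: "y \<in> carrier E"
    have "(x \<oplus> y) \<oplus> \<ominus> y = x" using x y by (simp add: M.a_assoc M.r_neg)
    then have "m x \<le> m (x \<oplus> y) + m (\<ominus> y)"
      using sublinear_add[OF m(1), of "x \<oplus> y" "\<ominus> y"] x y by simp
    then show "m (x \<oplus> y) = m x + m y" using sublinear_add[OF m(1) x y] odd[OF y] by simp
  next
    fix r x assume x: "x \<in> carrier E"
    show "m (r \<odot> x) = r * m x"
    proof (cases "0 \<le> r")
      case False
      have "r \<odot> x = \<ominus> ((- r) \<odot> x)" using x by (simp add: uminus_smult smult_smult)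
      then show ?thesis using odd[of "(- r) \<odot> x"] sublinear_smult[OF m(1) x, of "- r"] x False by simp
    qed (use sublinear_smult[OF m(1) x] in simp)
  next
    show "m x \<le> p x" for x using m(2) p'(2) order_trans by blast
    show "p z \<le> m z" using m(2)[of "\<ominus> z"] p'(3) odd[OF z] by simp
  qed
qed

lemma continuous_map_smult:
  assumes "continuous_map X euclideanreal r" "continuous_map X T f"
  shows "continuous_map X T (\<lambda>x. r x \<odot> f x)"
  using continuous_map_compose[OF continuous_map_pairedI[OF assms] continuous_smult] by (simp add: o_def)

lemma continuous_map_vadd:
  assumes "continuous_map X T f" "continuous_map X T g"
  shows "continuous_map X T (\<lambda>x. f x \<oplus> g x)"
  using continuous_map_compose[OF continuous_map_pairedI[OF assms] continuous_add] by (simp add: o_def)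

end

text \<open>The gauge of a convex neighbourhood \<open>W\<close> of zero that omits \<open>z\<close>
  has value at least 1 at \<open>z\<close>. A linear \<open>l\<close> below the gauge with
  \<open>p z \<le> l z\<close> is non-zero at \<open>z\<close> and at most 1 on \<open>W\<close>,
  hence continuous.\<close>

theorem dual_separates_points:
  fixes E :: "(real, 'b) module"
  assumes "locally_convex_space E T" and z: "z \<in> carrier E" "z \<noteq> \<zero>\<^bsub>E\<^esub>"
  shows "\<exists>l\<in>topological_dual E T. l z \<noteq> 0"
proof -
  interpret locally_convex_space E T by fact
  have "\<exists>U V. openin T U \<and> openin T V \<and> \<zero>\<^bsub>E\<^esub> \<in> U \<and> z \<in> V \<and> disjnt U V"
    using Hausdorff z M.zero_closed unfolding Hausdorff_space_def topspace_eq by blast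
  then obtain U where U: "openin T U" "\<zero>\<^bsub>E\<^esub> \<in> U" "z \<notin> U" by (auto simp: disjnt_iff)
  obtain W where W: "openin T W" "\<zero>\<^bsub>E\<^esub> \<in> W" "W \<subseteq> U"
      and conv: "\<And>x y t. x \<in> W \<Longrightarrow> y \<in> W \<Longrightarrow> 0 \<le> t \<Longrightarrow> t \<le> 1 \<Longrightarrow> (1 - t) \<odot>\<^bsub>E\<^esub> x \<oplus>\<^bsub>E\<^esub> t \<odot>\<^bsub>E\<^esub> y \<in> W"
    using convex_basis[OF U(1,2)] by (metis atLeastAtMost_iff)
  have WE: "W \<subseteq> carrier E" using openin_subset[OF W(1)] topspace_eq by simp
  define S where "S x = {t. 0 < t \<and> (1 / t) \<odot>\<^bsub>E\<^esub> x \<in> W}" for x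
  define p where "p x = (if x \<in> carrier E then Inf (S x) else 0)" for x
  have S_ne: "S x \<noteq> {}" if x: "x \<in> carrier E" for x
  proof -
    have "continuous_map euclideanreal T (\<lambda>r. r \<odot>\<^bsub>E\<^esub> x)"
      using x topspace_eq by (intro continuous_map_smult) auto
    then have "open {r. r \<odot>\<^bsub>E\<^esub> x \<in> W}"
      using openin_continuous_map_preimage[OF _ W(1), of euclideanreal] by simp
    moreover have "0 \<in> {r. r \<odot>\<^bsub>E\<^esub> x \<in> W}" using W x by simp
    ultimately obtain e where e: "e > 0" "\<And>r. \<bar>r\<bar> < e \<Longrightarrow> r \<odot>\<^bsub>E\<^esub> x \<in> W"
      unfolding open_dist by (auto simp: dist_real_def)
    then have "2 / e \<in> S x" using e(2)[of "1 / (2 / e)"] by (simp add: S_def)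
    then show ?thesis by blast
  qed
  have p_le: "p x \<le> t" if "x \<in> carrier E" "0 < t" "(1 / t) \<odot>\<^bsub>E\<^esub> x \<in> W" for x t
    unfolding p_def using that by (auto simp: S_def intro!: cInf_lower bdd_belowI[of _ 0])
  have p_ge: "a \<le> p x" if "x \<in> carrier E" "\<And>t. 0 < t \<Longrightarrow> (1 / t) \<odot>\<^bsub>E\<^esub> x \<in> W \<Longrightarrow> a \<le> t" for x a
    unfolding p_def using that S_ne[OF that(1)] by (auto simp: S_def intro!: cInf_greatest)
  have p: "sublinear p"
  proof (rule sublinearI)
    fix x y assume x: "x \<in> carrier E" and y: "y \<in> carrier E"
    have *: "p (x \<oplus>\<^bsub>E\<^esub> y) \<le> t + s" if t: "0 < t" "(1 / t) \<odot>\<^bsub>E\<^esub> x \<in> W" and s: "0 < s" "(1 / s) \<odot>\<^bsub>E\<^esub> y \<in> W" for t s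
    proof (rule p_le)
      have "1 - s / (t + s) = t / (t + s)" using t s by (simp add: field_simps)
      then have "(1 / (t + s)) \<odot>\<^bsub>E\<^esub> (x \<oplus>\<^bsub>E\<^esub> y) =
          (1 - s / (t + s)) \<odot>\<^bsub>E\<^esub> ((1 / t) \<odot>\<^bsub>E\<^esub> x) \<oplus>\<^bsub>E\<^esub> (s / (t + s)) \<odot>\<^bsub>E\<^esub> ((1 / s) \<odot>\<^bsub>E\<^esub> y)"
        using x y t s by (simp add: smult_add_right smult_smult)
      also have "\<dots> \<in> W" using t s by (intro conv) auto
      finally show "(1 / (t + s)) \<odot>\<^bsub>E\<^esub> (x \<oplus>\<^bsub>E\<^esub> y) \<in> W" .
    qed (use x y t s in auto)
    have "p (x \<oplus>\<^bsub>E\<^esub> y) - s \<le> p x" if "0 < s" "(1 / s) \<odot>\<^bsub>E\<^esub> y \<in> W" for s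
      using *[OF _ _ that] by (intro p_ge x) (simp add: algebra_simps)
    then have "p (x \<oplus>\<^bsub>E\<^esub> y) - p x \<le> p y" by (intro p_ge y) (simp add: algebra_simps)
    then show "p (x \<oplus>\<^bsub>E\<^esub> y) \<le> p x + p y" by simp
  next
    fix r x assume r: "0 < (r::real)" and x: "x \<in> carrier E"
    have "p (r \<odot>\<^bsub>E\<^esub> x) / r \<le> p x"
    proof (rule p_ge[OF x])
      fix t :: real assume t: "0 < t" "(1 / t) \<odot>\<^bsub>E\<^esub> x \<in> W"
      have "p (r \<odot>\<^bsub>E\<^esub> x) \<le> r * t" using t r x by (intro p_le) (auto simp: smult_smult)
      then show "p (r \<odot>\<^bsub>E\<^esub> x) / r \<le> t" using r by (simp add: divide_le_eq mult.commute)
    qed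
    then show "p (r \<odot>\<^bsub>E\<^esub> x) \<le> r * p x" using r by (simp add: divide_le_eq mult.commute)
  next
    have "p \<zero>\<^bsub>E\<^esub> \<le> 0" by (rule field_le_epsilon) (use W(2) in \<open>auto intro!: p_le\<close>)
    moreover have "0 \<le> p \<zero>\<^bsub>E\<^esub>" by (rule p_ge) auto
    ultimately show "p \<zero>\<^bsub>E\<^esub> = 0" by simp
  qed (simp add: p_def)
  have "1 \<le> p z"
  \<comment> \<open>For \<open>t < 1\<close> convexity would place \<open>z\<close> in
    \<open>W\<close>, as a point of the segment from zero to \<open>z\<close> divided by
    \<open>t\<close>.\<close>
  proof (rule p_ge[OF z(1)], rule ccontr)
    fix t :: real assume t: "0 < t" "(1 / t) \<odot>\<^bsub>E\<^esub> z \<in> W" "\<not> 1 \<le> t"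
    have "(1 - t) \<odot>\<^bsub>E\<^esub> \<zero>\<^bsub>E\<^esub> \<oplus>\<^bsub>E\<^esub> t \<odot>\<^bsub>E\<^esub> ((1 / t) \<odot>\<^bsub>E\<^esub> z) \<in> W" using t W by (intro conv) auto
    then have "z \<in> W" using t z by (simp add: smult_smult)
    then show False using U W by blast
  qed
  obtain l where l: "\<And>x y. x \<in> carrier E \<Longrightarrow> y \<in> carrier E \<Longrightarrow> l (x \<oplus>\<^bsub>E\<^esub> y) = l x + l y"
    "\<And>r x. x \<in> carrier E \<Longrightarrow> l (r \<odot>\<^bsub>E\<^esub> x) = r * l x" "\<And>x. l x \<le> p x" "p z \<le> l z"
    using Hahn_Banach[OF p z(1)] by metis
  have l_le: "l x \<le> 1" if "x \<in> W" for x
    using l(3)[of x] p_le[of x 1] that WE by fastforce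
  have "continuous_map T euclideanreal l"
  proof (rule continuous_map_realI)
    fix x and e :: real assume x: "x \<in> topspace T" and e: "0 < e"
    then have xE: "x \<in> carrier E" by (simp add: topspace_eq)
    define f where "f c y = c \<odot>\<^bsub>E\<^esub> (y \<oplus>\<^bsub>E\<^esub> (- 1) \<odot>\<^bsub>E\<^esub> x)" for c y
    have f: "continuous_map T T (f c)" for c
      unfolding f_def[abs_def] using xE topspace_eq by (intro continuous_map_smult continuous_map_vadd) auto
    have lf: "l (f c y) = c * (l y - l x)" if "y \<in> carrier E" for c y
      using that xE l(1,2) by (simp add: f_def)
    \<comment> \<open>\<open>W\<close> need not be symmetric, so both signs are imposed; the factor
      2 leaves \<open>\<bar>l y - l x\<bar> \<le> e / 2\<close>, which is strictly below
      \<open>e\<close>.\<close>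
    define V where "V = {y \<in> topspace T. f (2 / e) y \<in> W} \<inter> {y \<in> topspace T. f (- 2 / e) y \<in> W}"
    have "openin T V" unfolding V_def using f W(1) by (intro openin_Int openin_continuous_map_preimage)
    moreover have "x \<oplus>\<^bsub>E\<^esub> (- 1) \<odot>\<^bsub>E\<^esub> x = \<zero>\<^bsub>E\<^esub>" using xE by (simp add: uminus_smult[symmetric] M.r_neg)
    then have "x \<in> V" using x W(2) by (simp add: V_def f_def)
    moreover have "\<bar>l y - l x\<bar> < e" if "y \<in> V" for y
    proof -
      have y: "y \<in> carrier E" using that by (auto simp: V_def topspace_eq)
      have "l (f (2 / e) y) \<le> 1" "l (f (- 2 / e) y) \<le> 1"
        using that by (auto simp: V_def intro!: l_le)
      then have "(2 / e) * (l y - l x) \<le> 1" "(- 2 / e) * (l y - l x) \<le> 1"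
        unfolding lf[OF y] .
      then have "2 * (l y - l x) \<le> e" "2 * (l x - l y) \<le> e" using e by (auto simp: field_simps)
      then show ?thesis using e unfolding abs_less_iff by simp
    qed
    ultimately show "\<exists>U. openin T U \<and> x \<in> U \<and> (\<forall>x'\<in>U. \<bar>l x' - l x\<bar> < e)" by blast
  qed
  then have "l \<in> topological_dual E T" using l(1,2) by (simp add: topological_dual_def)
  moreover have "l z \<noteq> 0" using l(4) \<open>1 \<le> p z\<close> by linarith
  ultimately show ?thesis by blast
qed


section \<open>Spaces of functionals\<close>

definition function_module :: "('v \<Rightarrow> real) set \<Rightarrow> (real, 'v \<Rightarrow> real) module" where
  "function_module A = \<lparr>carrier = A, mult = (\<lambda>x y. x), one = (\<lambda>v. 0), zero = (\<lambda>v. 0),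
     add = (\<lambda>x y v. x v + y v), smult = (\<lambda>r x v. r * x v)\<rparr>"

lemma function_module_simps [simp]:
  "carrier (function_module A) = A" "\<zero>\<^bsub>function_module A\<^esub> = (\<lambda>v. 0)"
  "x \<oplus>\<^bsub>function_module A\<^esub> y = (\<lambda>v. x v + y v)" "r \<odot>\<^bsub>function_module A\<^esub> x = (\<lambda>v. r * x v)"
  by (simp_all add: function_module_def)

lemma cring_real_ring: "cring real_ring"
proof (rule cringI)
  show "abelian_group real_ring"
    by (rule abelian_groupI) (auto simp: real_ring_def intro: exI[of _ "- x" for x :: real] add.left_inverse)
  show "comm_monoid real_ring" by (rule comm_monoidI) (auto simp: real_ring_def)
qed (auto simp: real_ring_def algebra_simps)

definition evaluations :: "'v set \<Rightarrow> (('v \<Rightarrow> real) \<Rightarrow> real) set" where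
  "evaluations V = (\<lambda>v x. x v) ` V"

text \<open>Vanishing off \<open>V\<close> makes evaluations at points of \<open>V\<close> separate
  the elements; this gives the Hausdorff property.\<close>

locale functional_space =
  fixes A :: "('v \<Rightarrow> real) set" and V :: "'v set"
  assumes zero_A: "(\<lambda>v. 0) \<in> A"
    and add_A: "\<And>x y. x \<in> A \<Longrightarrow> y \<in> A \<Longrightarrow> (\<lambda>v. x v + y v) \<in> A"
    and smult_A: "\<And>r x. x \<in> A \<Longrightarrow> (\<lambda>v. r * x v) \<in> A"
    and V_nonempty: "V \<noteq> {}"
    and support_A: "\<And>x v. x \<in> A \<Longrightarrow> v \<notin> V \<Longrightarrow> x v = 0"
begin

abbreviation "\<E> \<equiv> function_module A"
abbreviation "\<tau> \<equiv> initial_topology A (evaluations V)"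

lemma ev_nonempty: "evaluations V \<noteq> {}"
  using V_nonempty by (simp add: evaluations_def)

lemma topspace_\<tau> [simp]: "topspace \<tau> = A"
  by (rule topspace_initial[OF ev_nonempty])

lemma continuous_ev: "v \<in> V \<Longrightarrow> continuous_map \<tau> euclideanreal (\<lambda>x. x v)"
  by (rule continuous_map_initial) (simp add: evaluations_def)

lemma continuous_into_\<tau>:
  assumes "f ` topspace X \<subseteq> A" "\<And>v. v \<in> V \<Longrightarrow> continuous_map X euclideanreal (\<lambda>x. f x v)"
  shows "continuous_map X \<tau> f"
  using assms by (intro continuous_map_into_initial ev_nonempty) (auto simp: evaluations_def)

lemma \<tau>_basis:
  assumes "openin \<tau> W" "x \<in> W"
  obtains Q e where "finite Q" "Q \<subseteq> V" "0 < e" "{y \<in> A. \<forall>v\<in>Q. \<bar>y v - x v\<bar> < e} \<subseteq> W"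
proof -
  obtain L e where L: "finite L" "L \<subseteq> evaluations V" "0 < e" "{y \<in> A. \<forall>l\<in>L. \<bar>l y - l x\<bar> < e} \<subseteq> W"
    using initial_topology_basis[OF assms] by blast
  obtain Q where Q: "Q \<subseteq> V" "finite Q" "L = (\<lambda>v x. x v) ` Q"
    using finite_subset_image[OF L(1) L(2)[unfolded evaluations_def]] by blast
  show thesis by (rule that[OF Q(2,1) L(3)]) (use L(4) Q(3) in auto)
qed

lemma openin_\<tau>_basic:
  assumes "finite Q" "Q \<subseteq> V"
  shows "openin \<tau> {y \<in> A. \<forall>v\<in>Q. \<bar>y v\<bar> < e}"
proof -
  have "openin \<tau> {y \<in> A. \<forall>l\<in>(\<lambda>v x. x v) ` Q. \<bar>l y - 0\<bar> < e}"
    using assms by (intro openin_initial_basic[where c = "\<lambda>_. 0"] ev_nonempty) (auto simp: evaluations_def)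
  then show ?thesis by simp
qed

lemma abelian_group: "abelian_group \<E>"
proof (rule abelian_groupI)
  fix x assume "x \<in> carrier \<E>"
  then have "(\<lambda>v. (-1) * x v) \<in> A" using smult_A[of x "-1"] by simp
  then show "\<exists>y\<in>carrier \<E>. y \<oplus>\<^bsub>\<E>\<^esub> x = \<zero>\<^bsub>\<E>\<^esub>"
    by (intro bexI[of _ "\<lambda>v. (-1) * x v"]) auto
qed (auto simp: zero_A add_A add_ac)

lemma module: "Module.module real_ring \<E>"
  by (rule moduleI[OF cring_real_ring abelian_group]) (auto simp: real_ring_def smult_A algebra_simps)

lemma uminus_eq: "x \<in> A \<Longrightarrow> \<ominus>\<^bsub>\<E>\<^esub> x = (\<lambda>v. - x v)"
  using abelian_group.minus_equality[OF abelian_group, of "\<lambda>v. - x v" x] smult_A[of x "-1"] by simp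

lemma minus_eq: "x \<in> A \<Longrightarrow> y \<in> A \<Longrightarrow> x \<ominus>\<^bsub>\<E>\<^esub> y = (\<lambda>v. x v - y v)"
  using uminus_eq[of y] by (simp add: a_minus_def)

lemma locally_convex: "locally_convex_space \<E> \<tau>"
proof (rule locally_convex_space.intro[OF module], unfold_locales)
  show "topspace \<tau> = carrier \<E>" by simp
  have "continuous_map (prod_topology \<tau> \<tau>) \<tau> (\<lambda>z. (\<lambda>v. fst z v + snd z v))"
  proof (rule continuous_into_\<tau>)
    fix v assume v: "v \<in> V"
    show "continuous_map (prod_topology \<tau> \<tau>) euclideanreal (\<lambda>z. fst z v + snd z v)"
      using continuous_map_compose[OF continuous_map_fst continuous_ev[OF v], of \<tau>]
        continuous_map_compose[OF continuous_map_snd continuous_ev[OF v], of \<tau>]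
      by (intro continuous_map_add) (auto simp: o_def)
  qed (auto simp: add_A)
  then show "continuous_map (prod_topology \<tau> \<tau>) \<tau> (\<lambda>(x, y). x \<oplus>\<^bsub>\<E>\<^esub> y)"
    by (simp add: case_prod_unfold)
  have "continuous_map (prod_topology euclideanreal \<tau>) \<tau> (\<lambda>z. (\<lambda>v. fst z * snd z v))"
  proof (rule continuous_into_\<tau>)
    fix v assume v: "v \<in> V"
    show "continuous_map (prod_topology euclideanreal \<tau>) euclideanreal (\<lambda>z. fst z * snd z v)"
      using continuous_map_compose[OF continuous_map_snd continuous_ev[OF v], of euclideanreal]
        continuous_map_fst[of euclideanreal \<tau>]
      by (intro continuous_map_real_mult) (auto simp: o_def)
  qed (auto simp: smult_A)
  then show "continuous_map (prod_topology euclideanreal \<tau>) \<tau> (\<lambda>(r, x). r \<odot>\<^bsub>\<E>\<^esub> x)"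
    by (simp add: case_prod_unfold)
  show "Hausdorff_space \<tau>"
    unfolding Hausdorff_space_def topspace_\<tau>
  proof (intro allI impI, elim conjE)
    fix x y assume xy: "x \<in> A" "y \<in> A" "x \<noteq> y"
    then obtain v where v: "x v \<noteq> y v" by blast
    then have vV: "v \<in> V" using support_A xy by metis
    obtain U W where UW: "open U" "open W" "x v \<in> U" "y v \<in> W" "U \<inter> W = {}"
      using hausdorff[OF v] by blast
    let ?pre = "\<lambda>S. {z \<in> topspace \<tau>. z v \<in> S}"
    have "openin \<tau> (?pre U)" "openin \<tau> (?pre W)"
      using openin_continuous_map_preimage[OF continuous_ev[OF vV]] UW(1,2) by (simp_all del: topspace_\<tau>)
    moreover have "x \<in> ?pre U" "y \<in> ?pre W" "disjnt (?pre U) (?pre W)"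
      using UW xy by (auto simp: disjnt_def)
    ultimately show "\<exists>U V. openin \<tau> U \<and> openin \<tau> V \<and> x \<in> U \<and> y \<in> V \<and> disjnt U V" by blast
  qed
  fix U assume U: "openin \<tau> U" "\<zero>\<^bsub>\<E>\<^esub> \<in> U"
  then obtain Q e where Q: "finite Q" "Q \<subseteq> V" "0 < e" "{y \<in> A. \<forall>v\<in>Q. \<bar>y v - 0\<bar> < e} \<subseteq> U"
    using \<tau>_basis[of U "\<lambda>v. 0"] by auto
  let ?W = "{y \<in> A. \<forall>v\<in>Q. \<bar>y v\<bar> < e}"
  have "(\<lambda>v. (1 - t) * x v + t * y v) \<in> ?W" if "x \<in> ?W" "y \<in> ?W" "t \<in> {0..1}" for x y t
  proof -
    have "\<bar>(1 - t) * x v + t * y v\<bar> < e" if v: "v \<in> Q" for v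
    proof -
      have 1: "x v < e" "- x v < e" "y v < e" "- y v < e" "0 \<le> t" "t \<le> 1"
        using v \<open>x \<in> ?W\<close> \<open>y \<in> ?W\<close> \<open>t \<in> {0..1}\<close> by (auto simp: abs_less_iff)
      have "(1 - t) * x v + t * y v < e" by (rule convex_bound_lt) (use 1 in auto)
      moreover have "(1 - t) * (- x v) + t * (- y v) < e" by (rule convex_bound_lt) (use 1 in auto)
      ultimately show ?thesis by (simp add: abs_less_iff)
    qed
    then show ?thesis using that smult_A add_A by simp
  qed
  then show "\<exists>W. openin \<tau> W \<and> \<zero>\<^bsub>\<E>\<^esub> \<in> W \<and> W \<subseteq> U \<and>
        (\<forall>x\<in>W. \<forall>y\<in>W. \<forall>t\<in>{0..1}. (1 - t) \<odot>\<^bsub>\<E>\<^esub> x \<oplus>\<^bsub>\<E>\<^esub> t \<odot>\<^bsub>\<E>\<^esub> y \<in> W)"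
    using openin_\<tau>_basic[OF Q(1,2), of e] Q(3,4) zero_A by (intro exI[of _ ?W]) auto
qed

lemma ev_dual: "v \<in> V \<Longrightarrow> (\<lambda>x. x v) \<in> topological_dual \<E> \<tau>"
  using continuous_ev by (simp add: topological_dual_def)

text \<open>Continuity at zero gives \<open>\<bar>l x\<bar> < 1\<close> on a basic neighbourhood,
  and homogeneity rescales this to a seminorm bound.\<close>

lemma dual_bound:
  assumes l: "l \<in> topological_dual \<E> \<tau>"
  obtains Q M where "finite Q" "Q \<subseteq> V" "0 < M" "\<And>x. x \<in> A \<Longrightarrow> \<bar>l x\<bar> \<le> M * (\<Sum>v\<in>Q. \<bar>x v\<bar>)"
proof -
  have lin: "\<And>r x. x \<in> A \<Longrightarrow> l (\<lambda>v. r * x v) = r * l x" and cont: "continuous_map \<tau> euclideanreal l"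
    using l by (auto simp: topological_dual_def)
  have "openin \<tau> {x \<in> topspace \<tau>. l x \<in> {-1<..<1}}"
    using cont by (rule openin_continuous_map_preimage) auto
  moreover have "(\<lambda>v. 0) \<in> {x \<in> topspace \<tau>. l x \<in> {-1<..<1}}"
    using zero_A lin[OF zero_A, of 0] by simp
  ultimately obtain Q e where Q: "finite Q" "Q \<subseteq> V" "0 < e"
      "{y \<in> A. \<forall>v\<in>Q. \<bar>y v - 0\<bar> < e} \<subseteq> {x \<in> topspace \<tau>. l x \<in> {-1<..<1}}"
    by (rule \<tau>_basis) (rule that)
  show thesis
  proof (rule that[OF Q(1,2), of "1 / e"])
    fix x assume x: "x \<in> A"
    define s where "s = (\<Sum>v\<in>Q. \<bar>x v\<bar>)"
    have s: "0 \<le> s" "\<And>v. v \<in> Q \<Longrightarrow> \<bar>x v\<bar> \<le> s"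
      unfolding s_def using Q(1) by (auto intro!: sum_nonneg member_le_sum)
    have "\<bar>l x\<bar> * e \<le> s"
    proof (rule field_le_epsilon)
      fix d :: real assume d: "0 < d"
      \<comment> \<open>The sum \<open>s\<close> may be zero, so the scaling goes through
        \<open>s + d\<close>, with \<open>d\<close> arbitrarily small.\<close>
      define r where "r = e / (s + d)"
      have r: "0 < r" using Q(3) s(1) d by (simp add: r_def)
      have "\<bar>r * x v\<bar> < e" if "v \<in> Q" for v
      proof -
        have "r * \<bar>x v\<bar> \<le> r * s" using s(2)[OF that] r by simp
        also have "\<dots> < e" using Q(3) s(1) d by (simp add: r_def field_simps)
        finally show ?thesis using r by (simp add: abs_mult)
      qed
      then have "\<bar>l (\<lambda>v. r * x v)\<bar> < 1" using Q(4) smult_A[OF x, of r] by (fastforce simp: abs_less_iff)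
      then have "r * \<bar>l x\<bar> < 1" using lin[OF x] r by (simp add: abs_mult)
      then show "\<bar>l x\<bar> * e \<le> s + d" using s(1) d by (simp add: r_def divide_less_eq mult.commute)
    qed
    then show "\<bar>l x\<bar> \<le> 1 / e * (\<Sum>v\<in>Q. \<bar>x v\<bar>)" using Q(3) by (simp add: s_def le_divide_eq)
  qed (use Q(3) in simp)
qed

text \<open>A weakly Cauchy filter on \<open>C\<close> is Cauchy under each evaluation, so it
  converges pointwise because the real line is complete. Pointwise convergence is convergence in
  \<open>\<tau>\<close>, which every element of the dual respects. Weak completeness is thus reduced
  to closedness under pointwise limits.\<close>

lemma weakly_completeI:
  assumes CA: "C \<subseteq> A"
    and lim: "\<And>F c. F \<noteq> bot \<Longrightarrow> eventually (\<lambda>x. x \<in> C) F \<Longrightarrow> (\<And>v. ((\<lambda>x. x v) \<longlongrightarrow> c v) F) \<Longrightarrow> c \<in> C"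
  shows "weakly_complete \<E> \<tau> C"
  unfolding weakly_complete_def complete_in_def
proof (intro allI impI, elim conjE)
  let ?D = "topological_dual \<E> \<tau>"
  let ?w = "weak_topology \<E> \<tau>"
  have w: "?w = initial_topology A ?D" by (simp add: weak_topology_initial)
  have D: "?D \<noteq> {}" using ev_dual V_nonempty by blast
  fix F assume F: "F \<noteq> bot" "eventually (\<lambda>x. x \<in> C) F"
    and cauchy: "\<forall>U. openin ?w U \<and> \<zero>\<^bsub>\<E>\<^esub> \<in> U \<longrightarrow>
      (\<exists>S. eventually (\<lambda>x. x \<in> S) F \<and> (\<forall>x\<in>S \<inter> C. \<forall>y\<in>S \<inter> C. x \<ominus>\<^bsub>\<E>\<^esub> y \<in> U))"
  have "\<exists>c. ((\<lambda>x. x v) \<longlongrightarrow> c) F" for v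
  proof (cases "v \<in> V")
    case True
    have "cauchy_filter (filtermap (\<lambda>x. x v) F)"
      unfolding cauchy_filter_metric
    proof (intro allI impI)
      fix e :: real assume e: "0 < e"
      define N where "N = {y \<in> A. \<forall>l\<in>{\<lambda>x. x v}. \<bar>l y - 0\<bar> < e}"
      have "openin ?w N"
        unfolding w N_def using ev_dual[OF True] D by (intro openin_initial_basic[where c = "\<lambda>_. 0"]) auto
      moreover have "\<zero>\<^bsub>\<E>\<^esub> \<in> N"
        using zero_A e by (simp add: N_def)
      ultimately have "\<exists>S. eventually (\<lambda>x. x \<in> S) F \<and> (\<forall>x\<in>S \<inter> C. \<forall>y\<in>S \<inter> C. x \<ominus>\<^bsub>\<E>\<^esub> y \<in> N)"
        by (intro cauchy[THEN spec, THEN mp] conjI)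
      then obtain S where S: "eventually (\<lambda>x. x \<in> S) F"
          "\<forall>x\<in>S \<inter> C. \<forall>y\<in>S \<inter> C. x \<ominus>\<^bsub>\<E>\<^esub> y \<in> N"
        by (elim exE conjE) (rule that)
      have "eventually (\<lambda>r. \<exists>x\<in>S \<inter> C. r = x v) (filtermap (\<lambda>x. x v) F)"
        unfolding eventually_filtermap using S(1) F(2) by eventually_elim auto
      moreover have "\<forall>r t. (\<exists>x\<in>S \<inter> C. r = x v) \<and> (\<exists>x\<in>S \<inter> C. t = x v) \<longrightarrow> dist r t < e"
      proof (intro allI impI, elim conjE bexE)
        fix r t x y assume xy: "x \<in> S \<inter> C" "y \<in> S \<inter> C" "r = x v" "t = y v"
        then have "x \<in> A" "y \<in> A" using CA by auto
        moreover have "x \<ominus>\<^bsub>\<E>\<^esub> y \<in> N" using S(2) xy(1,2) by blast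
        ultimately show "dist r t < e" using xy(3,4) by (simp add: minus_eq N_def dist_real_def)
      qed
      ultimately show "\<exists>P. eventually P (filtermap (\<lambda>x. x v) F) \<and> (\<forall>x y. P x \<and> P y \<longrightarrow> dist x y < e)"
        by (intro exI[of _ "\<lambda>r. \<exists>x\<in>S \<inter> C. r = x v"] conjI)
    qed
    then obtain c where "filtermap (\<lambda>x. x v) F \<le> nhds c"
      using cauchy_filter_complete_converges[of "filtermap (\<lambda>x. x v) F" UNIV] F(1)
      by (auto simp: filtermap_bot_iff complete_UNIV)
    then show ?thesis by (auto simp: filterlim_def)
  next
    case False
    have "eventually (\<lambda>x. x v = 0) F" using F(2) by eventually_elim (use CA support_A False in auto)
    then show ?thesis by (intro exI[of _ 0] tendsto_eventually)
  qed
  then obtain c where "\<forall>v. ((\<lambda>x. x v) \<longlongrightarrow> c v) F" by (rule choice[OF allI, THEN exE]) (rule that)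
  then have c: "\<And>v. ((\<lambda>x. x v) \<longlongrightarrow> c v) F" by blast
  have cC: "c \<in> C" by (rule lim[OF F c])
  have "limitin \<tau> (\<lambda>x. x) c F"
    using cC CA c F(2) by (intro limitin_initial ev_nonempty) (auto simp: evaluations_def elim: eventually_mono)
  then have "((\<lambda>x. l x) \<longlongrightarrow> l c) F" if "l \<in> ?D" for l
    using continuous_map_limit[of \<tau> euclideanreal l "\<lambda>x. x" c F] that
    by (simp add: topological_dual_def o_def)
  then have "limitin ?w (\<lambda>x. x) c F"
    unfolding w using cC CA F(2) by (intro limitin_initial D) (auto elim: eventually_mono)
  then show "\<exists>c\<in>C. limitin ?w (\<lambda>x. x) c F" using cC by blast
qed

end


section \<open>Invariant functionals from the fixed-point property\<close>

context topological_group
begin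

definition right_uc :: "('a \<Rightarrow> real) \<Rightarrow> bool" where
  "right_uc v \<longleftrightarrow> (\<forall>e>0. \<exists>U. openin T U \<and> \<one> \<in> U \<and> (\<forall>a\<in>U. \<forall>g\<in>carrier G. \<bar>v (a \<otimes> g) - v g\<bar> < e))"

text \<open>The translates \<open>f (inv g \<otimes> x)\<close> are those of the adjoint action, and
  they carry no coefficients, as in the notion of cobounded type; repeated list entries take the
  place of integer multiples.\<close>

definition dominated :: "('a \<Rightarrow> real) \<Rightarrow> ('a \<Rightarrow> real) set" where
  "dominated f = {v. right_uc v \<and> (\<exists>B. \<forall>x\<in>carrier G. \<bar>v x\<bar> \<le> B) \<and>
     (\<exists>gs. set gs \<subseteq> carrier G \<and> (\<forall>x\<in>carrier G. \<bar>v x\<bar> \<le> (\<Sum>g\<leftarrow>gs. f (inv g \<otimes> x))))}"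

lemma right_ucI:
  assumes "\<And>e. 0 < e \<Longrightarrow> \<exists>U. openin T U \<and> \<one> \<in> U \<and> (\<forall>a\<in>U. \<forall>g\<in>carrier G. \<bar>v (a \<otimes> g) - v g\<bar> < e)"
  shows "right_uc v"
  using assms by (simp add: right_uc_def)

lemma right_ucE:
  assumes "right_uc v" "0 < e"
  obtains U where "openin T U" "\<one> \<in> U" "\<And>a g. a \<in> U \<Longrightarrow> g \<in> carrier G \<Longrightarrow> \<bar>v (a \<otimes> g) - v g\<bar> < e"
  using assms unfolding right_uc_def by metis

lemma right_uc_add: assumes "right_uc u" "right_uc v" shows "right_uc (\<lambda>x. u x + v x)"
proof (rule right_ucI)
  fix e :: real assume e: "0 < e"
  then have e2: "0 < e / 2" by simp
  obtain U where U: "openin T U" "\<one> \<in> U" "\<And>a g. a \<in> U \<Longrightarrow> g \<in> carrier G \<Longrightarrow> \<bar>u (a \<otimes> g) - u g\<bar> < e / 2"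
    using right_ucE[OF assms(1) e2] by metis
  obtain V where V: "openin T V" "\<one> \<in> V" "\<And>a g. a \<in> V \<Longrightarrow> g \<in> carrier G \<Longrightarrow> \<bar>v (a \<otimes> g) - v g\<bar> < e / 2"
    using right_ucE[OF assms(2) e2] by metis
  show "\<exists>U. openin T U \<and> \<one> \<in> U \<and> (\<forall>a\<in>U. \<forall>g\<in>carrier G. \<bar>u (a \<otimes> g) + v (a \<otimes> g) - (u g + v g)\<bar> < e)"
  proof (intro exI[of _ "U \<inter> V"] conjI ballI)
    fix a g assume "a \<in> U \<inter> V" "g \<in> carrier G"
    then show "\<bar>u (a \<otimes> g) + v (a \<otimes> g) - (u g + v g)\<bar> < e"
      using U(3)[of a g] V(3)[of a g] unfolding abs_less_iff by simp
  qed (use U V in auto)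
qed

lemma right_uc_scale: assumes "right_uc v" shows "right_uc (\<lambda>x. c * v x)"
proof (rule right_ucI)
  fix e :: real assume e: "0 < e"
  define d where "d = e / (\<bar>c\<bar> + 1)"
  have d: "0 < d" "\<bar>c\<bar> * d < e" using e by (auto simp: d_def field_simps add_pos_nonneg)
  obtain U where U: "openin T U" "\<one> \<in> U" "\<And>a g. a \<in> U \<Longrightarrow> g \<in> carrier G \<Longrightarrow> \<bar>v (a \<otimes> g) - v g\<bar> < d"
    using right_ucE[OF assms d(1)] by metis
  have "\<bar>c * v (a \<otimes> g) - c * v g\<bar> < e" if "a \<in> U" "g \<in> carrier G" for a g
  proof -
    have "\<bar>c * v (a \<otimes> g) - c * v g\<bar> = \<bar>c\<bar> * \<bar>v (a \<otimes> g) - v g\<bar>" by (simp add: abs_mult[symmetric] right_diff_distrib)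
    also have "\<dots> \<le> \<bar>c\<bar> * d" using U(3)[OF that] by (intro mult_left_mono) auto
    finally show ?thesis using d(2) by simp
  qed
  then show "\<exists>U. openin T U \<and> \<one> \<in> U \<and> (\<forall>a\<in>U. \<forall>g\<in>carrier G. \<bar>c * v (a \<otimes> g) - c * v g\<bar> < e)"
    using U(1,2) by blast
qed

lemma right_uc_abs: assumes "right_uc v" shows "right_uc (\<lambda>x. \<bar>v x\<bar>)"
proof (rule right_ucI)
  fix e :: real assume e: "0 < e"
  obtain U where U: "openin T U" "\<one> \<in> U" "\<And>a g. a \<in> U \<Longrightarrow> g \<in> carrier G \<Longrightarrow> \<bar>v (a \<otimes> g) - v g\<bar> < e"
    using right_ucE[OF assms e] by metis
  have "\<bar>\<bar>v (a \<otimes> g)\<bar> - \<bar>v g\<bar>\<bar> < e" if "a \<in> U" "g \<in> carrier G" for a g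
    using U(3)[OF that] by linarith
  then show "\<exists>U. openin T U \<and> \<one> \<in> U \<and> (\<forall>a\<in>U. \<forall>g\<in>carrier G. \<bar>\<bar>v (a \<otimes> g)\<bar> - \<bar>v g\<bar>\<bar> < e)"
    using U(1,2) by blast
qed

text \<open>\<open>b \<otimes> (a \<otimes> g) = (b \<otimes> a \<otimes> inv b) \<otimes> (b
  \<otimes> g)\<close>, and conjugation by a fixed \<open>b\<close> is continuous.\<close>

lemma right_uc_ltrans: assumes v: "right_uc v" and b: "b \<in> carrier G" shows "right_uc (\<lambda>x. v (b \<otimes> x))"
proof (rule right_ucI)
  fix e :: real assume e: "0 < e"
  obtain U where U: "openin T U" "\<one> \<in> U" "\<And>a g. a \<in> U \<Longrightarrow> g \<in> carrier G \<Longrightarrow> \<bar>v (a \<otimes> g) - v g\<bar> < e"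
    using right_ucE[OF v e] by metis
  have c: "continuous_map T T (\<lambda>x. b \<otimes> x \<otimes> inv b)"
    using b by (intro continuous_map_mult continuous_map_ltrans) (auto simp: topspace_eq)
  show "\<exists>U. openin T U \<and> \<one> \<in> U \<and> (\<forall>a\<in>U. \<forall>g\<in>carrier G. \<bar>v (b \<otimes> (a \<otimes> g)) - v (b \<otimes> g)\<bar> < e)"
  proof (intro exI[of _ "{x \<in> topspace T. b \<otimes> x \<otimes> inv b \<in> U}"] conjI ballI)
    show "openin T {x \<in> topspace T. b \<otimes> x \<otimes> inv b \<in> U}" using c U(1) by (rule openin_continuous_map_preimage)
    show "\<one> \<in> {x \<in> topspace T. b \<otimes> x \<otimes> inv b \<in> U}" using b U(2) by (simp add: topspace_eq)
    fix a g assume a: "a \<in> {x \<in> topspace T. b \<otimes> x \<otimes> inv b \<in> U}" and g: "g \<in> carrier G"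
    have "inv b \<otimes> (b \<otimes> g) = g" using b g by (simp add: m_assoc[symmetric])
    then have "(b \<otimes> a \<otimes> inv b) \<otimes> (b \<otimes> g) = b \<otimes> (a \<otimes> g)"
      using a b g by (simp add: topspace_eq m_assoc)
    then show "\<bar>v (b \<otimes> (a \<otimes> g)) - v (b \<otimes> g)\<bar> < e"
      using U(3)[of "b \<otimes> a \<otimes> inv b" "b \<otimes> g"] a b g by simp
  qed
qed

end

section \<open>Functions dominated by translates and their functionals\<close>

locale translate_dominated = topological_group +
  fixes f :: "'a \<Rightarrow> real" and t0 :: 'a
  assumes f_uc: "right_uc f" and f_bounded: "\<exists>B. \<forall>x\<in>carrier G. \<bar>f x\<bar> \<le> B"
    and f_nonneg: "\<And>x. x \<in> carrier G \<Longrightarrow> 0 \<le> f x"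
    and t0: "t0 \<in> carrier G" "0 < f t0"
begin

abbreviation "V \<equiv> dominated f"

definition maj :: "'a list \<Rightarrow> 'a \<Rightarrow> real" where
  "maj gs x = (\<Sum>g\<leftarrow>gs. f (inv g \<otimes> x))"

lemma maj_nonneg: "set gs \<subseteq> carrier G \<Longrightarrow> x \<in> carrier G \<Longrightarrow> 0 \<le> maj gs x"
  unfolding maj_def by (intro sum_list_nonneg) (auto intro!: f_nonneg)

lemma V_I:
  assumes "right_uc v" "\<And>x. x \<in> carrier G \<Longrightarrow> \<bar>v x\<bar> \<le> B" "set gs \<subseteq> carrier G" "\<And>x. x \<in> carrier G \<Longrightarrow> \<bar>v x\<bar> \<le> maj gs x"
  shows "v \<in> V"
  using assms unfolding dominated_def maj_def by blast

lemma V_E: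
  assumes "v \<in> V"
  obtains B gs where "right_uc v" "\<And>x. x \<in> carrier G \<Longrightarrow> \<bar>v x\<bar> \<le> B" "set gs \<subseteq> carrier G"
    "\<And>x. x \<in> carrier G \<Longrightarrow> \<bar>v x\<bar> \<le> maj gs x"
  using assms unfolding dominated_def maj_def by blast

lemma f_V: "f \<in> V"
proof -
  obtain B where "\<forall>x\<in>carrier G. \<bar>f x\<bar> \<le> B" using f_bounded by blast
  then show ?thesis by (intro V_I[of _ B "[\<one>]"] f_uc) (auto simp: maj_def f_nonneg)
qed

lemma V_add: assumes "u \<in> V" "v \<in> V" shows "(\<lambda>x. u x + v x) \<in> V"
proof -
  obtain B gs where u: "right_uc u" "\<And>x. x \<in> carrier G \<Longrightarrow> \<bar>u x\<bar> \<le> B" "set gs \<subseteq> carrier G"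
    "\<And>x. x \<in> carrier G \<Longrightarrow> \<bar>u x\<bar> \<le> maj gs x" using assms(1) by (rule V_E) blast
  obtain C hs where v: "right_uc v" "\<And>x. x \<in> carrier G \<Longrightarrow> \<bar>v x\<bar> \<le> C" "set hs \<subseteq> carrier G"
    "\<And>x. x \<in> carrier G \<Longrightarrow> \<bar>v x\<bar> \<le> maj hs x" using assms(2) by (rule V_E) blast
  show ?thesis
  proof (rule V_I[of _ "B + C" "gs @ hs"])
    show "right_uc (\<lambda>x. u x + v x)" using u v by (intro right_uc_add)
    fix x assume x: "x \<in> carrier G"
    show "\<bar>u x + v x\<bar> \<le> B + C" using u(2)[OF x] v(2)[OF x] by linarith
    show "\<bar>u x + v x\<bar> \<le> maj (gs @ hs) x" using u(4)[OF x] v(4)[OF x] by (simp add: maj_def)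
  qed (use u v in auto)
qed

lemma V_scale: assumes "v \<in> V" shows "(\<lambda>x. c * v x) \<in> V"
proof -
  obtain B gs where v: "right_uc v" "\<And>x. x \<in> carrier G \<Longrightarrow> \<bar>v x\<bar> \<le> B" "set gs \<subseteq> carrier G"
    "\<And>x. x \<in> carrier G \<Longrightarrow> \<bar>v x\<bar> \<le> maj gs x" using assms(1) by (rule V_E) blast
  obtain N where N: "\<bar>c\<bar> \<le> real N" using real_arch_simple by blast
  show ?thesis
  proof (rule V_I[of _ "\<bar>c\<bar> * B" "concat (replicate N gs)"])
    show "right_uc (\<lambda>x. c * v x)" using v by (intro right_uc_scale)
    fix x assume x: "x \<in> carrier G"
    show "\<bar>c * v x\<bar> \<le> \<bar>c\<bar> * B" using v(2)[OF x] by (simp add: abs_mult mult_left_mono)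
    have "\<bar>c * v x\<bar> \<le> real N * maj gs x"
      unfolding abs_mult using v(4)[OF x] N by (intro mult_mono) auto
    also have "\<dots> = maj (concat (replicate N gs)) x"
      unfolding maj_def by (induction N) (auto simp: algebra_simps)
    finally show "\<bar>c * v x\<bar> \<le> maj (concat (replicate N gs)) x" .
  qed (use v in auto)
qed

lemma V_diff: "u \<in> V \<Longrightarrow> v \<in> V \<Longrightarrow> (\<lambda>x. u x - v x) \<in> V"
  using V_add[of u "\<lambda>x. (-1) * v x"] V_scale[of v "-1"] by simp

lemma V_zero: "(\<lambda>x. 0) \<in> V"
  using V_scale[OF f_V, of 0] by simp

lemma V_abs: assumes "v \<in> V" shows "(\<lambda>x. \<bar>v x\<bar>) \<in> V"
proof -
  obtain B gs where v: "right_uc v" "\<And>x. x \<in> carrier G \<Longrightarrow> \<bar>v x\<bar> \<le> B" "set gs \<subseteq> carrier G"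
    "\<And>x. x \<in> carrier G \<Longrightarrow> \<bar>v x\<bar> \<le> maj gs x" using assms(1) by (rule V_E) blast
  then show ?thesis by (intro V_I[of _ B gs] right_uc_abs) auto
qed

lemma V_ltrans: assumes "v \<in> V" and b: "b \<in> carrier G" shows "(\<lambda>x. v (b \<otimes> x)) \<in> V"
proof -
  obtain B gs where v: "right_uc v" "\<And>x. x \<in> carrier G \<Longrightarrow> \<bar>v x\<bar> \<le> B" "set gs \<subseteq> carrier G"
    "\<And>x. x \<in> carrier G \<Longrightarrow> \<bar>v x\<bar> \<le> maj gs x" using assms(1) by (rule V_E) blast
  have maj: "maj gs (b \<otimes> x) = maj (map (\<lambda>g. inv b \<otimes> g) gs) x" if "x \<in> carrier G" for x
    unfolding maj_def map_map o_def using v(3) b that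
    by (intro arg_cong[of _ _ sum_list] map_cong) (auto simp: inv_mult_group m_assoc subset_eq)
  show ?thesis
  proof (rule V_I[of _ B "map (\<lambda>g. inv b \<otimes> g) gs"])
    show "right_uc (\<lambda>x. v (b \<otimes> x))" using v(1) b by (rule right_uc_ltrans)
    fix x assume x: "x \<in> carrier G"
    show "\<bar>v (b \<otimes> x)\<bar> \<le> B" using v(2) b x by simp
    show "\<bar>v (b \<otimes> x)\<bar> \<le> maj (map (\<lambda>g. inv b \<otimes> g) gs) x" unfolding maj[OF x, symmetric] using v(4) b x by simp
  qed (use v(3) b in auto)
qed

lemma maj_V: "set gs \<subseteq> carrier G \<Longrightarrow> maj gs \<in> V"
proof (induction gs)
  case Nil
  then show ?case using V_zero by (simp add: maj_def[abs_def])
next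
  case (Cons g gs)
  then show ?case using V_add[OF V_ltrans[OF f_V, of "inv g"], of "maj gs"] by (simp add: maj_def[abs_def])
qed

text \<open>The last clause excludes functionals that see values off \<open>carrier G\<close>. The
  group laws can fail there, and the identity for \<open>rep\<close> at a product would fail with
  them.\<close>

definition A :: "(('a \<Rightarrow> real) \<Rightarrow> real) set" where
  "A = {x. (\<forall>v. v \<notin> V \<longrightarrow> x v = 0) \<and> (\<forall>u\<in>V. \<forall>v\<in>V. x (\<lambda>y. u y + v y) = x u + x v) \<and>
     (\<forall>c. \<forall>v\<in>V. x (\<lambda>y. c * v y) = c * x v) \<and>
     (\<forall>u\<in>V. \<forall>v\<in>V. (\<forall>y\<in>carrier G. u y = v y) \<longrightarrow> x u = x v)}"

lemma A_support: "x \<in> A \<Longrightarrow> v \<notin> V \<Longrightarrow> x v = 0"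
  unfolding A_def by blast

lemma A_add: "x \<in> A \<Longrightarrow> u \<in> V \<Longrightarrow> v \<in> V \<Longrightarrow> x (\<lambda>y. u y + v y) = x u + x v"
  unfolding A_def by blast

lemma A_scale: "x \<in> A \<Longrightarrow> v \<in> V \<Longrightarrow> x (\<lambda>y. c * v y) = c * x v"
  unfolding A_def by blast

lemma A_cong: "x \<in> A \<Longrightarrow> u \<in> V \<Longrightarrow> v \<in> V \<Longrightarrow> (\<And>y. y \<in> carrier G \<Longrightarrow> u y = v y) \<Longrightarrow> x u = x v"
  unfolding A_def by blast

lemma A_I:
  assumes "\<And>v. v \<notin> V \<Longrightarrow> x v = 0"
    and "\<And>u v. u \<in> V \<Longrightarrow> v \<in> V \<Longrightarrow> x (\<lambda>y. u y + v y) = x u + x v"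
    and "\<And>c v. v \<in> V \<Longrightarrow> x (\<lambda>y. c * v y) = c * x v"
    and "\<And>u v. u \<in> V \<Longrightarrow> v \<in> V \<Longrightarrow> (\<And>y. y \<in> carrier G \<Longrightarrow> u y = v y) \<Longrightarrow> x u = x v"
  shows "x \<in> A"
  unfolding A_def using assms by blast

lemma A_diff: "x \<in> A \<Longrightarrow> u \<in> V \<Longrightarrow> v \<in> V \<Longrightarrow> x (\<lambda>y. u y - v y) = x u - x v"
  using A_add[of x u "\<lambda>y. (-1) * v y"] A_scale[of x v "-1"] V_scale[of v "-1"] by simp

lemma A_zero: "x \<in> A \<Longrightarrow> x (\<lambda>y. 0) = 0"
  using A_scale[of x f 0] f_V by simp

sublocale functional_space A V
proof
  show "V \<noteq> {}" using f_V by blast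
  show "(\<lambda>v. 0) \<in> A" by (rule A_I) auto
  show "x v = 0" if "x \<in> A" "v \<notin> V" for x v using that by (rule A_support)
  show "(\<lambda>v. x v + y v) \<in> A" if "x \<in> A" "y \<in> A" for x y
  proof (rule A_I)
    show "x u + y u = x v + y v" if "u \<in> V" "v \<in> V" "\<And>t. t \<in> carrier G \<Longrightarrow> u t = v t" for u v
      using A_cong[OF \<open>x \<in> A\<close> that] A_cong[OF \<open>y \<in> A\<close> that] by simp
  qed (use that in \<open>simp_all add: A_support A_add A_scale algebra_simps\<close>)
  show "(\<lambda>v. r * x v) \<in> A" if "x \<in> A" for r x
  proof (rule A_I)
    show "r * x u = r * x v" if "u \<in> V" "v \<in> V" "\<And>t. t \<in> carrier G \<Longrightarrow> u t = v t" for u v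
      using A_cong[OF \<open>x \<in> A\<close> that] by simp
  qed (use that in \<open>simp_all add: A_support A_add A_scale algebra_simps\<close>)
qed

definition comb :: "(real \<times> 'a) list \<Rightarrow> ('a \<Rightarrow> real) \<Rightarrow> real" where
  "comb ps v = (\<Sum>p\<leftarrow>ps. fst p * v (snd p))"

definition weights :: "(real \<times> 'a) list set" where
  "weights = {ps. \<forall>p\<in>set ps. 0 \<le> fst p \<and> snd p \<in> carrier G}"

text \<open>
  By definition every element is a limit of positive combinations of point evaluations. With the
  cone of all positive functionals this would require a separation theorem.
\<close>

definition C :: "(('a \<Rightarrow> real) \<Rightarrow> real) set" where
  "C = {x \<in> A. \<forall>Q e. finite Q \<and> Q \<subseteq> V \<and> 0 < e \<longrightarrow> (\<exists>ps\<in>weights. \<forall>v\<in>Q. \<bar>x v - comb ps v\<bar> < e)}"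

lemma C_A: "C \<subseteq> A"
  by (auto simp: C_def)

lemma C_approx:
  assumes "x \<in> C" "finite Q" "Q \<subseteq> V" "0 < e"
  shows "\<exists>ps\<in>weights. \<forall>v\<in>Q. \<bar>x v - comb ps v\<bar> < e"
  using assms unfolding C_def by blast

lemma C_I:
  assumes "x \<in> A" "\<And>Q e. finite Q \<Longrightarrow> Q \<subseteq> V \<Longrightarrow> 0 < e \<Longrightarrow> \<exists>ps\<in>weights. \<forall>v\<in>Q. \<bar>x v - comb ps v\<bar> < e"
  shows "x \<in> C"
  using assms unfolding C_def by blast

lemma C_nonneg:
  assumes x: "x \<in> C" and v: "v \<in> V" "\<And>y. y \<in> carrier G \<Longrightarrow> 0 \<le> v y"
  shows "0 \<le> x v"
proof (rule field_le_epsilon)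
  fix e :: real assume e: "0 < e"
  obtain ps where ps: "ps \<in> weights" "\<bar>x v - comb ps v\<bar> < e"
    using C_approx[OF x, of "{v}" e] v(1) e by auto
  have "0 \<le> comb ps v" unfolding comb_def using ps(1) v(2)
    by (intro sum_list_nonneg) (auto simp: weights_def intro!: mult_nonneg_nonneg)
  then show "0 \<le> x v + e" using ps(2) by (simp add: abs_less_iff)
qed

lemma C_mono:
  assumes x: "x \<in> C" and "u \<in> V" "v \<in> V" "\<And>y. y \<in> carrier G \<Longrightarrow> u y \<le> v y"
  shows "x u \<le> x v"
  using C_nonneg[OF x, of "\<lambda>y. v y - u y"] A_diff[of x v u] V_diff[of v u] assms C_A by auto

lemma C_abs_le:
  assumes x: "x \<in> C" and "u \<in> V" "v \<in> V" "\<And>y. y \<in> carrier G \<Longrightarrow> \<bar>u y\<bar> \<le> v y"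
  shows "\<bar>x u\<bar> \<le> x v"
proof -
  have xA: "x \<in> A" using x C_A by blast
  have 1: "u y \<le> v y" "(-1) * u y \<le> v y" if "y \<in> carrier G" for y
    using assms(4)[OF that] by linarith+
  have "x u \<le> x v" by (rule C_mono[OF x assms(2,3) 1(1)])
  moreover have "x (\<lambda>y. (-1) * u y) \<le> x v" by (rule C_mono[OF x V_scale[OF assms(2)] assms(3) 1(2)])
  ultimately show ?thesis using A_scale[OF xA assms(2), of "-1"] by linarith
qed

lemma C_add: assumes x: "x \<in> C" and y: "y \<in> C" shows "(\<lambda>v. x v + y v) \<in> C"
proof (rule C_I)
  show "(\<lambda>v. x v + y v) \<in> A" using x y C_A by (intro add_A) auto
  fix Q e assume Q: "finite Q" "Q \<subseteq> V" "0 < (e::real)"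
  obtain ps where ps0: "ps \<in> weights" "\<forall>v\<in>Q. \<bar>x v - comb ps v\<bar> < e / 2"
    using C_approx[OF x Q(1,2), of "e / 2"] Q(3) by auto
  note ps = ps0(1) bspec[OF ps0(2)]
  obtain qs where qs0: "qs \<in> weights" "\<forall>v\<in>Q. \<bar>y v - comb qs v\<bar> < e / 2"
    using C_approx[OF y Q(1,2), of "e / 2"] Q(3) by auto
  note qs = qs0(1) bspec[OF qs0(2)]
  show "\<exists>ps\<in>weights. \<forall>v\<in>Q. \<bar>x v + y v - comb ps v\<bar> < e"
  proof (intro bexI[of _ "ps @ qs"] ballI)
    fix v assume "v \<in> Q"
    from ps(2)[OF this] qs(2)[OF this] show "\<bar>x v + y v - comb (ps @ qs) v\<bar> < e"
      unfolding comb_def abs_less_iff by simp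
  qed (use ps qs in \<open>auto simp: weights_def\<close>)
qed

lemma C_scale: assumes x: "x \<in> C" and r: "0 \<le> r" shows "(\<lambda>v. r * x v) \<in> C"
proof (rule C_I)
  show "(\<lambda>v. r * x v) \<in> A" using x C_A by (intro smult_A) auto
  fix Q e assume Q: "finite Q" "Q \<subseteq> V" "0 < (e::real)"
  define d where "d = e / (r + 1)"
  have d: "0 < d" "r * d < e" using Q(3) r by (auto simp: d_def field_simps)
  obtain ps where ps0: "ps \<in> weights" "\<forall>v\<in>Q. \<bar>x v - comb ps v\<bar> < d"
    using C_approx[OF x Q(1,2) d(1)] by blast
  note ps = ps0(1) bspec[OF ps0(2)]
  show "\<exists>ps\<in>weights. \<forall>v\<in>Q. \<bar>r * x v - comb ps v\<bar> < e"
  proof (intro bexI[of _ "map (\<lambda>p. (r * fst p, snd p)) ps"] ballI)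
    fix v assume v: "v \<in> Q"
    have "comb (map (\<lambda>p. (r * fst p, snd p)) ps) v = r * comb ps v"
      by (simp add: comb_def o_def sum_list_const_mult mult.assoc)
    then have "\<bar>r * x v - comb (map (\<lambda>p. (r * fst p, snd p)) ps) v\<bar> = r * \<bar>x v - comb ps v\<bar>"
      using r by (simp add: right_diff_distrib[symmetric] abs_mult)
    also have "\<dots> \<le> r * d" using ps(2)[OF v] r by (intro mult_left_mono) auto
    finally show "\<bar>r * x v - comb (map (\<lambda>p. (r * fst p, snd p)) ps) v\<bar> < e" using d(2) by simp
  qed (use ps(1) r in \<open>auto simp: weights_def\<close>)
qed

definition ev :: "'a \<Rightarrow> ('a \<Rightarrow> real) \<Rightarrow> real" where
  "ev t v = (if v \<in> V then v t else 0)"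

lemma ev_A: "t \<in> carrier G \<Longrightarrow> ev t \<in> A"
  by (rule A_I) (simp_all add: ev_def V_add V_scale)

lemma ev_C: assumes t: "t \<in> carrier G" shows "ev t \<in> C"
proof (rule C_I[OF ev_A[OF t]])
  fix Q e assume "finite Q" "Q \<subseteq> V" "0 < (e::real)"
  then show "\<exists>ps\<in>weights. \<forall>v\<in>Q. \<bar>ev t v - comb ps v\<bar> < e"
    using t by (intro bexI[of _ "[(1, t)]"]) (auto simp: ev_def comb_def weights_def)
qed

text \<open>Elements of \<open>C\<close> are nonnegative on nonnegative functions, so if both
  \<open>z\<close> and its negative lie in \<open>C\<close>, then \<open>z\<close> vanishes on
  those. They span \<open>V\<close>, since \<open>v\<close> is the difference of
  \<open>\<bar>v\<bar> + v\<close> and \<open>\<bar>v\<bar>\<close>.\<close>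

lemma proper: "proper_cone \<E> C"
  unfolding proper_cone_def cone_in_def
proof (intro conjI ballI allI impI)
  show "C \<noteq> {}" using ev_C[OF t0(1)] by blast
  show "C \<subseteq> carrier \<E>" using C_A by simp
  have zC: "(\<lambda>v. 0) \<in> C" using C_scale[OF ev_C[OF t0(1)], of 0] by simp
  show "C \<inter> (\<lambda>x. \<ominus>\<^bsub>\<E>\<^esub> x) ` C = {\<zero>\<^bsub>\<E>\<^esub>}"
  proof (intro subset_antisym subsetI)
    fix z assume "z \<in> C \<inter> (\<lambda>x. \<ominus>\<^bsub>\<E>\<^esub> x) ` C"
    then obtain x where z: "z \<in> C" and x: "x \<in> C" "z = (\<lambda>v. - x v)" using uminus_eq C_A by fastforce
    have pos: "z v = 0" if "v \<in> V" "\<And>y. y \<in> carrier G \<Longrightarrow> 0 \<le> v y" for v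
      using C_nonneg[OF z that] C_nonneg[OF x(1) that] x(2) by simp
    have zA: "z \<in> A" using z C_A by blast
    have "z v = 0" for v
    proof (cases "v \<in> V")
      case True
      have "z (\<lambda>y. \<bar>v y\<bar> + v y) = 0" "z (\<lambda>y. \<bar>v y\<bar>) = 0"
        using True by (intro pos V_add V_abs; auto)+
      then show ?thesis using A_add[OF zA V_abs[OF True] True] by simp
    next
      case False
      then show ?thesis using A_support[OF zA] by simp
    qed
    then show "z \<in> {\<zero>\<^bsub>\<E>\<^esub>}" by auto
  next
    fix z assume "z \<in> {\<zero>\<^bsub>\<E>\<^esub>}"
    then show "z \<in> C \<inter> (\<lambda>x. \<ominus>\<^bsub>\<E>\<^esub> x) ` C"
      using zC zero_A uminus_eq[OF zero_A] by force
  qed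
qed (use C_add C_scale in auto)

text \<open>Membership in \<open>A\<close> consists of equations between finitely many evaluations,
  and the approximation clause of \<open>C\<close> survives a pointwise limit at the cost of halving
  \<open>e\<close>.\<close>

lemma weakly_complete_C: "weakly_complete \<E> \<tau> C"
proof (rule weakly_completeI[OF C_A])
  fix F c assume F: "F \<noteq> bot" "eventually (\<lambda>x. x \<in> C) F" "\<And>v. ((\<lambda>x. x v) \<longlongrightarrow> c v) F"
  have lim_eq: "a = b" if "(h \<longlongrightarrow> a) F" "(k \<longlongrightarrow> b) F" "\<And>x. x \<in> A \<Longrightarrow> h x = k x"
    for h k :: "(('a \<Rightarrow> real) \<Rightarrow> real) \<Rightarrow> real" and a b
  proof -
    have "eventually (\<lambda>x. h x = k x) F" using F(2) by eventually_elim (use C_A that(3) in auto)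
    then have "(k \<longlongrightarrow> a) F" using that(1) by (rule tendsto_cong[THEN iffD1])
    then show ?thesis using that(2) by (rule tendsto_unique[OF F(1)])
  qed
  have cA: "c \<in> A"
    proof (rule A_I)
    show "c v = 0" if "v \<notin> V" for v
      by (rule lim_eq[OF F(3) tendsto_const]) (rule A_support[OF _ that])
    fix u v assume uv: "u \<in> V" "v \<in> V"
    show "c (\<lambda>y. u y + v y) = c u + c v"
      by (rule lim_eq[OF F(3) tendsto_add[OF F(3) F(3)]]) (rule A_add[OF _ uv])
    show "c u = c v" if "\<And>y. y \<in> carrier G \<Longrightarrow> u y = v y"
      by (rule lim_eq[OF F(3) F(3)]) (rule A_cong[OF _ uv that])
  next
    fix r v assume v: "v \<in> V"
    show "c (\<lambda>y. r * v y) = r * c v"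
      by (rule lim_eq[OF F(3) tendsto_mult[OF tendsto_const F(3)]]) (rule A_scale[OF _ v])
  qed
  show "c \<in> C"
  proof (rule C_I[OF cA])
    fix Q e assume Q: "finite Q" "Q \<subseteq> V" "0 < (e::real)"
    have "eventually (\<lambda>x. \<forall>v\<in>Q. \<bar>x v - c v\<bar> < e / 2) F"
      using Q(1) tendstoD[OF F(3), of "e / 2"] Q(3)
      by (intro eventually_ball_finite) (simp_all add: dist_real_def)
    then have "eventually (\<lambda>x. x \<in> C \<and> (\<forall>v\<in>Q. \<bar>x v - c v\<bar> < e / 2)) F"
      using F(2) by eventually_elim simp
    then obtain x where x: "x \<in> C" "\<forall>v\<in>Q. \<bar>x v - c v\<bar> < e / 2"
      using eventually_happens'[OF F(1)] by blast
    obtain ps where ps0: "ps \<in> weights" "\<forall>v\<in>Q. \<bar>x v - comb ps v\<bar> < e / 2"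
      using C_approx[OF x(1) Q(1,2), of "e / 2"] Q(3) by auto
    note ps = ps0(1) bspec[OF ps0(2)]
    show "\<exists>ps\<in>weights. \<forall>v\<in>Q. \<bar>c v - comb ps v\<bar> < e"
    proof (intro bexI[of _ ps] ballI ps)
      fix v assume v: "v \<in> Q"
      show "\<bar>c v - comb ps v\<bar> < e" using ps(2)[OF v] x(2) v unfolding abs_less_iff by fastforce
    qed
  qed
qed

section \<open>The representation on the cone of functionals\<close>

definition rep :: "'a \<Rightarrow> (('a \<Rightarrow> real) \<Rightarrow> real) \<Rightarrow> ('a \<Rightarrow> real) \<Rightarrow> real" where
  "rep g x v = (if v \<in> V then x (\<lambda>y. v (g \<otimes> y)) else 0)"

lemma rep_A:
  assumes g: "g \<in> carrier G" and x: "x \<in> A"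
  shows "rep g x \<in> A"
proof (rule A_I)
  fix u v assume uv: "u \<in> V" "v \<in> V"
  show "rep g x (\<lambda>y. u y + v y) = rep g x u + rep g x v"
    using A_add[OF x V_ltrans[OF uv(1) g] V_ltrans[OF uv(2) g]] uv by (simp add: rep_def V_add)
  show "rep g x u = rep g x v" if "\<And>y. y \<in> carrier G \<Longrightarrow> u y = v y"
    using A_cong[OF x V_ltrans[OF uv(1) g] V_ltrans[OF uv(2) g]] that g uv by (simp add: rep_def)
next
  fix c v assume v: "v \<in> V"
  show "rep g x (\<lambda>y. c * v y) = c * rep g x v"
    using A_scale[OF x V_ltrans[OF v g]] v by (simp add: rep_def V_scale)
qed (simp add: rep_def)

text \<open>The orbit of the evaluation at the identity consists of all evaluations, so conditions
  on this orbit become conditions on the functions in \<open>V\<close>.\<close>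

lemma rep_ev: "g \<in> carrier G \<Longrightarrow> rep g (ev \<one>) = ev g"
  by (auto simp: rep_def ev_def V_ltrans fun_eq_iff)

lemma rep_C: assumes g: "g \<in> carrier G" and x: "x \<in> C" shows "rep g x \<in> C"
proof (rule C_I)
  show "rep g x \<in> A" using g x C_A by (intro rep_A) auto
  fix Q e assume Q: "finite Q" "Q \<subseteq> V" "0 < (e::real)"
  obtain ps where ps0: "ps \<in> weights" "\<forall>v\<in>(\<lambda>v y. v (g \<otimes> y)) ` Q. \<bar>x v - comb ps v\<bar> < e"
    using C_approx[OF x, of "(\<lambda>v y. v (g \<otimes> y)) ` Q" e] Q V_ltrans g by blast
  note ps = ps0(1) bspec[OF ps0(2)]
  have "comb (map (\<lambda>p. (fst p, g \<otimes> snd p)) ps) v = comb ps (\<lambda>y. v (g \<otimes> y))" for v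
    by (simp add: comb_def o_def)
  then show "\<exists>ps\<in>weights. \<forall>v\<in>Q. \<bar>rep g x v - comb ps v\<bar> < e"
    using ps Q(2) g by (intro bexI[of _ "map (\<lambda>p. (fst p, g \<otimes> snd p)) ps"]) (auto simp: rep_def weights_def)
qed

lemma representation: "cone_representation G \<E> \<tau> C rep"
  unfolding cone_representation_def linear_operator_def
proof (intro conjI ballI allI)
  fix g assume g: "g \<in> carrier G"
  show "rep g \<in> carrier \<E> \<rightarrow> carrier \<E>" using rep_A g by auto
  show "continuous_map \<tau> \<tau> (rep g)"
  proof (rule continuous_into_\<tau>)
    show "rep g ` topspace \<tau> \<subseteq> A" using rep_A g by auto
    fix v assume "v \<in> V"
    then show "continuous_map \<tau> euclideanreal (\<lambda>x. rep g x v)"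
      using continuous_ev[OF V_ltrans[of v g]] g by (simp add: rep_def)
  qed
  show "rep g ` C \<subseteq> C" using rep_C g by auto
  fix h x assume h: "h \<in> carrier G" and x: "x \<in> carrier \<E>"
  then have xA: "x \<in> A" by simp
  show "rep (g \<otimes> h) x = rep g (rep h x)"
  proof
    fix v
    show "rep (g \<otimes> h) x v = rep g (rep h x) v"
    proof (cases "v \<in> V")
      case True
      then have "x (\<lambda>y. v (g \<otimes> h \<otimes> y)) = x (\<lambda>y. v (g \<otimes> (h \<otimes> y)))"
        using V_ltrans[OF V_ltrans[OF True g] h] V_ltrans[OF True, of "g \<otimes> h"] g h
        by (intro A_cong[OF xA]) (auto simp: m_assoc)
      then show ?thesis using True V_ltrans[OF True g] by (simp add: rep_def)
    qed (simp add: rep_def)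
  qed
next
  fix x assume "x \<in> carrier \<E>"
  then have xA: "x \<in> A" by simp
  show "rep \<one> x = x"
  proof
    fix v
    show "rep \<one> x v = x v"
      using A_support[OF xA, of v] A_cong[OF xA V_ltrans[of v \<one>], of v] by (auto simp: rep_def)
  qed
qed (auto simp: rep_def)

text \<open>For the base point \<open>ev \<one>\<close> the two orbit conditions say that the
  functions in \<open>V\<close> are bounded and right-uniformly continuous, tested on the finitely
  many functions that define a neighbourhood.\<close>

lemma orbit_uniformly_continuous:
  "locally_bounded_right_uniformly_continuous G T \<E> \<tau> C rep"
  unfolding locally_bounded_right_uniformly_continuous_def
proof (intro bexI[of _ "ev \<one>"] conjI allI impI)
  show "ev \<one> \<in> C" by (rule ev_C) simp
  have "(\<lambda>x. f (t0 \<otimes> x)) \<in> V" using V_ltrans[OF f_V t0(1)] .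
  then have "ev \<one> (\<lambda>x. f (t0 \<otimes> x)) \<noteq> 0" using t0 by (simp add: ev_def)
  then show "ev \<one> \<noteq> \<zero>\<^bsub>\<E>\<^esub>" by fastforce
  show "bounded_in \<E> \<tau> ((\<lambda>g. rep g (ev \<one>)) ` carrier G)"
    unfolding bounded_in_def
  proof (intro conjI allI impI)
    show "(\<lambda>g. rep g (ev \<one>)) ` carrier G \<subseteq> carrier \<E>"
      using rep_ev ev_A by auto
    fix U assume U: "openin \<tau> U \<and> \<zero>\<^bsub>\<E>\<^esub> \<in> U"
    obtain Q e where Q: "finite Q" "Q \<subseteq> V" "0 < e" "{y \<in> A. \<forall>v\<in>Q. \<bar>y v - 0\<bar> < e} \<subseteq> U"
      using \<tau>_basis[of U "\<lambda>v. 0"] U by auto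
    have "\<forall>v\<in>Q. \<exists>B. \<forall>x\<in>carrier G. \<bar>v x\<bar> \<le> B" using Q(2) by (auto simp: dominated_def)
    then obtain B where B: "\<And>v x. v \<in> Q \<Longrightarrow> x \<in> carrier G \<Longrightarrow> \<bar>v x\<bar> \<le> B v" by metis
    define M where "M = (\<Sum>v\<in>Q. \<bar>B v\<bar>)"
    have M: "\<bar>v x\<bar> \<le> M" if "v \<in> Q" "x \<in> carrier G" for v x
    proof -
      have "\<bar>B v\<bar> \<le> M" unfolding M_def using Q(1) that by (intro member_le_sum) auto
      then show ?thesis using B[OF that] by linarith
    qed
    have M0: "0 \<le> M" unfolding M_def by (intro sum_nonneg) auto
    show "\<exists>r>0. \<forall>t. r \<le> \<bar>t\<bar> \<longrightarrow> (\<lambda>g. rep g (ev \<one>)) ` carrier G \<subseteq> (\<lambda>x. t \<odot>\<^bsub>\<E>\<^esub> x) ` U"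
    \<comment> \<open>\<open>M\<close> may be 0; using \<open>M + 1\<close> makes \<open>t\<close>
      non-zero and the estimate strict.\<close>
    proof (intro exI[of _ "(M + 1) / e"] conjI allI impI subsetI)
      show "0 < (M + 1) / e" using M0 Q(3) by simp
      fix t x assume t: "(M + 1) / e \<le> \<bar>t\<bar>" and x: "x \<in> (\<lambda>g. rep g (ev \<one>)) ` carrier G"
      have t1: "M + 1 \<le> \<bar>t\<bar> * e" using t Q(3) by (simp add: divide_le_eq)
      then have tn: "t \<noteq> 0" using M0 by auto
      obtain g where g: "g \<in> carrier G" "x = ev g" using x rep_ev by auto
      define y where "y v = (1 / t) * x v" for v
      have "y \<in> A" unfolding y_def[abs_def] g(2) by (rule smult_A[OF ev_A[OF g(1)]])
      moreover have "\<bar>y v\<bar> < e" if v: "v \<in> Q" for v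
      proof -
        have "\<bar>x v\<bar> \<le> M" using M[OF v g(1)] v Q(2) g(2) by (auto simp: ev_def)
        then have "\<bar>x v\<bar> < \<bar>t\<bar> * e" using t1 by simp
        then show ?thesis using tn by (simp add: y_def abs_mult divide_less_eq mult.commute)
      qed
      ultimately have "y \<in> U" using Q(4) by auto
      moreover have "x = t \<odot>\<^bsub>\<E>\<^esub> y" using tn by (simp add: y_def fun_eq_iff)
      ultimately show "x \<in> (\<lambda>x. t \<odot>\<^bsub>\<E>\<^esub> x) ` U" by blast
    qed
  qed
  fix U assume U: "openin \<tau> U \<and> \<zero>\<^bsub>\<E>\<^esub> \<in> U"
  obtain Q e where Q: "finite Q" "Q \<subseteq> V" "0 < e" "{y \<in> A. \<forall>v\<in>Q. \<bar>y v - 0\<bar> < e} \<subseteq> U"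
    using \<tau>_basis[of U "\<lambda>v. 0"] U by auto
  have "\<forall>v\<in>Q. \<exists>W. openin T W \<and> \<one> \<in> W \<and> (\<forall>a\<in>W. \<forall>g\<in>carrier G. \<bar>v (a \<otimes> g) - v g\<bar> < e)"
    using Q(2,3) by (auto simp: dominated_def right_uc_def)
  then obtain W where W: "\<And>v. v \<in> Q \<Longrightarrow> openin T (W v) \<and> \<one> \<in> W v"
     "\<And>v a g. v \<in> Q \<Longrightarrow> a \<in> W v \<Longrightarrow> g \<in> carrier G \<Longrightarrow> \<bar>v (a \<otimes> g) - v g\<bar> < e"
    by metis
  show "\<exists>W. openin T W \<and> \<one> \<in> W \<and> (\<forall>a\<in>W. \<forall>g\<in>carrier G.
      rep (a \<otimes> g) (ev \<one>) \<ominus>\<^bsub>\<E>\<^esub> rep g (ev \<one>) \<in> U)"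
  proof (intro exI[of _ "topspace T \<inter> \<Inter>(W ` Q)"] conjI ballI)
    show "openin T (topspace T \<inter> \<Inter>(W ` Q))" using Q(1) W(1) by (intro openin_Int_Inter) auto
    show "\<one> \<in> topspace T \<inter> \<Inter>(W ` Q)" using W(1) by (auto simp: topspace_eq)
    fix a g assume a: "a \<in> topspace T \<inter> \<Inter>(W ` Q)" and g: "g \<in> carrier G"
    then have aG: "a \<in> carrier G" by (simp add: topspace_eq)
    have eA: "ev (a \<otimes> g) \<in> A" "ev g \<in> A" using ev_A aG g by auto
    have "(\<lambda>v. ev (a \<otimes> g) v - ev g v) \<in> A"
      using add_A[OF eA(1) smult_A[OF eA(2), of "-1"]] by simp
    moreover have "\<bar>ev (a \<otimes> g) v - ev g v\<bar> < e" if "v \<in> Q" for v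
      using W(2)[OF that _ g] a that Q(2) by (auto simp: ev_def)
    ultimately have "(\<lambda>v. ev (a \<otimes> g) v - ev g v) \<in> U" using Q(4) by auto
    then show "rep (a \<otimes> g) (ev \<one>) \<ominus>\<^bsub>\<E>\<^esub> rep g (ev \<one>) \<in> U"
      using rep_ev aG g minus_eq[OF eA] by simp
  qed
qed

lemma C_maj: "x \<in> C \<Longrightarrow> set gs \<subseteq> carrier G \<Longrightarrow> x (maj gs) = (\<Sum>g\<leftarrow>gs. x (\<lambda>y. f (inv g \<otimes> y)))"
proof (induction gs)
  case Nil
  then show ?case using A_zero C_A by (auto simp: maj_def[abs_def])
next
  case (Cons g gs)
  have "maj (g # gs) = (\<lambda>y. f (inv g \<otimes> y) + maj gs y)" by (simp add: maj_def fun_eq_iff)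
  then show ?case
    using Cons A_add[of x "\<lambda>y. f (inv g \<otimes> y)" "maj gs"] C_A V_ltrans[OF f_V, of "inv g"] maj_V[of gs] by auto
qed

text \<open>Evaluation at \<open>f\<close> is the cobounding functional. A continuous
  \<open>l\<close> is bounded by \<open>M\<close> times a finite sum of absolute values
  \<open>\<bar>x v\<bar>\<close>. For \<open>x\<close> in \<open>C\<close> this is at most
  \<open>x u\<close>, with \<open>u\<close> equal to \<open>M\<close> times the sum of the functions
  \<open>\<bar>v\<bar>\<close>; since \<open>u\<close> lies in \<open>V\<close>, it is below
  finitely many translates of \<open>f\<close>.\<close>

lemma cobounded: "cobounded_type G \<E> \<tau> C rep"
  unfolding cobounded_type_def
proof (intro bexI[of _ "\<lambda>x. x f"] ballI)
  show "(\<lambda>x. x f) \<in> topological_dual \<E> \<tau>" by (rule ev_dual[OF f_V])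
  fix l assume "l \<in> topological_dual \<E> \<tau>"
  then obtain Q M where Q: "finite Q" "Q \<subseteq> V" "0 < M" "\<And>x. x \<in> A \<Longrightarrow> \<bar>l x\<bar> \<le> M * (\<Sum>v\<in>Q. \<bar>x v\<bar>)"
    by (rule dual_bound) blast
  define u where "u y = M * (\<Sum>v\<in>Q. \<bar>v y\<bar>)" for y
  have sum: "(\<lambda>y. \<Sum>v\<in>Q. \<bar>v y\<bar>) \<in> V \<and> (\<forall>x\<in>A. x (\<lambda>y. \<Sum>v\<in>Q. \<bar>v y\<bar>) = (\<Sum>v\<in>Q. x (\<lambda>y. \<bar>v y\<bar>)))"
    using Q(1,2)
  proof (induction Q rule: finite_induct)
    case empty
    then show ?case using V_zero A_zero by simp
  next
    case (insert v Q)
    then show ?case using V_add[OF V_abs[of v]] A_add[OF _ V_abs[of v]] by auto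
  qed
  then have uV: "u \<in> V" unfolding u_def[abs_def] by (intro V_scale) auto
  obtain B gs where gs: "set gs \<subseteq> carrier G" "\<And>y. y \<in> carrier G \<Longrightarrow> \<bar>u y\<bar> \<le> maj gs y"
    using uV by (rule V_E) blast
  have bound: "\<bar>l x\<bar> \<le> (\<Sum>j = 1..length gs. adjoint_rep G rep (gs ! (j - 1)) (\<lambda>x. x f) x)" if x: "x \<in> C" for x
  proof -
    have xA: "x \<in> A" using x C_A by blast
    have "\<bar>l x\<bar> \<le> M * (\<Sum>v\<in>Q. \<bar>x v\<bar>)" by (rule Q(4)[OF xA])
    also have "\<dots> \<le> M * (\<Sum>v\<in>Q. x (\<lambda>y. \<bar>v y\<bar>))"
      using Q(2,3) C_abs_le[OF x] V_abs by (intro mult_left_mono sum_mono) auto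
    also have "\<dots> = x u" unfolding u_def[abs_def] using A_scale[OF xA] sum xA by simp
    also have "\<dots> \<le> x (maj gs)"
      using gs(2) by (intro C_mono[OF x uV maj_V[OF gs(1)]]) fastforce
    also have "\<dots> = (\<Sum>g\<leftarrow>gs. x (\<lambda>y. f (inv g \<otimes> y)))" by (rule C_maj[OF x gs(1)])
    also have "\<dots> = (\<Sum>j = 0..<length gs. adjoint_rep G rep (gs ! j) (\<lambda>x. x f) x)"
      by (simp add: sum_list_sum_nth adjoint_rep_def rep_def f_V)
    \<comment> \<open>List positions start at 0, the sums in the notion of cobounded type at
      1.\<close>
    also have "\<dots> = (\<Sum>j = 1..length gs. adjoint_rep G rep (gs ! (j - 1)) (\<lambda>x. x f) x)"
      by (rule sum.reindex_bij_witness[of _ "\<lambda>j. j - 1" Suc]) auto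
    finally show ?thesis .
  qed
  show "\<exists>(n::nat) g. (\<forall>j\<in>{1..n}. g j \<in> carrier G) \<and> dual_le C l (\<lambda>x. \<Sum>j = 1..n. adjoint_rep G rep (g j) (\<lambda>x. x f) x) \<and>
      dual_le C (\<lambda>x. - l x) (\<lambda>x. \<Sum>j = 1..n. adjoint_rep G rep (g j) (\<lambda>x. x f) x)"
  proof (rule exI[of _ "length gs"], rule exI[of _ "\<lambda>j. gs ! (j - 1)"], intro conjI ballI)
    show "gs ! (j - 1) \<in> carrier G" if "j \<in> {1..length gs}" for j
      using gs(1) that nth_mem[of "j - 1" gs] by fastforce
  qed (use bound in \<open>fastforce simp: dual_le_def\<close>)+
qed

text \<open>Positivity at \<open>f\<close> follows from the fixed point being non-zero: if
  \<open>M f = 0\<close>, invariance kills every translate of \<open>f\<close>, and domination then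
  kills all of \<open>V\<close>.\<close>

theorem invariant_functional:
  assumes "fixed_point_property_for_cones TYPE(('a \<Rightarrow> real) \<Rightarrow> real) G T"
  shows "\<exists>M\<in>C. 0 < M f \<and> (\<forall>g\<in>carrier G. \<forall>v\<in>V. M (\<lambda>y. v (g \<otimes> y)) = M v)"
proof -
  have "\<exists>x\<in>C. x \<noteq> \<zero>\<^bsub>\<E>\<^esub> \<and> (\<forall>g\<in>carrier G. rep g x = x)"
    by (rule assms[unfolded fixed_point_property_for_cones_def, THEN spec[of _ \<E>], THEN spec[of _ \<tau>],
          THEN spec[of _ C], THEN spec[of _ rep], THEN mp])
      (intro conjI locally_convex proper weakly_complete_C representation orbit_uniformly_continuous cobounded)
  then obtain M where M0: "M \<in> C" "M \<noteq> \<zero>\<^bsub>\<E>\<^esub> \<and> (\<forall>g\<in>carrier G. rep g M = M)"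
    by (rule bexE)
  then have M: "M \<in> C" "M \<noteq> (\<lambda>v. 0)" "\<And>g. g \<in> carrier G \<Longrightarrow> rep g M = M" by simp_all
  have inv: "M (\<lambda>y. v (g \<otimes> y)) = M v" if "g \<in> carrier G" "v \<in> V" for g v
    using M(3)[OF that(1), THEN fun_cong, of v] that(2) by (simp add: rep_def)
  have "M f \<noteq> 0"
  proof
    assume 0: "M f = 0"
    have "M v = 0" for v
    proof (cases "v \<in> V")
      case True
      obtain B gs where gs: "set gs \<subseteq> carrier G" "\<And>y. y \<in> carrier G \<Longrightarrow> \<bar>v y\<bar> \<le> maj gs y"
        using True by (rule V_E) blast
      have "\<bar>M v\<bar> \<le> M (maj gs)" by (rule C_abs_le[OF M(1) True maj_V[OF gs(1)] gs(2)])
      also have "\<dots> = (\<Sum>g\<leftarrow>gs. 0)"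
        unfolding C_maj[OF M(1) gs(1)]
        by (intro arg_cong[of _ _ sum_list] map_cong refl) (use gs(1) inv[OF _ f_V] 0 in \<open>simp add: subset_eq\<close>)
      finally show ?thesis by simp
    next
      case False
      then show ?thesis using A_support M(1) C_A by blast
    qed
    then show False using M(2) by auto
  qed
  moreover have "0 \<le> M f" by (rule C_nonneg[OF M(1) f_V f_nonneg])
  ultimately show ?thesis using M(1) inv by (intro bexI[of _ M]) auto
qed

end


section \<open>Passing to a closed subgroup\<close>

lemma (in topological_group) right_uc_continuous:
  assumes v: "right_uc v"
  shows "continuous_map T euclideanreal v"
proof (rule continuous_map_realI)
  fix x and e :: real assume x: "x \<in> topspace T" and e: "0 < e"
  have xG: "x \<in> carrier G" using x by (simp add: topspace_eq)
  obtain U where U: "openin T U" "\<one> \<in> U" "\<And>a g. a \<in> U \<Longrightarrow> g \<in> carrier G \<Longrightarrow> \<bar>v (a \<otimes> g) - v g\<bar> < e"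
    using right_ucE[OF v e] by metis
  show "\<exists>U. openin T U \<and> x \<in> U \<and> (\<forall>x'\<in>U. \<bar>v x' - v x\<bar> < e)"
  proof (intro exI[of _ "{y \<in> topspace T. y \<otimes> inv x \<in> U}"] conjI ballI)
    show "openin T {y \<in> topspace T. y \<otimes> inv x \<in> U}"
      using continuous_map_rtrans[OF inv_closed[OF xG]] U(1) by (rule openin_continuous_map_preimage)
    show "x \<in> {y \<in> topspace T. y \<otimes> inv x \<in> U}" using x xG U(2) by simp
    fix y assume y: "y \<in> {y \<in> topspace T. y \<otimes> inv x \<in> U}"
    then have "(y \<otimes> inv x) \<otimes> x = y" using xG by (simp add: topspace_eq m_assoc)
    then show "\<bar>v y - v x\<bar> < e" using U(3)[of "y \<otimes> inv x" x] y xG by simp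
  qed
qed

lemma (in translate_dominated) V_solid:
  assumes "right_uc v" "u \<in> V" "\<And>x. x \<in> carrier G \<Longrightarrow> \<bar>v x\<bar> \<le> u x"
  shows "v \<in> V"
proof -
  obtain B gs where u: "set gs \<subseteq> carrier G" "\<And>x. x \<in> carrier G \<Longrightarrow> \<bar>u x\<bar> \<le> B"
    "\<And>x. x \<in> carrier G \<Longrightarrow> \<bar>u x\<bar> \<le> maj gs x" using assms(2) by (rule V_E) blast
  show ?thesis
  proof (rule V_I[OF assms(1) _ u(1)])
    fix x assume x: "x \<in> carrier G"
    show "\<bar>v x\<bar> \<le> B" "\<bar>v x\<bar> \<le> maj gs x" using assms(3)[OF x] u(2,3)[OF x] by linarith+
  qed
qed

locale closed_subgroup = locally_compact_group +
  fixes H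
  assumes H: "subgroup H G" and closed: "closedin T H"
begin

abbreviation "K \<equiv> G\<lparr>carrier := H\<rparr>"
abbreviation "TH \<equiv> subtopology T H"

lemma H_carrier: "h \<in> H \<Longrightarrow> h \<in> carrier G"
  using subgroup.mem_carrier[OF H] .

lemma H_mult: "h \<in> H \<Longrightarrow> k \<in> H \<Longrightarrow> h \<otimes> k \<in> H"
  using subgroup.m_closed[OF H] .

lemma H_inv: "h \<in> H \<Longrightarrow> inv h \<in> H"
  using subgroup.m_inv_closed[OF H] .

lemma topspace_Int_H [simp]: "topspace T \<inter> H = H"
  using closedin_subset[OF closed] by blast

lemma inv_K [simp]: "h \<in> H \<Longrightarrow> inv\<^bsub>K\<^esub> h = inv h"
  by (rule m_inv_consistent[OF H])

lemma locally_compact_group_K: "locally_compact_group K TH"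
proof (intro locally_compact_group.intro topological_group.intro topological_group_axioms.intro
    locally_compact_group_axioms.intro)
  show "group K" by (rule subgroup_imp_group[OF H])
  show "topspace TH = carrier K" by simp
  have "continuous_map (subtopology (prod_topology T T) (H \<times> H)) T (\<lambda>(x, y). x \<otimes> y)"
    using continuous_mult by (rule continuous_map_from_subtopology)
  then have "continuous_map (prod_topology TH TH) TH (\<lambda>(x, y). x \<otimes> y)"
    using H_mult by (auto simp: continuous_map_in_subtopology subtopology_Times)
  then show "continuous_map (prod_topology TH TH) TH (\<lambda>(x, y). x \<otimes>\<^bsub>K\<^esub> y)" by simp
  have "continuous_map TH TH (\<lambda>x. inv x)"
    using continuous_map_from_subtopology[OF continuous_inv, of H] H_inv
    by (auto simp: continuous_map_in_subtopology)
  then show "continuous_map TH TH (\<lambda>x. inv\<^bsub>K\<^esub> x)"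
    by (rule continuous_map_eq) simp
  show "locally_compact_space TH" using locally_compact closed by (rule locally_compact_space_closed_subset)
  show "Hausdorff_space TH" using Hausdorff by (rule Hausdorff_space_subtopology)
qed

sublocale K: locally_compact_group K TH
  by (rule locally_compact_group_K)

text \<open>Closedness of \<open>H\<close> makes the trace of a compact set on \<open>H\<close>
  compact.\<close>

lemma Cc_restrict: assumes "f \<in> Cc T" shows "f \<in> Cc TH"
proof -
  obtain L where L: "compactin T L" "\<And>x. x \<in> topspace T \<Longrightarrow> x \<notin> L \<Longrightarrow> f x = 0" using CcE[OF assms] by metis
  show ?thesis
  proof (rule CcI)
    show "continuous_map TH euclideanreal f"
      using Cc_continuous[OF assms] by (rule continuous_map_from_subtopology)
    show "compactin TH (H \<inter> L)" using closed_Int_compactin[OF closed L(1)] by (simp add: compactin_subtopology)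
    fix x assume "x \<in> topspace TH" "x \<notin> H \<inter> L"
    then show "f x = 0" using L(2) H_carrier by (simp add: topspace_eq)
  qed
qed

end

section \<open>Convolution over the subgroup\<close>

locale subgroup_Haar = closed_subgroup +
  fixes \<mu> :: "('a \<Rightarrow> real) \<Rightarrow> real" and \<psi> :: "'a \<Rightarrow> real"
  assumes Haar: "K.left_Haar \<mu>" and \<psi>: "\<psi> \<in> Cc TH" "\<mu> \<psi> \<noteq> 0"
begin

lemma pf: "positive_functional TH \<mu>"
  by (rule K.left_HaarD(1)[OF Haar])

lemma Haar_invariant: "h \<in> H \<Longrightarrow> p \<in> Cc TH \<Longrightarrow> \<mu> (\<lambda>x. p (h \<otimes> x)) = \<mu> p"
  using K.left_HaarD(2)[OF Haar, of h p] by simp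

text \<open>The convolution \<open>(p * F \<mu>\<^sup>r)(g) = \<integral> p(g h) F(h\<inverse>) d\<mu>(h)\<close> of \<open>p\<close> with \<open>F\<close> times the right Haar measure
  of the subgroup. With the left Haar measure it need not be bounded.\<close>

definition conv :: "('a \<Rightarrow> real) \<Rightarrow> ('a \<Rightarrow> real) \<Rightarrow> 'a \<Rightarrow> real" where
  "conv p F g = \<mu> (\<lambda>h. p (g \<otimes> h) * F (inv h))"

abbreviation cont :: "('a \<Rightarrow> real) \<Rightarrow> bool" where
  "cont F \<equiv> continuous_map TH euclideanreal F"

lemma cont_inv: "cont F \<Longrightarrow> cont (\<lambda>h. F (inv h))"
  by (rule continuous_map_eq[OF K.continuous_map_compose_real[OF K.continuous_inv, of F]]) simp_all

lemma conv_Cc: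
  assumes "p \<in> Cc T" "cont F" "g \<in> carrier G"
  shows "(\<lambda>h. p (g \<otimes> h) * F (inv h)) \<in> Cc TH"
  using Cc_restrict[OF Cc_ltrans[OF assms(1,3)]] cont_inv[OF assms(2)] by (rule Cc_mult)

lemma conv_add_left:
  assumes "p \<in> Cc T" "q \<in> Cc T" "cont F" "g \<in> carrier G"
  shows "conv (\<lambda>x. p x + q x) F g = conv p F g + conv q F g"
  unfolding conv_def distrib_right
  by (rule pf_add[OF pf conv_Cc[OF assms(1,3,4)] conv_Cc[OF assms(2,3,4)]])

lemma conv_diff_left:
  assumes "p \<in> Cc T" "q \<in> Cc T" "cont F" "g \<in> carrier G"
  shows "conv (\<lambda>x. p x - q x) F g = conv p F g - conv q F g"
  unfolding conv_def left_diff_distrib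
  by (rule pf_diff[OF pf conv_Cc[OF assms(1,3,4)] conv_Cc[OF assms(2,3,4)]])

lemma conv_scale_left:
  assumes "p \<in> Cc T" "cont F" "g \<in> carrier G"
  shows "conv (\<lambda>x. c * p x) F g = c * conv p F g"
  unfolding conv_def mult.assoc by (rule pf_scale[OF pf conv_Cc[OF assms]])

lemma conv_add_right:
  assumes "p \<in> Cc T" "cont F" "cont F'" "g \<in> carrier G"
  shows "conv p (\<lambda>x. F x + F' x) g = conv p F g + conv p F' g"
  unfolding conv_def distrib_left
  by (rule pf_add[OF pf conv_Cc[OF assms(1,2,4)] conv_Cc[OF assms(1,3,4)]])

lemma conv_cong:
  assumes "p \<in> Cc T" "cont F" "q \<in> Cc T" "cont F'" "g \<in> carrier G"
    "\<And>x. x \<in> carrier G \<Longrightarrow> p x = q x" "\<And>x. x \<in> H \<Longrightarrow> F x = F' x"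
  shows "conv p F g = conv q F' g"
  unfolding conv_def
  by (rule pf_cong[OF pf conv_Cc[OF assms(1,2,5)] conv_Cc[OF assms(3,4,5)]]) (use assms H_carrier H_inv in auto)

lemma conv_mono:
  assumes "p \<in> Cc T" "cont F" "q \<in> Cc T" "cont F'" "g \<in> carrier G"
    "\<And>h. h \<in> H \<Longrightarrow> p (g \<otimes> h) * F (inv h) \<le> q (g \<otimes> h) * F' (inv h)"
  shows "conv p F g \<le> conv q F' g"
  unfolding conv_def
  by (rule pf_mono[OF pf conv_Cc[OF assms(1,2,5)] conv_Cc[OF assms(3,4,5)]]) (use assms(6) in simp)

lemma conv_abs_le:
  assumes "p \<in> Cc T" "cont F" "q \<in> Cc T" "cont F'" "g \<in> carrier G"
    "\<And>h. h \<in> H \<Longrightarrow> \<bar>p (g \<otimes> h) * F (inv h)\<bar> \<le> q (g \<otimes> h) * F' (inv h)"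
  shows "\<bar>conv p F g\<bar> \<le> conv q F' g"
  unfolding conv_def
  by (rule pf_abs_le[OF pf conv_Cc[OF assms(1,2,5)] conv_Cc[OF assms(3,4,5)]]) (use assms(6) in simp)

lemma conv_nonneg:
  assumes "p \<in> Cc T" "cont F" "g \<in> carrier G" "\<And>x. x \<in> carrier G \<Longrightarrow> 0 \<le> p x" "\<And>x. x \<in> H \<Longrightarrow> 0 \<le> F x"
  shows "0 \<le> conv p F g"
  unfolding conv_def
  by (rule pf_nonneg[OF pf conv_Cc[OF assms(1-3)]]) (use assms(3-5) H_carrier H_inv in auto)

lemma conv_ltrans:
  assumes "p \<in> Cc T" "cont F" "b \<in> carrier G" "g \<in> carrier G"
  shows "conv p F (b \<otimes> g) = conv (\<lambda>x. p (b \<otimes> x)) F g"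
  unfolding conv_def
  by (rule pf_cong[OF pf conv_Cc[OF assms(1,2)] conv_Cc[OF Cc_ltrans[OF assms(1,3)] assms(2,4)]])
    (use assms(3,4) H_carrier in \<open>auto simp: m_assoc\<close>)

text \<open>Right translation by \<open>k\<close> turns \<open>\<mu>\<close> into another left Haar
  functional, so uniqueness makes it a multiple of \<open>\<mu>\<close>; the factor is read off at
  \<open>\<psi>\<close>.\<close>

lemma right_scaling:
  assumes k: "k \<in> H"
  shows "\<exists>d. \<forall>p\<in>Cc TH. \<mu> (\<lambda>h. p (h \<otimes> k)) = d * \<mu> p"
proof -
  have rt: "(\<lambda>h. p (h \<otimes> k)) \<in> Cc TH" if "p \<in> Cc TH" for p
    using K.Cc_rtrans[OF that, of k] k by simp
  have "K.left_Haar (\<lambda>p. \<mu> (\<lambda>h. p (h \<otimes> k)))"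
    unfolding K.left_Haar_def positive_functional_def
  proof (intro conjI ballI allI impI)
    fix p q assume p: "p \<in> Cc TH" and q: "q \<in> Cc TH"
    show "\<mu> (\<lambda>h. p (h \<otimes> k) + q (h \<otimes> k)) = \<mu> (\<lambda>h. p (h \<otimes> k)) + \<mu> (\<lambda>h. q (h \<otimes> k))"
      by (rule pf_add[OF pf rt[OF p] rt[OF q]])
  next
    fix c p assume p: "p \<in> Cc TH"
    show "\<mu> (\<lambda>h. c * p (h \<otimes> k)) = c * \<mu> (\<lambda>h. p (h \<otimes> k))" by (rule pf_scale[OF pf rt[OF p]])
  next
    fix p assume p: "p \<in> Cc TH" "\<forall>x\<in>topspace TH. 0 \<le> p x"
    show "0 \<le> \<mu> (\<lambda>h. p (h \<otimes> k))" by (rule pf_nonneg[OF pf rt[OF p(1)]]) (use p(2) k H_mult in simp)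
  next
    fix a p assume a: "a \<in> carrier K" and p: "p \<in> Cc TH"
    have aH: "a \<in> H" using a by simp
    have "\<mu> (\<lambda>h. p (a \<otimes> (h \<otimes> k))) = \<mu> (\<lambda>h. p ((a \<otimes> h) \<otimes> k))"
    proof (rule pf_cong[OF pf])
      show "(\<lambda>h. p (a \<otimes> (h \<otimes> k))) \<in> Cc TH" using rt[OF K.Cc_ltrans[OF p a]] by simp
      show "(\<lambda>h. p ((a \<otimes> h) \<otimes> k)) \<in> Cc TH" using K.Cc_ltrans[OF rt[OF p] a] by simp
    qed (use aH k H_carrier in \<open>simp add: m_assoc\<close>)
    also have "\<dots> = \<mu> (\<lambda>h. p (h \<otimes> k))" by (rule Haar_invariant[OF aH rt[OF p]])
    finally show "\<mu> (\<lambda>h. p (a \<otimes>\<^bsub>K\<^esub> (h \<otimes> k))) = \<mu> (\<lambda>h. p (h \<otimes> k))" by simp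
  qed
  from K.left_Haar_unique[OF this Haar _ \<psi>(1)]
  have "\<mu> (\<lambda>h. p (h \<otimes> k)) = (\<mu> (\<lambda>h. \<psi> (h \<otimes> k)) / \<mu> \<psi>) * \<mu> p" if "p \<in> Cc TH" for p
    using that \<psi>(2) by (simp add: field_simps)
  then show ?thesis by blast
qed

definition modular :: "'a \<Rightarrow> real" where
  "modular k = (SOME d. \<forall>p\<in>Cc TH. \<mu> (\<lambda>h. p (h \<otimes> k)) = d * \<mu> p)"

lemma modular: "k \<in> H \<Longrightarrow> p \<in> Cc TH \<Longrightarrow> \<mu> (\<lambda>h. p (h \<otimes> k)) = modular k * \<mu> p"
  using someI_ex[OF right_scaling[of k]] unfolding modular_def by blast

lemma cont_ltrans: "cont F \<Longrightarrow> k \<in> H \<Longrightarrow> cont (\<lambda>h. F (k \<otimes> h))"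
  using K.continuous_map_compose_real[OF K.continuous_map_ltrans[of k], of F] by simp

text \<open>Substituting \<open>h \<otimes> k\<close> for \<open>h\<close> frees \<open>F\<close>
  from the translation, passes it on to \<open>p\<close>, and costs the factor
  \<open>modular k\<close>.\<close>

lemma conv_translate_right:
  assumes p: "p \<in> Cc T" and F: "cont F" and k: "k \<in> H" and g: "g \<in> carrier G"
  shows "conv p (\<lambda>h. F (inv k \<otimes> h)) g = modular k * conv (\<lambda>x. p (x \<otimes> inv k)) F g"
proof -
  have kG: "k \<in> carrier G" using k H_carrier by blast
  define q where "q h = p (g \<otimes> h \<otimes> inv k) * F (inv h)" for h
  have q: "q \<in> Cc TH"
    unfolding q_def[abs_def] using Cc_rtrans[OF p, of "inv k"] kG by (intro conv_Cc F g) auto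
  have "conv p (\<lambda>h. F (inv k \<otimes> h)) g = \<mu> (\<lambda>h. q (h \<otimes> k))"
    unfolding conv_def
  proof (rule pf_cong[OF pf conv_Cc[OF p cont_ltrans[OF F H_inv[OF k]] g]])
    show "(\<lambda>h. q (h \<otimes> k)) \<in> Cc TH" using K.Cc_rtrans[OF q, of k] k by simp
    fix h assume "h \<in> topspace TH"
    then have h: "h \<in> H" "h \<in> carrier G" using H_carrier by auto
    have "g \<otimes> (h \<otimes> k) \<otimes> inv k = g \<otimes> h" using g h kG by (simp add: m_assoc)
    then show "p (g \<otimes> h) * F (inv k \<otimes> inv h) = q (h \<otimes> k)"
      using h kG by (simp add: q_def inv_mult_group)
  qed
  also have "\<dots> = modular k * \<mu> q" by (rule modular[OF k q])
  finally show ?thesis by (simp add: conv_def q_def[abs_def])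
qed

text \<open>If \<open>g \<otimes> a\<close> lies in \<open>L\<close> for some \<open>a\<close> in
  \<open>H\<close>, left invariance of \<open>\<mu>\<close> moves the integration by
  \<open>a\<close>, and the integrand then vanishes off the fixed compact set \<open>D\<close>;
  without such an \<open>a\<close> the integral is zero. Hence \<open>c\<close> does not depend on
  \<open>g\<close>. It also serves all \<open>p\<close> supported in \<open>L\<close> at once, which
  the estimate for differences of translates requires.\<close>

lemma conv_bound:
  assumes L: "compactin T L"
  obtains c where "0 \<le> c" "\<And>p F s B g. p \<in> Cc T \<Longrightarrow> cont F \<Longrightarrow> g \<in> carrier G \<Longrightarrow> 0 \<le> s \<Longrightarrow>
    (\<And>x. x \<in> carrier G \<Longrightarrow> \<bar>p x\<bar> \<le> s) \<Longrightarrow> (\<And>x. x \<in> carrier G \<Longrightarrow> x \<notin> L \<Longrightarrow> p x = 0) \<Longrightarrow>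
    (\<And>x. x \<in> H \<Longrightarrow> \<bar>F x\<bar> \<le> B) \<Longrightarrow> \<bar>conv p F g\<bar> \<le> s * B * c"
proof -
  define D where "D = H \<inter> (\<lambda>(x, y). inv x \<otimes> y) ` (L \<times> L)"
  have "compactin TH D"
    using closed_Int_compactin[OF closed compactin_mult_inv(2)[OF L L]] by (simp add: D_def compactin_subtopology)
  then obtain k where k: "k \<in> Cc TH" "\<And>x. x \<in> topspace TH \<Longrightarrow> 0 \<le> k x" "\<And>x. x \<in> D \<Longrightarrow> k x = (1::real)"
    using bump_compact[OF K.locally_compact K.Hausdorff] by metis
  show thesis
  proof (rule that[of "\<mu> k"])
    show "0 \<le> \<mu> k" using k by (intro pf_nonneg[OF pf])
    fix p F s B g
    assume p: "p \<in> Cc T" and F: "cont F" and g: "g \<in> carrier G" and s: "0 \<le> s"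
      and ps: "\<And>x. x \<in> carrier G \<Longrightarrow> \<bar>p x\<bar> \<le> s" and pL: "\<And>x. x \<in> carrier G \<Longrightarrow> x \<notin> L \<Longrightarrow> p x = 0"
      and FB: "\<And>x. x \<in> H \<Longrightarrow> \<bar>F x\<bar> \<le> B"
    have B: "0 \<le> B" using FB[of \<one>] subgroup.one_closed[OF H] by fastforce
    define q where "q h = p (g \<otimes> h) * F (inv h)" for h
    have q: "q \<in> Cc TH" unfolding q_def[abs_def] by (rule conv_Cc[OF p F g])
    show "\<bar>conv p F g\<bar> \<le> s * B * \<mu> k"
    proof (cases "\<exists>h\<in>H. g \<otimes> h \<in> L")
      case True
      then obtain a where a: "a \<in> H" "g \<otimes> a \<in> L" by blast
      have aG: "a \<in> carrier G" using a H_carrier by blast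
      have qa: "(\<lambda>h. q (a \<otimes> h)) \<in> Cc TH" using K.Cc_ltrans[OF q, of a] a by simp
      have "conv p F g = \<mu> (\<lambda>h. q (a \<otimes> h))"
        unfolding Haar_invariant[OF a(1) q] by (simp add: conv_def q_def[abs_def])
      also have "\<bar>\<dots>\<bar> \<le> \<mu> (\<lambda>h. (s * B) * k h)"
      proof (rule pf_abs_le[OF pf qa Cc_scale[OF k(1)]])
        fix h assume "h \<in> topspace TH"
        then have h: "h \<in> H" "h \<in> carrier G" using H_carrier by auto
        show "\<bar>q (a \<otimes> h)\<bar> \<le> s * B * k h"
        proof (cases "g \<otimes> (a \<otimes> h) \<in> L")
          case True
          have "h = inv (g \<otimes> a) \<otimes> (g \<otimes> (a \<otimes> h))"
            using g aG h by (simp add: inv_solve_left m_assoc)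
          then have "h \<in> D" using True a(2) h unfolding D_def by (auto intro!: image_eqI[of _ _ "(g \<otimes> a, g \<otimes> (a \<otimes> h))"])
          then have "k h = 1" by (rule k(3))
          moreover have "\<bar>q (a \<otimes> h)\<bar> \<le> s * B"
            unfolding q_def abs_mult using ps[of "g \<otimes> (a \<otimes> h)"] FB[of "inv (a \<otimes> h)"] g aG h a s H_mult H_inv
            by (intro mult_mono) auto
          ultimately show ?thesis by simp
        next
          case False
          then have "q (a \<otimes> h) = 0" using pL g aG h by (simp add: q_def)
          then show ?thesis using s B k(2)[of h] h by simp
        qed
      qed
      also have "\<dots> = s * B * \<mu> k" by (rule pf_scale[OF pf k(1)])
      finally show ?thesis .
    next
      case False
      have "conv p F g = \<mu> (\<lambda>h. 0)"
        unfolding conv_def q_def[symmetric]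
      proof (rule pf_cong[OF pf _ Cc_zero])
        show "q \<in> Cc TH" by (rule q)
        show "q h = 0" if "h \<in> topspace TH" for h
          using pL[of "g \<otimes> h"] that False g H_carrier[of h] by (simp add: q_def)
      qed
      then show ?thesis using pf_zero[OF pf] s B \<open>0 \<le> \<mu> k\<close> by simp
    qed
  qed
qed

lemma conv_bounded:
  assumes p: "p \<in> Cc T" and F: "cont F" "\<And>x. x \<in> H \<Longrightarrow> \<bar>F x\<bar> \<le> B"
  shows "\<exists>M. \<forall>g\<in>carrier G. \<bar>conv p F g\<bar> \<le> M"
proof -
  obtain L where L: "compactin T L" "\<And>x. x \<in> topspace T \<Longrightarrow> x \<notin> L \<Longrightarrow> p x = 0" using CcE[OF p] by metis
  obtain s where s: "s > 0" "\<And>x. x \<in> topspace T \<Longrightarrow> \<bar>p x\<bar> \<le> s" using Cc_bounded[OF p] by metis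
  obtain c where c: "0 \<le> c" "\<And>p F s B g. p \<in> Cc T \<Longrightarrow> cont F \<Longrightarrow> g \<in> carrier G \<Longrightarrow> 0 \<le> s \<Longrightarrow>
    (\<And>x. x \<in> carrier G \<Longrightarrow> \<bar>p x\<bar> \<le> s) \<Longrightarrow> (\<And>x. x \<in> carrier G \<Longrightarrow> x \<notin> L \<Longrightarrow> p x = 0) \<Longrightarrow>
    (\<And>x. x \<in> H \<Longrightarrow> \<bar>F x\<bar> \<le> B) \<Longrightarrow> \<bar>conv p F g\<bar> \<le> s * B * c"
    by (rule conv_bound[OF L(1)]) blast
  have "\<bar>conv p F g\<bar> \<le> s * B * c" if "g \<in> carrier G" for g
    by (rule c(2)[OF p F(1) that]) (use s L(2) F(2) in \<open>simp_all add: topspace_eq\<close>)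
  then show ?thesis by blast
qed

text \<open>The increment of the convolution is the convolution of
  \<open>p (a \<otimes> x) - p x\<close> with \<open>F\<close>. This function of \<open>x\<close> is
  uniformly small for \<open>a\<close> near the identity and supported in a compact set independent
  of \<open>a\<close>, so \<open>conv_bound\<close> applies.\<close>

lemma conv_right_uc:
  assumes p: "p \<in> Cc T" and F: "cont F" "\<And>x. x \<in> H \<Longrightarrow> \<bar>F x\<bar> \<le> B"
  shows "right_uc (conv p F)"
proof (rule right_ucI)
  fix e :: real assume e: "0 < e"
  obtain L where L: "compactin T L" "\<And>x. x \<in> topspace T \<Longrightarrow> x \<notin> L \<Longrightarrow> p x = 0" using CcE[OF p] by metis
  obtain W M where WM: "openin T W" "\<one> \<in> W" "compactin T M" "W \<subseteq> M" by (rule compact_nhd_one)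
  \<comment> \<open>Contains the support of \<open>p\<close> and those of all
    \<open>p (a \<otimes> x)\<close> with \<open>a\<close> in \<open>W\<close>.\<close>
  define N where "N = L \<union> (\<lambda>(x, y). inv x \<otimes> y) ` (M \<times> L)"
  have N: "compactin T N" unfolding N_def using L(1) compactin_mult_inv(2)[OF WM(3) L(1)] by (rule compactin_Un)
  obtain c where c: "0 \<le> c" "\<And>p F s B g. p \<in> Cc T \<Longrightarrow> cont F \<Longrightarrow> g \<in> carrier G \<Longrightarrow> 0 \<le> s \<Longrightarrow>
    (\<And>x. x \<in> carrier G \<Longrightarrow> \<bar>p x\<bar> \<le> s) \<Longrightarrow> (\<And>x. x \<in> carrier G \<Longrightarrow> x \<notin> N \<Longrightarrow> p x = 0) \<Longrightarrow>
    (\<And>x. x \<in> H \<Longrightarrow> \<bar>F x\<bar> \<le> B) \<Longrightarrow> \<bar>conv p F g\<bar> \<le> s * B * c"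
    by (rule conv_bound[OF N]) blast
  have B: "0 \<le> B" using F(2)[of \<one>] subgroup.one_closed[OF H] by fastforce
  define d where "d = e / (B * c + 1)"
  have Bc: "0 \<le> B * c" using B c(1) by simp
  have d: "0 < d" "d * (B * c) < e" using e Bc by (auto simp: d_def field_simps)
  obtain U where U: "openin T U" "\<one> \<in> U" "\<forall>u\<in>U. \<forall>x\<in>carrier G. \<bar>p (u \<otimes> x) - p x\<bar> \<le> d"
    using uniform_translate_near_one(1)[OF p d(1)] by blast
  show "\<exists>U. openin T U \<and> \<one> \<in> U \<and> (\<forall>a\<in>U. \<forall>g\<in>carrier G. \<bar>conv p F (a \<otimes> g) - conv p F g\<bar> < e)"
  proof (intro exI[of _ "U \<inter> W"] conjI ballI)
    fix a g assume a: "a \<in> U \<inter> W" and g: "g \<in> carrier G"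
    have aG: "a \<in> carrier G" using a WM(1) openin_subset by (fastforce simp: topspace_eq)
    have pa: "(\<lambda>x. p (a \<otimes> x)) \<in> Cc T" by (rule Cc_ltrans[OF p aG])
    have "\<bar>conv (\<lambda>x. p (a \<otimes> x) - p x) F g\<bar> \<le> d * B * c"
    proof (rule c(2)[OF Cc_diff[OF pa p] F(1) g])
      fix x assume x: "x \<in> carrier G" "x \<notin> N"
      have "a \<otimes> x \<notin> L"
      proof
        assume "a \<otimes> x \<in> L"
        moreover have "x = inv a \<otimes> (a \<otimes> x)" using aG x by (simp add: m_assoc[symmetric])
        ultimately have "x \<in> N" using a WM(4) unfolding N_def by (auto intro!: image_eqI[of _ _ "(a, a \<otimes> x)"])
        then show False using x(2) by simp
      qed
      then show "p (a \<otimes> x) - p x = 0" using L(2) x aG by (simp add: topspace_eq N_def)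
    qed (use d U(3) a F(2) in auto)
    then have "\<bar>conv (\<lambda>x. p (a \<otimes> x)) F g - conv p F g\<bar> \<le> d * (B * c)"
      by (simp add: conv_diff_left[OF pa p F(1) g] mult.assoc)
    then show "\<bar>conv p F (a \<otimes> g) - conv p F g\<bar> < e"
      using d(2) by (simp add: conv_ltrans[OF p F(1) aG g])
  qed (use U WM in auto)
qed

end

section \<open>Domination and invariance of convolutions\<close>

locale subgroup_dominated = subgroup_Haar G T H \<mu> \<psi> +
    K: translate_dominated "G\<lparr>carrier := H\<rparr>" "subtopology T H" f t0
  for G :: "('a, 'b) monoid_scheme" (structure) and T :: "'a topology" and H :: "'a set"
    and \<mu> :: "('a \<Rightarrow> real) \<Rightarrow> real" and \<psi> :: "'a \<Rightarrow> real"
    and f :: "'a \<Rightarrow> real" and t0 :: 'a +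
  fixes p0 :: "'a \<Rightarrow> real"
  assumes p0: "p0 \<in> Cc T" "\<And>x. x \<in> carrier G \<Longrightarrow> 0 \<le> p0 x" "0 < p0 \<one>"
begin

lemma dominated_cont: "F \<in> K.V \<Longrightarrow> cont F"
  by (rule K.right_uc_continuous) (auto simp: K.dominated_def)

lemma dominated_bounded: assumes "F \<in> K.V" obtains B where "\<And>x. x \<in> H \<Longrightarrow> \<bar>F x\<bar> \<le> B"
  using assms by (auto simp: K.dominated_def)

lemma f_nonneg: "x \<in> H \<Longrightarrow> 0 \<le> f x"
  using K.f_nonneg[of x] by simp

lemma f_cont: "cont f"
  by (rule dominated_cont[OF K.f_V])

lemma translate_dominated_conv: "translate_dominated G T (conv p0 f) t0"
proof (unfold_locales)
  obtain B where B: "\<And>x. x \<in> H \<Longrightarrow> \<bar>f x\<bar> \<le> B" using dominated_bounded[OF K.f_V] by metis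
  show "right_uc (conv p0 f)" using p0(1) f_cont B by (rule conv_right_uc)
  show "\<exists>B. \<forall>x\<in>carrier G. \<bar>conv p0 f x\<bar> \<le> B" using p0(1) f_cont B by (rule conv_bounded)
  show "0 \<le> conv p0 f x" if "x \<in> carrier G" for x
    using p0(1) f_cont that p0(2) by (rule conv_nonneg) (auto intro: f_nonneg)
  have t0: "t0 \<in> H" "t0 \<in> carrier G" using K.t0(1) H_carrier by auto
  then show "t0 \<in> carrier G" by simp
  \<comment> \<open>At \<open>h = inv t0\<close> the integrand is \<open>p0 \<one> * f t0\<close>,
    and a non-zero Haar functional is strictly positive on a nonnegative function that is positive
    somewhere.\<close>
  show "0 < conv p0 f t0"
    unfolding conv_def
  proof (rule K.left_Haar_faithful[OF Haar \<psi> conv_Cc[OF p0(1) f_cont t0(2)]])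
    show "inv t0 \<in> carrier K" using H_inv[OF t0(1)] by simp
    show "0 < p0 (t0 \<otimes> inv t0) * f (inv (inv t0))" using p0(3) K.t0(2) t0 by simp
    show "0 \<le> p0 (t0 \<otimes> x) * f (inv x)" if "x \<in> carrier K" for x
      using that p0(2)[of "t0 \<otimes> x"] K.f_nonneg[of "inv x"] t0 H_carrier H_inv by simp
  qed
qed

sublocale D: translate_dominated G T "conv p0 f" t0
  by (rule translate_dominated_conv)

text \<open>A nonnegative \<open>p\<close> lies below finitely many left translates of
  \<open>p0\<close>, and convolution commutes with left translations of \<open>G\<close>.\<close>

lemma conv_f_dominated:
  assumes p: "p \<in> Cc T" "\<And>x. x \<in> carrier G \<Longrightarrow> 0 \<le> p x"
  shows "conv p f \<in> D.V"
proof -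
  obtain B where B: "\<And>x. x \<in> H \<Longrightarrow> \<bar>f x\<bar> \<le> B" using dominated_bounded[OF K.f_V] by metis
  obtain ss where ss: "set ss \<subseteq> carrier G" "\<And>x. x \<in> carrier G \<Longrightarrow> p x \<le> (\<Sum>s\<leftarrow>ss. p0 (s \<otimes> x))"
    using finite_translates_cover[OF p(1) Cc_continuous[OF p0(1)] p0(2) one_closed p0(3)] by metis
  have sum: "(\<lambda>x. \<Sum>s\<leftarrow>ss. p0 (s \<otimes> x)) \<in> Cc T \<and> (\<lambda>g. \<Sum>s\<leftarrow>ss. conv p0 f (s \<otimes> g)) \<in> D.V \<and>
     (\<forall>g\<in>carrier G. conv (\<lambda>x. \<Sum>s\<leftarrow>ss. p0 (s \<otimes> x)) f g = (\<Sum>s\<leftarrow>ss. conv p0 f (s \<otimes> g)))"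
    using ss(1)
  proof (induction ss)
    case Nil
    have "conv (\<lambda>x. 0) f g = 0" for g using pf_zero[OF pf] by (simp add: conv_def)
    then show ?case by (simp add: Cc_zero D.V_zero)
  next
    case (Cons s ss)
    then show ?case
      using conv_add_left[OF Cc_ltrans[OF p0(1), of s] _ f_cont, of "\<lambda>x. \<Sum>s\<leftarrow>ss. p0 (s \<otimes> x)"]
      by (simp add: Cc_add Cc_ltrans p0(1) D.V_add D.V_ltrans D.f_V conv_ltrans f_cont)
  qed
  show ?thesis
  proof (rule D.V_solid)
    show "right_uc (conv p f)" using p(1) f_cont B by (rule conv_right_uc)
    show "(\<lambda>g. \<Sum>s\<leftarrow>ss. conv p0 f (s \<otimes> g)) \<in> D.V" using sum by blast
    fix g assume g: "g \<in> carrier G"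
    have "0 \<le> conv p f g"
      using p(1) f_cont g p(2) by (rule conv_nonneg) (auto intro: f_nonneg)
    moreover have "conv p f g \<le> conv (\<lambda>x. \<Sum>s\<leftarrow>ss. p0 (s \<otimes> x)) f g"
    proof (rule conv_mono[OF p(1) f_cont conjunct1[OF sum] f_cont g])
      fix h assume h: "h \<in> H"
      show "p (g \<otimes> h) * f (inv h) \<le> (\<Sum>s\<leftarrow>ss. p0 (s \<otimes> (g \<otimes> h))) * f (inv h)"
        using ss(2)[of "g \<otimes> h"] g h H_carrier K.f_nonneg[of "inv h"] H_inv by (intro mult_right_mono) auto
    qed
    ultimately show "\<bar>conv p f g\<bar> \<le> (\<Sum>s\<leftarrow>ss. conv p0 f (s \<otimes> g))" using sum g by simp
  qed
qed

text \<open>Majorising \<open>F\<close> by translates of \<open>f\<close> leads to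
  \<open>modular k\<close> times the convolution of a right translate of
  \<open>\<bar>p\<bar>\<close> with \<open>f\<close>. These right translates are covered because
  \<open>conv_f_dominated\<close> admits every nonnegative \<open>p\<close>.\<close>

lemma conv_dominated:
  assumes p: "p \<in> Cc T" and F: "F \<in> K.V"
  shows "conv p F \<in> D.V"
proof -
  obtain B where B: "\<And>x. x \<in> H \<Longrightarrow> \<bar>F x\<bar> \<le> B" using dominated_bounded[OF F] by metis
  obtain C ks where ks: "set ks \<subseteq> carrier K" "\<And>x. x \<in> carrier K \<Longrightarrow> \<bar>F x\<bar> \<le> K.maj ks x"
    using F by (rule K.V_E) blast
  define q where "q x = \<bar>p x\<bar>" for x
  have q: "q \<in> Cc T" "\<And>x. 0 \<le> q x" unfolding q_def[abs_def] using Cc_abs[OF p] by auto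
  have qk: "(\<lambda>x. q (x \<otimes> inv k)) \<in> Cc T" if "k \<in> H" for k
    using Cc_rtrans[OF q(1), of "inv k"] that H_carrier by simp
  define u where "u g = (\<Sum>k\<leftarrow>ks. modular k * conv (\<lambda>x. q (x \<otimes> inv k)) f g)" for g
  have sum: "u \<in> D.V \<and> (\<forall>g\<in>carrier G. conv q (K.maj ks) g = u g)"
    unfolding u_def[abs_def] using ks(1)
  proof (induction ks)
    case Nil
    have "conv q (K.maj []) g = 0" for g using pf_zero[OF pf] by (simp add: conv_def K.maj_def)
    then show ?case by (simp add: D.V_zero)
  next
    case (Cons k ks)
    then have k: "k \<in> H" and ks: "set ks \<subseteq> carrier K" by auto
    have "K.maj (k # ks) = (\<lambda>h. f (inv k \<otimes> h) + K.maj ks h)" using k by (simp add: K.maj_def fun_eq_iff)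
    then have "conv q (K.maj (k # ks)) g = modular k * conv (\<lambda>x. q (x \<otimes> inv k)) f g + conv q (K.maj ks) g"
      if g: "g \<in> carrier G" for g
      using conv_add_right[OF q(1) cont_ltrans[OF f_cont H_inv[OF k]] dominated_cont[OF K.maj_V[OF ks]] g]
        conv_translate_right[OF q(1) f_cont k g] by simp
    then show ?case
      using Cons.IH[OF ks] D.V_add[OF D.V_scale[OF conv_f_dominated[OF qk[OF k]]]] q(2) by simp
  qed
  show ?thesis
  proof (rule D.V_solid)
    show "right_uc (conv p F)" using p dominated_cont[OF F] B by (rule conv_right_uc)
    show "u \<in> D.V" using sum by blast
    fix g assume g: "g \<in> carrier G"
    have "\<bar>conv p F g\<bar> \<le> conv q (K.maj ks) g"
    proof (rule conv_abs_le[OF p dominated_cont[OF F] q(1) dominated_cont[OF K.maj_V[OF ks(1)]] g])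
      fix h assume h: "h \<in> H"
      show "\<bar>p (g \<otimes> h) * F (inv h)\<bar> \<le> q (g \<otimes> h) * K.maj ks (inv h)"
        unfolding abs_mult q_def using ks(2)[of "inv h"] H_inv[OF h] by (intro mult_left_mono) auto
    qed
    then show "\<bar>conv p F g\<bar> \<le> u g" using sum g by simp
  qed
qed

text \<open>Convolution commutes with left translations, so the invariance of \<open>M\<close>
  passes to \<open>p\<close>; nonnegativity of \<open>F\<close> gives positivity. The resulting
  functional may be zero.\<close>

lemma functional_left_Haar:
  assumes M: "M \<in> D.C" "\<And>g v. g \<in> carrier G \<Longrightarrow> v \<in> D.V \<Longrightarrow> M (\<lambda>y. v (g \<otimes> y)) = M v"
    and F: "F \<in> K.V" "\<And>x. x \<in> H \<Longrightarrow> 0 \<le> F x"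
  shows "left_Haar (\<lambda>p. M (conv p F))"
proof -
  have MA: "M \<in> D.A" using M(1) D.C_A by blast
  note FC = dominated_cont[OF F(1)]
  show ?thesis
    unfolding left_Haar_def positive_functional_def
  proof (intro conjI ballI allI impI)
    fix p q assume p: "p \<in> Cc T" and q: "q \<in> Cc T"
    have "M (conv (\<lambda>x. p x + q x) F) = M (\<lambda>g. conv p F g + conv q F g)"
      by (rule D.A_cong[OF MA conv_dominated[OF Cc_add[OF p q] F(1)]
            D.V_add[OF conv_dominated[OF p F(1)] conv_dominated[OF q F(1)]]])
        (rule conv_add_left[OF p q FC])
    also have "\<dots> = M (conv p F) + M (conv q F)"
      by (rule D.A_add[OF MA conv_dominated[OF p F(1)] conv_dominated[OF q F(1)]])
    finally show "M (conv (\<lambda>x. p x + q x) F) = M (conv p F) + M (conv q F)" .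
  next
    fix c p assume p: "p \<in> Cc T"
    have "M (conv (\<lambda>x. c * p x) F) = M (\<lambda>g. c * conv p F g)"
      by (rule D.A_cong[OF MA conv_dominated[OF Cc_scale[OF p] F(1)] D.V_scale[OF conv_dominated[OF p F(1)]]])
        (rule conv_scale_left[OF p FC])
    also have "\<dots> = c * M (conv p F)" by (rule D.A_scale[OF MA conv_dominated[OF p F(1)]])
    finally show "M (conv (\<lambda>x. c * p x) F) = c * M (conv p F)" .
  next
    fix p assume p: "p \<in> Cc T" "\<forall>x\<in>topspace T. 0 \<le> p x"
    show "0 \<le> M (conv p F)"
    proof (rule D.C_nonneg[OF M(1) conv_dominated[OF p(1) F(1)]])
      show "0 \<le> conv p F g" if "g \<in> carrier G" for g
        using p(1) FC that by (rule conv_nonneg) (use p(2) F(2) in \<open>auto simp: topspace_eq\<close>)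
    qed
  next
    fix a p assume a: "a \<in> carrier G" and p: "p \<in> Cc T"
    have "M (conv (\<lambda>x. p (a \<otimes> x)) F) = M (\<lambda>g. conv p F (a \<otimes> g))"
      by (rule D.A_cong[OF MA conv_dominated[OF Cc_ltrans[OF p a] F(1)] D.V_ltrans[OF conv_dominated[OF p F(1)] a]])
        (rule conv_ltrans[OF p FC a, symmetric])
    also have "\<dots> = M (conv p F)" by (rule M(2)[OF a conv_dominated[OF p F(1)]])
    finally show "M (conv (\<lambda>x. p (a \<otimes> x)) F) = M (conv p F)" .
  qed
qed

lemma functional_translate_right:
  assumes M: "M \<in> D.C" and p: "p \<in> Cc T" and F: "F \<in> K.V" and k: "k \<in> H"
  shows "M (conv p (\<lambda>h. F (inv k \<otimes> h))) = modular k * M (conv (\<lambda>x. p (x \<otimes> inv k)) F)"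
proof -
  have MA: "M \<in> D.A" using M D.C_A by blast
  have FV: "(\<lambda>h. F (inv k \<otimes> h)) \<in> K.V" using K.V_ltrans[OF F, of "inv k"] H_inv[OF k] by simp
  have pk: "(\<lambda>x. p (x \<otimes> inv k)) \<in> Cc T" using Cc_rtrans[OF p, of "inv k"] k H_carrier by simp
  have "M (conv p (\<lambda>h. F (inv k \<otimes> h))) = M (\<lambda>g. modular k * conv (\<lambda>x. p (x \<otimes> inv k)) F g)"
    by (rule D.A_cong[OF MA conv_dominated[OF p FV] D.V_scale[OF conv_dominated[OF pk F]]])
      (rule conv_translate_right[OF p dominated_cont[OF F] k])
  also have "\<dots> = modular k * M (conv (\<lambda>x. p (x \<otimes> inv k)) F)"
    by (rule D.A_scale[OF MA conv_dominated[OF pk F]])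
  finally show ?thesis .
qed

lemma functional_add:
  assumes M: "M \<in> D.C" and p: "p \<in> Cc T" and F: "F \<in> K.V" "F' \<in> K.V"
  shows "M (conv p (\<lambda>h. F h + F' h)) = M (conv p F) + M (conv p F')"
proof -
  have MA: "M \<in> D.A" using M D.C_A by blast
  have "M (conv p (\<lambda>h. F h + F' h)) = M (\<lambda>g. conv p F g + conv p F' g)"
    by (rule D.A_cong[OF MA conv_dominated[OF p K.V_add[OF F]] D.V_add[OF conv_dominated[OF p F(1)] conv_dominated[OF p F(2)]]])
      (rule conv_add_right[OF p dominated_cont[OF F(1)] dominated_cont[OF F(2)]])
  also have "\<dots> = M (conv p F) + M (conv p F')"
    by (rule D.A_add[OF MA conv_dominated[OF p F(1)] conv_dominated[OF p F(2)]])
  finally show ?thesis .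
qed

text \<open>\<open>M\<close> is a limit of positive combinations of values of
  \<open>conv p0 F\<close> at points of \<open>G\<close>, and each such value is an integral over
  \<open>H\<close>, hence a limit of Riemann sums in values of \<open>F\<close>. The two
  approximations are composed, with the same weights for all \<open>F\<close> in
  \<open>Q\<close>.\<close>

lemma functional_approx:
  assumes M: "M \<in> D.C" and Q: "finite Q" "Q \<subseteq> K.V" and e: "0 < e"
  shows "\<exists>rs\<in>K.weights. \<forall>F\<in>Q. \<bar>M (conv p0 F) - K.comb rs F\<bar> < e"
proof -
  have Riemann: "\<exists>rs\<in>K.weights. \<forall>F\<in>Q. \<bar>conv p0 F g - K.comb rs F\<bar> < d" if g: "g \<in> carrier G" and d: "0 < d" for g d
  proof -
    have p: "(\<lambda>h. p0 (g \<otimes> h)) \<in> Cc TH" by (rule Cc_restrict[OF Cc_ltrans[OF p0(1) g]])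
    have p1: "0 \<le> p0 (g \<otimes> h)" if "h \<in> topspace TH" for h using that p0(2) g H_carrier by simp
    define Q' where "Q' = (\<lambda>F h. F (inv h)) ` Q"
    have Q': "finite Q'" "\<And>F. F \<in> Q \<Longrightarrow> (\<lambda>h. F (inv h)) \<in> Q'" using Q(1) by (auto simp: Q'_def)
    have qc: "cont q" if "q \<in> Q'" for q
      using that Q(2) dominated_cont cont_inv unfolding Q'_def by blast
    obtain I w where I: "finite I" "I \<subseteq> topspace TH" "\<And>i. i \<in> I \<Longrightarrow> 0 \<le> w i"
      "\<And>q. q \<in> Q' \<Longrightarrow> \<bar>\<mu> (\<lambda>h. p0 (g \<otimes> h) * q h) - (\<Sum>i\<in>I. w i * q i)\<bar> < d"
      by (rule positive_functional_approx[OF K.locally_compact K.Hausdorff pf p p1 Q'(1) qc d]) blast+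
    obtain xs where xs: "set xs = I" "distinct xs" using finite_distinct_list[OF I(1)] by blast
    \<comment> \<open>The integrand contains \<open>F (inv h)\<close>, so the node \<open>i\<close>
      contributes an evaluation at \<open>inv i\<close>.\<close>
    define rs where "rs = map (\<lambda>i. (w i, inv i)) xs"
    have "\<bar>conv p0 F g - K.comb rs F\<bar> < d" if "F \<in> Q" for F
    proof -
      have "K.comb rs F = (\<Sum>i\<in>I. w i * F (inv i))"
        using sum.distinct_set_conv_list[OF xs(2), of "\<lambda>i. w i * F (inv i)"] xs(1)
        by (simp add: K.comb_def rs_def o_def)
      then show ?thesis using I(4)[OF Q'(2)[OF that]] by (simp add: conv_def)
    qed
    moreover have "rs \<in> K.weights" using I(2,3) xs(1) H_inv by (auto simp: rs_def K.weights_def)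
    ultimately show ?thesis by blast
  qed
  have disc: "\<exists>rs\<in>K.weights. \<forall>F\<in>Q. \<bar>D.comb ps (conv p0 F) - K.comb rs F\<bar> < d" if "ps \<in> D.weights" "0 < d" for ps d
    using that
  proof (induction ps arbitrary: d)
    case Nil
    then show ?case by (intro bexI[of _ "[]"]) (auto simp: D.comb_def K.comb_def K.weights_def)
  next
    case (Cons u ps)
    obtain a g where u: "u = (a, g)" by (cases u)
    have a: "0 \<le> a" "g \<in> carrier G" and ps: "ps \<in> D.weights" using Cons.prems(1) by (auto simp: D.weights_def u)
    obtain rs where rs: "rs \<in> K.weights" "\<And>F. F \<in> Q \<Longrightarrow> \<bar>D.comb ps (conv p0 F) - K.comb rs F\<bar> < d / 2"
      using Cons.IH[OF ps, of "d / 2"] Cons.prems(2) by auto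
    \<comment> \<open>Half of \<open>d\<close> goes to the tail by induction, the other half to this
      term, whose weight \<open>a\<close> scales the error; \<open>a + 1\<close> avoids division by
      zero.\<close>
    define c where "c = d / (2 * (a + 1))"
    have c: "0 < c" "a * c < d / 2" using Cons.prems(2) a by (auto simp: c_def field_simps)
    obtain ss where ss: "ss \<in> K.weights" "\<And>F. F \<in> Q \<Longrightarrow> \<bar>conv p0 F g - K.comb ss F\<bar> < c"
      using Riemann[OF a(2) c(1)] by blast
    define ts where "ts = map (\<lambda>q. (a * fst q, snd q)) ss @ rs"
    have ts: "K.comb ts F = a * K.comb ss F + K.comb rs F" for F
      by (simp add: ts_def K.comb_def o_def sum_list_const_mult mult.assoc)
    have "\<bar>D.comb (u # ps) (conv p0 F) - K.comb ts F\<bar> < d" if F: "F \<in> Q" for F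
    proof -
      have "D.comb (u # ps) (conv p0 F) - K.comb ts F
          = a * (conv p0 F g - K.comb ss F) + (D.comb ps (conv p0 F) - K.comb rs F)"
        unfolding ts by (simp add: D.comb_def u algebra_simps)
      moreover have "\<bar>a * (conv p0 F g - K.comb ss F)\<bar> \<le> a * c"
        unfolding abs_mult using ss(2)[OF F] a(1) by (simp add: mult_left_mono)
      ultimately show ?thesis using rs(2)[OF F] c(2) by linarith
    qed
    moreover have "ts \<in> K.weights" using ss(1) rs(1) a(1) by (auto simp: ts_def K.weights_def)
    ultimately show ?case by blast
  qed
  have "(\<lambda>F. conv p0 F) ` Q \<subseteq> D.V" using conv_dominated[OF p0(1)] Q(2) by blast
  then obtain ps where ps: "ps \<in> D.weights" "\<And>F. F \<in> Q \<Longrightarrow> \<bar>M (conv p0 F) - D.comb ps (conv p0 F)\<bar> < e / 2"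
    using D.C_approx[OF M, of "(\<lambda>F. conv p0 F) ` Q" "e / 2"] Q(1) e by auto
  obtain rs where rs: "rs \<in> K.weights" "\<And>F. F \<in> Q \<Longrightarrow> \<bar>D.comb ps (conv p0 F) - K.comb rs F\<bar> < e / 2"
    using disc[OF ps(1), of "e / 2"] e by auto
  show ?thesis
  proof (intro bexI[OF _ rs(1)] ballI)
    fix F assume "F \<in> Q"
    from ps(2)[OF this] rs(2)[OF this] show "\<bar>M (conv p0 F) - K.comb rs F\<bar> < e" by linarith
  qed
qed

end

text \<open>The functional is \<open>\<Lambda> F = M (conv p0 F)\<close>. One bump \<open>p0\<close>
  and one Haar functional \<open>\<mu>\<close> are shared by the space for \<open>f\<close> and the
  space for the constant 1, so that both carry the same modular factor.\<close>

theorem (in closed_subgroup) subgroup_invariant_functional: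
  assumes FPC: "fixed_point_property_for_cones TYPE(('a \<Rightarrow> real) \<Rightarrow> real) G T"
    and f: "translate_dominated K TH f t0"
  obtains \<Lambda> where "0 < \<Lambda> f"
    "\<And>k F. k \<in> H \<Longrightarrow> F \<in> K.dominated f \<Longrightarrow> \<Lambda> (\<lambda>h. F (k \<otimes> h)) = \<Lambda> F"
    "\<And>F F'. F \<in> K.dominated f \<Longrightarrow> F' \<in> K.dominated f \<Longrightarrow> (\<And>h. h \<in> H \<Longrightarrow> F h = F' h) \<Longrightarrow> \<Lambda> F = \<Lambda> F'"
    "\<And>Q e. finite Q \<Longrightarrow> Q \<subseteq> K.dominated f \<Longrightarrow> 0 < e \<Longrightarrow>
       \<exists>rs. (\<forall>r\<in>set rs. 0 \<le> fst r \<and> snd r \<in> H) \<and> (\<forall>F\<in>Q. \<bar>\<Lambda> F - (\<Sum>r\<leftarrow>rs. fst r * F (snd r))\<bar> < e)"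
proof -
  obtain \<mu> \<psi> where Haar: "K.left_Haar \<mu>" "\<psi> \<in> Cc TH" "\<mu> \<psi> \<noteq> 0" using K.left_Haar_exists by blast
  have 1: "compactin T {\<one>}" by (simp add: topspace_eq)
  obtain p0 where p0: "p0 \<in> Cc T" "\<And>x. x \<in> topspace T \<Longrightarrow> 0 \<le> p0 x" "\<And>x. x \<in> {\<one>} \<Longrightarrow> p0 x = (1::real)"
    by (rule bump_compact[OF locally_compact Hausdorff 1]) blast
  have p0': "\<And>x. x \<in> carrier G \<Longrightarrow> 0 \<le> p0 x" "0 < p0 \<one>" using p0(2,3) by (auto simp: topspace_eq)
  interpret F: translate_dominated K TH f t0 by (rule f)
  interpret S: subgroup_dominated G T H \<mu> \<psi> f t0 p0
    by unfold_locales (use Haar p0(1) p0' in auto)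
  interpret One: translate_dominated K TH "\<lambda>_. 1" "\<one>"
  proof unfold_locales
    show "K.right_uc (\<lambda>_. 1)"
      by (rule K.right_ucI) (use K.one_closed in \<open>auto simp: intro!: exI[of _ "topspace TH"]\<close>)
    show "\<one> \<in> carrier K" using subgroup.one_closed[OF H] by simp
  qed auto
  interpret U: subgroup_dominated G T H \<mu> \<psi> "\<lambda>_. 1" \<one> p0
    by unfold_locales (use Haar p0(1) p0' in auto)
  obtain N where N: "N \<in> U.D.C" "0 < N (S.conv p0 (\<lambda>_. 1))"
      "\<And>g v. g \<in> carrier G \<Longrightarrow> v \<in> U.D.V \<Longrightarrow> N (\<lambda>y. v (g \<otimes> y)) = N v"
    using U.D.invariant_functional[OF FPC] by blast
  obtain M where M: "M \<in> S.D.C" "0 < M (S.conv p0 f)"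
      "\<And>g v. g \<in> carrier G \<Longrightarrow> v \<in> S.D.V \<Longrightarrow> M (\<lambda>y. v (g \<otimes> y)) = M v"
    using S.D.invariant_functional[OF FPC] by blast
  define n where "n p = N (S.conv p (\<lambda>_. 1))" for p
  have n: "left_Haar n"
    unfolding n_def[abs_def] by (rule U.functional_left_Haar[OF N(1,3) One.f_V]) auto
  define r where "r k x = p0 (x \<otimes> inv k)" for k x
  have rC: "r k \<in> Cc T" if "k \<in> H" for k
    unfolding r_def[abs_def] using Cc_rtrans[OF p0(1), of "inv k"] that H_carrier by simp
  have nr: "n p0 = S.modular k * n (r k)" if "k \<in> H" for k
    unfolding n_def r_def[abs_def] using U.functional_translate_right[OF N(1) p0(1) One.f_V that] .
  \<comment> \<open>Multiplying by \<open>n p0 > 0\<close> allows uniqueness to exchange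
    \<open>r k\<close> and \<open>p0\<close> between the two Haar functionals; then
    \<open>modular k * n (r k)\<close> is \<open>n p0\<close> again and cancels.\<close>
  have pos: "M (S.conv p0 (\<lambda>h. F (inv k \<otimes> h))) = M (S.conv p0 F)"
    if k: "k \<in> H" and F: "F \<in> F.V" "\<And>x. x \<in> H \<Longrightarrow> 0 \<le> F x" for k F
  proof -
    have J: "left_Haar (\<lambda>p. M (S.conv p F))" by (rule S.functional_left_Haar[OF M(1,3) F])
    have "M (S.conv p0 (\<lambda>h. F (inv k \<otimes> h))) * n p0 = S.modular k * (M (S.conv (r k) F) * n p0)"
      using S.functional_translate_right[OF M(1) p0(1) F(1) k] by (simp add: r_def[abs_def])
    also have "M (S.conv (r k) F) * n p0 = n (r k) * M (S.conv p0 F)"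
      by (rule left_Haar_unique[OF J n rC[OF k] p0(1)])
    also have "S.modular k * (n (r k) * M (S.conv p0 F)) = M (S.conv p0 F) * n p0"
      using nr[OF k] by simp
    finally show ?thesis using N(2) by (simp add: n_def)
  qed
  \<comment> \<open>The Haar argument covers nonnegative \<open>F\<close>; a general
    \<open>F\<close> is the difference of \<open>F + F.maj ks\<close> and \<open>F.maj ks\<close>,
    both nonnegative on \<open>H\<close>.\<close>
  have inv: "M (S.conv p0 (\<lambda>h. F (inv k \<otimes> h))) = M (S.conv p0 F)" if k: "k \<in> H" and F: "F \<in> F.V" for k F
  proof -
    obtain B ks where ks: "set ks \<subseteq> carrier K" "\<And>x. x \<in> carrier K \<Longrightarrow> \<bar>F x\<bar> \<le> F.maj ks x"
      using F by (rule F.V_E) blast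
    have ik: "inv k \<in> carrier K" using H_inv[OF k] by simp
    have mV: "F.maj ks \<in> F.V" by (rule F.maj_V[OF ks(1)])
    have m0: "0 \<le> F.maj ks x" if "x \<in> H" for x using F.maj_nonneg[OF ks(1), of x] that by simp
    have F0: "0 \<le> F x + F.maj ks x" if "x \<in> H" for x using ks(2)[of x] that by simp
    have kV: "(\<lambda>h. F (inv k \<otimes> h)) \<in> F.V" "(\<lambda>h. F.maj ks (inv k \<otimes> h)) \<in> F.V"
      using F.V_ltrans[OF F ik] F.V_ltrans[OF mV ik] by simp_all
    have "M (S.conv p0 (\<lambda>h. F (inv k \<otimes> h) + F.maj ks (inv k \<otimes> h))) = M (S.conv p0 (\<lambda>h. F h + F.maj ks h))"
      using pos[OF k F.V_add[OF F mV] F0] by simp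
    moreover have "M (S.conv p0 (\<lambda>h. F.maj ks (inv k \<otimes> h))) = M (S.conv p0 (F.maj ks))"
      by (rule pos[OF k mV m0])
    ultimately show ?thesis
      using S.functional_add[OF M(1) p0(1) kV] S.functional_add[OF M(1) p0(1) F mV] by simp
  qed
  show thesis
  proof (rule that[of "\<lambda>F. M (S.conv p0 F)"])
    show "0 < M (S.conv p0 f)" by (rule M(2))
    show "M (S.conv p0 (\<lambda>h. F (k \<otimes> h))) = M (S.conv p0 F)" if "k \<in> H" "F \<in> K.dominated f" for k F
      using inv[OF H_inv[OF that(1)] that(2)] H_carrier[OF that(1)] by simp
    show "M (S.conv p0 F) = M (S.conv p0 F')"
      if F: "F \<in> K.dominated f" "F' \<in> K.dominated f" "\<And>h. h \<in> H \<Longrightarrow> F h = F' h" for F F'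
    proof -
      have "M \<in> S.D.A" using M(1) S.D.C_A by blast
      then show ?thesis
        by (rule S.D.A_cong[OF _ S.conv_dominated[OF p0(1) F(1)] S.conv_dominated[OF p0(1) F(2)]])
          (rule S.conv_cong[OF p0(1) S.dominated_cont[OF F(1)] p0(1) S.dominated_cont[OF F(2)] _ refl F(3)])
    qed
    show "\<exists>rs. (\<forall>r\<in>set rs. 0 \<le> fst r \<and> snd r \<in> H) \<and>
        (\<forall>F\<in>Q. \<bar>M (S.conv p0 F) - (\<Sum>r\<leftarrow>rs. fst r * F (snd r))\<bar> < e)"
      if "finite Q" "Q \<subseteq> K.dominated f" "0 < e" for Q e
      using S.functional_approx[OF M(1) that] unfolding F.weights_def F.comb_def by auto
  qed
qed


section \<open>Back to the cone\<close>

lemma dual_add: "l \<in> topological_dual E T \<Longrightarrow> x \<in> carrier E \<Longrightarrow> y \<in> carrier E \<Longrightarrow> l (x \<oplus>\<^bsub>E\<^esub> y) = l x + l y"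
  by (simp add: topological_dual_def)

lemma dual_smult: "l \<in> topological_dual E T \<Longrightarrow> x \<in> carrier E \<Longrightarrow> l (r \<odot>\<^bsub>E\<^esub> x) = r * l x"
  by (simp add: topological_dual_def)

lemma dual_continuous: "l \<in> topological_dual E T \<Longrightarrow> continuous_map T euclideanreal l"
  by (simp add: topological_dual_def)

lemma dual_zero: "(\<lambda>x. 0) \<in> topological_dual E T"
  by (simp add: topological_dual_def)

lemma dual_sum_list:
  assumes "\<And>i. i \<in> set xs \<Longrightarrow> l i \<in> topological_dual E T"
  shows "(\<lambda>x. \<Sum>i\<leftarrow>xs. l i x) \<in> topological_dual E T"
  using assms
proof (induction xs)
  case (Cons i xs)
  then have "l i \<in> topological_dual E T" "(\<lambda>x. \<Sum>i\<leftarrow>xs. l i x) \<in> topological_dual E T" by auto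
  then show ?case
    by (auto simp: topological_dual_def distrib_left intro!: continuous_map_add)
qed (simp add: dual_zero)

lemma dual_minus:
  fixes E :: "(real, 'e) module"
  assumes E: "locally_convex_space E T" and "l \<in> topological_dual E T" "x \<in> carrier E" "y \<in> carrier E"
  shows "l (x \<ominus>\<^bsub>E\<^esub> y) = l x - l y"
proof -
  interpret locally_convex_space E T by (rule E)
  show ?thesis
    using assms(2-4) dual_add[of l E T x "\<ominus>\<^bsub>E\<^esub> y"] dual_smult[of l E T y "-1"]
    by (simp add: a_minus_def uminus_smult)
qed

text \<open>The sets of points of \<open>C\<close> within \<open>e\<close> of
  \<open>\<Lambda>\<close> on a finite \<open>L\<close> form the base of a weakly Cauchy filter. Its
  limit exists in \<open>C\<close> by completeness, and uniqueness of limits identifies the values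
  there.\<close>

theorem weak_limit_in_cone:
  fixes E :: "(real, 'e) module"
  assumes E: "locally_convex_space E T" and C: "C \<subseteq> carrier E" "weakly_complete E T C"
    and approx: "\<And>L e. finite L \<Longrightarrow> L \<subseteq> topological_dual E T \<Longrightarrow> 0 < e \<Longrightarrow> \<exists>c\<in>C. \<forall>l\<in>L. \<bar>l c - \<Lambda> l\<bar> < e"
  shows "\<exists>c\<in>C. \<forall>l\<in>topological_dual E T. l c = \<Lambda> l"
proof -
  interpret locally_convex_space E T by (rule E)
  let ?D = "topological_dual E T"
  let ?w = "weak_topology E T"
  have w: "?w = initial_topology (carrier E) ?D" by (rule weak_topology_initial)
  define I where "I = {p. finite (fst p) \<and> fst p \<subseteq> ?D \<and> (0::real) < snd p}"
  define S where "S p = {c \<in> C. \<forall>l\<in>fst p. \<bar>l c - \<Lambda> l\<bar> < snd p}" for p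
  define F where "F = (INF p\<in>I. principal (S p))"
  have ev: "eventually P F \<longleftrightarrow> (\<exists>p\<in>I. \<forall>x\<in>S p. P x)" for P
    unfolding F_def
  proof (subst eventually_INF_base)
    show "I \<noteq> {}" by (auto simp: I_def intro!: exI[of _ "{}"] exI[of _ 1])
    fix p q assume pq: "p \<in> I" "q \<in> I"
    have "S (fst p \<union> fst q, min (snd p) (snd q)) \<subseteq> S p \<inter> S q" by (auto simp: S_def)
    moreover have "(fst p \<union> fst q, min (snd p) (snd q)) \<in> I" using pq by (auto simp: I_def)
    ultimately show "\<exists>x\<in>I. principal (S x) \<le> inf (principal (S p)) (principal (S q))"
      by (intro bexI[of _ "(fst p \<union> fst q, min (snd p) (snd q))"]) auto
  qed (simp add: eventually_principal)
  have Sne: "S p \<noteq> {}" if "p \<in> I" for p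
    using approx[of "fst p" "snd p"] that by (auto simp: I_def S_def)
  have F0: "F \<noteq> bot"
    using Sne by (auto simp: trivial_limit_def ev)
  have FC: "eventually (\<lambda>x. x \<in> C) F"
    unfolding ev by (intro bexI[of _ "({}, 1)"]) (auto simp: S_def I_def)
  have Flim: "((\<lambda>x. l x) \<longlongrightarrow> \<Lambda> l) F" if l: "l \<in> ?D" for l
  proof (rule tendstoI)
    fix e :: real assume e: "0 < e"
    show "eventually (\<lambda>x. dist (l x) (\<Lambda> l) < e) F"
      unfolding ev using l e by (intro bexI[of _ "({l}, e)"]) (auto simp: S_def I_def dist_real_def)
  qed
  have cauchy: "\<exists>N. eventually (\<lambda>x. x \<in> N) F \<and> (\<forall>x\<in>N \<inter> C. \<forall>y\<in>N \<inter> C. x \<ominus>\<^bsub>E\<^esub> y \<in> U)"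
    if U: "openin ?w U" "\<zero>\<^bsub>E\<^esub> \<in> U" for U
  proof -
    obtain L e where L: "finite L" "L \<subseteq> ?D" "0 < e" "{y \<in> carrier E. \<forall>l\<in>L. \<bar>l y - l \<zero>\<^bsub>E\<^esub>\<bar> < e} \<subseteq> U"
      using initial_topology_basis[OF U(1)[unfolded w] U(2)] by blast
    \<comment> \<open>Two points that are both within \<open>e / 2\<close> of
      \<open>\<Lambda>\<close> differ by less than \<open>e\<close> on \<open>L\<close>.\<close>
    have pI: "(L, e / 2) \<in> I" using L by (auto simp: I_def)
    have "x \<ominus>\<^bsub>E\<^esub> y \<in> U" if x: "x \<in> S (L, e / 2)" and y: "y \<in> S (L, e / 2)" for x y
    proof -
      have xy: "x \<in> carrier E" "y \<in> carrier E" using x y C(1) by (auto simp: S_def)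
      have "\<bar>l (x \<ominus>\<^bsub>E\<^esub> y) - l \<zero>\<^bsub>E\<^esub>\<bar> < e" if l: "l \<in> L" for l
      proof -
        have lD: "l \<in> ?D" using l L(2) by blast
        have "l \<zero>\<^bsub>E\<^esub> = 0" using dual_smult[OF lD M.zero_closed, of 0] by simp
        moreover have "\<bar>l x - \<Lambda> l\<bar> < e / 2" "\<bar>l y - \<Lambda> l\<bar> < e / 2" using x y l by (auto simp: S_def)
        ultimately show ?thesis unfolding dual_minus[OF E lD xy] by linarith
      qed
      then show ?thesis using L(4) xy by auto
    qed
    then show ?thesis using pI by (intro exI[of _ "S (L, e / 2)"]) (auto simp: ev)
  qed
  obtain c where c: "c \<in> C" "limitin ?w (\<lambda>x. x) c F"
    using C(2)[unfolded weakly_complete_def complete_in_def, THEN spec[of _ F]] F0 FC cauchy by blast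
  have "l c = \<Lambda> l" if l: "l \<in> ?D" for l
  proof -
    have "((\<lambda>x. l x) \<longlongrightarrow> l c) F"
      using continuous_map_limit[OF continuous_map_initial[OF l] c(2)[unfolded w]] by (simp add: o_def)
    then show ?thesis using Flim[OF l] by (rule tendsto_unique[OF F0])
  qed
  then show ?thesis using c(1) by blast
qed

theorem theorem11:
  fixes G :: "('g, 'm) monoid_scheme" and T :: "'g topology" and H :: "'g set"
  assumes "locally_compact_group G T"
    and "fixed_point_property_for_cones TYPE(('g \<Rightarrow> real) \<Rightarrow> real) G T"
    and "subgroup H G" and "closedin T H"
  shows "fixed_point_property_for_cones TYPE('e) (G\<lparr>carrier := H\<rparr>) (subtopology T H)"
  unfolding fixed_point_property_for_cones_def
proof (intro allI impI, elim conjE)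
  fix E :: "(real, 'e) module" and TE C \<pi>
  interpret G: locally_compact_group G T by fact
  interpret S: closed_subgroup G T H
    by (intro closed_subgroup.intro closed_subgroup_axioms.intro assms)
  let ?K = "G\<lparr>carrier := H\<rparr>" and ?TH = "subtopology T H"
  let ?D = "topological_dual E TE"
  assume E: "locally_convex_space E TE" and Cp: "proper_cone E C" and Cc: "weakly_complete E TE C"
    and rep: "cone_representation ?K E TE C \<pi>"
    and uc: "locally_bounded_right_uniformly_continuous ?K ?TH E TE C \<pi>"
    and cob: "cobounded_type ?K E TE C \<pi>"
  interpret E: locally_convex_space E TE by fact
  have CE: "C \<subseteq> carrier E" and C_add: "\<And>x y. x \<in> C \<Longrightarrow> y \<in> C \<Longrightarrow> x \<oplus>\<^bsub>E\<^esub> y \<in> C"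
    and C_smult: "\<And>r x. 0 \<le> r \<Longrightarrow> x \<in> C \<Longrightarrow> r \<odot>\<^bsub>E\<^esub> x \<in> C"
    using Cp by (auto simp: proper_cone_def cone_in_def)
  have \<pi>E: "\<And>g x. g \<in> H \<Longrightarrow> x \<in> carrier E \<Longrightarrow> \<pi> g x \<in> carrier E"
    and \<pi>_add: "\<And>g x y. g \<in> H \<Longrightarrow> x \<in> carrier E \<Longrightarrow> y \<in> carrier E \<Longrightarrow> \<pi> g (x \<oplus>\<^bsub>E\<^esub> y) = \<pi> g x \<oplus>\<^bsub>E\<^esub> \<pi> g y"
    and \<pi>_smult: "\<And>g r x. g \<in> H \<Longrightarrow> x \<in> carrier E \<Longrightarrow> \<pi> g (r \<odot>\<^bsub>E\<^esub> x) = r \<odot>\<^bsub>E\<^esub> \<pi> g x"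
    and \<pi>_cont: "\<And>g. g \<in> H \<Longrightarrow> continuous_map TE TE (\<pi> g)"
    and \<pi>_mult: "\<And>g h x. g \<in> H \<Longrightarrow> h \<in> H \<Longrightarrow> x \<in> carrier E \<Longrightarrow> \<pi> (g \<otimes>\<^bsub>G\<^esub> h) x = \<pi> g (\<pi> h x)"
    and \<pi>C: "\<And>g x. g \<in> H \<Longrightarrow> x \<in> C \<Longrightarrow> \<pi> g x \<in> C"
    using rep by (auto simp: cone_representation_def linear_operator_def Pi_iff image_subset_iff)
  obtain x0 where x0: "x0 \<in> C" "x0 \<noteq> \<zero>\<^bsub>E\<^esub>" "bounded_in E TE ((\<lambda>g. \<pi> g x0) ` H)"
    and x0_uc: "\<And>U. openin TE U \<Longrightarrow> \<zero>\<^bsub>E\<^esub> \<in> U \<Longrightarrow>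
       \<exists>V. openin ?TH V \<and> \<one>\<^bsub>G\<^esub> \<in> V \<and> (\<forall>a\<in>V. \<forall>g\<in>H. \<pi> (a \<otimes>\<^bsub>G\<^esub> g) x0 \<ominus>\<^bsub>E\<^esub> \<pi> g x0 \<in> U)"
    using uc unfolding locally_bounded_right_uniformly_continuous_def by auto
  have x0E: "x0 \<in> carrier E" using x0(1) CE by blast
  obtain l0 where l0: "l0 \<in> ?D" and l0_dom: "\<forall>l\<in>?D. \<exists>(n::nat) g. (\<forall>j\<in>{1..n}. g j \<in> H) \<and>
      dual_le C l (\<lambda>x. \<Sum>j=1..n. adjoint_rep ?K \<pi> (g j) l0 x) \<and>
      dual_le C (\<lambda>x. - l x) (\<lambda>x. \<Sum>j=1..n. adjoint_rep ?K \<pi> (g j) l0 x)"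
    using cob unfolding cobounded_type_def by auto
  have adj: "adjoint_rep ?K \<pi> g l x = l (\<pi> (inv\<^bsub>G\<^esub> g) x)" if "g \<in> H" for g l x
    using that by (simp add: adjoint_rep_def)
  have dom: "\<exists>gs. set gs \<subseteq> H \<and> (\<forall>x\<in>C. \<bar>l x\<bar> \<le> (\<Sum>g\<leftarrow>gs. l0 (\<pi> (inv\<^bsub>G\<^esub> g) x)))" if l: "l \<in> ?D" for l
  proof -
    obtain n :: nat and g where g: "\<forall>j\<in>{1..n}. g j \<in> H"
      "dual_le C l (\<lambda>x. \<Sum>j=1..n. adjoint_rep ?K \<pi> (g j) l0 x)"
      "dual_le C (\<lambda>x. - l x) (\<lambda>x. \<Sum>j=1..n. adjoint_rep ?K \<pi> (g j) l0 x)"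
      using l0_dom l by blast
    let ?gs = "map g [1..<Suc n]"
    have "\<bar>l x\<bar> \<le> (\<Sum>g\<leftarrow>?gs. l0 (\<pi> (inv\<^bsub>G\<^esub> g) x))" if x: "x \<in> C" for x
    proof -
      have "(\<Sum>j=1..n. adjoint_rep ?K \<pi> (g j) l0 x) = (\<Sum>j=1..n. l0 (\<pi> (inv\<^bsub>G\<^esub> (g j)) x))"
        using g(1) adj by (intro sum.cong) auto
      also have "\<dots> = (\<Sum>g\<leftarrow>?gs. l0 (\<pi> (inv\<^bsub>G\<^esub> g) x))"
        by (simp add: sum_list_distinct_conv_sum_set o_def atLeastLessThanSuc_atLeastAtMost del: upt_Suc)
      finally show ?thesis using g(2,3) x by (fastforce simp: dual_le_def)
    qed
    then show ?thesis using g(1) by (intro exI[of _ ?gs]) auto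
  qed
  have dual_\<pi>: "(\<lambda>x. l (\<pi> g x)) \<in> ?D" if l: "l \<in> ?D" and g: "g \<in> H" for l g
    using dual_add[OF l] dual_smult[OF l] \<pi>_add[OF g] \<pi>_smult[OF g] \<pi>E[OF g]
      continuous_map_compose[OF \<pi>_cont[OF g] dual_continuous[OF l]]
    by (simp add: topological_dual_def o_def)
  obtain gs0 where gs0: "set gs0 \<subseteq> H" "\<forall>x\<in>C. \<bar>l0 x\<bar> \<le> (\<Sum>g\<leftarrow>gs0. l0 (\<pi> (inv\<^bsub>G\<^esub> g) x))"
    using dom[OF l0] by blast
  \<comment> \<open>The cobounding \<open>l0\<close> need not be nonnegative on \<open>C\<close>.
    The sum \<open>l1\<close> of translates dominating \<open>\<bar>l0\<bar>\<close> is, and it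
    still cobounds because \<open>l0 \<le> l1\<close> on \<open>C\<close>.\<close>
  define l1 where "l1 x = (\<Sum>g\<leftarrow>gs0. l0 (\<pi> (inv\<^bsub>G\<^esub> g) x))" for x
  have l1: "l1 \<in> ?D"
    unfolding l1_def[abs_def] using gs0(1) S.H_inv by (intro dual_sum_list dual_\<pi>[OF l0]) auto
  have l1_ge: "\<bar>l0 x\<bar> \<le> l1 x" if "x \<in> C" for x using gs0(2) that by (simp add: l1_def)
  have l1_0: "0 \<le> l1 x" if "x \<in> C" for x using l1_ge[OF that] by linarith
  have dom1: "\<exists>gs. set gs \<subseteq> H \<and> (\<forall>x\<in>C. \<bar>l x\<bar> \<le> (\<Sum>g\<leftarrow>gs. l1 (\<pi> (inv\<^bsub>G\<^esub> g) x)))" if l: "l \<in> ?D" for l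
  proof -
    obtain gs where gs: "set gs \<subseteq> H" "\<forall>x\<in>C. \<bar>l x\<bar> \<le> (\<Sum>g\<leftarrow>gs. l0 (\<pi> (inv\<^bsub>G\<^esub> g) x))"
      using dom[OF l] by blast
    have "(\<Sum>g\<leftarrow>gs. l0 (\<pi> (inv\<^bsub>G\<^esub> g) x)) \<le> (\<Sum>g\<leftarrow>gs. l1 (\<pi> (inv\<^bsub>G\<^esub> g) x))" if x: "x \<in> C" for x
    proof (rule sum_list_mono)
      fix g assume "g \<in> set gs"
      then have "\<pi> (inv\<^bsub>G\<^esub> g) x \<in> C" using gs(1) S.H_inv \<pi>C x by blast
      then show "l0 (\<pi> (inv\<^bsub>G\<^esub> g) x) \<le> l1 (\<pi> (inv\<^bsub>G\<^esub> g) x)" using l1_ge by fastforce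
    qed
    then show ?thesis using gs by (intro exI[of _ gs]) force
  qed
  define orb :: "('e \<Rightarrow> real) \<Rightarrow> 'g \<Rightarrow> real" where "orb l h = l (\<pi> h x0)" for l h
  define f where "f = orb l1"
  have orb_uc: "S.K.right_uc (orb l)" if l: "l \<in> ?D" for l
  proof (rule S.K.right_ucI)
    fix e :: real assume e: "0 < e"
    define U where "U = {x \<in> topspace TE. l x \<in> {-e<..<e}}"
    have "openin TE U" unfolding U_def using dual_continuous[OF l] by (rule openin_continuous_map_preimage) auto
    moreover have "l \<zero>\<^bsub>E\<^esub> = 0" using dual_smult[OF l E.M.zero_closed, of 0] by simp
    then have "\<zero>\<^bsub>E\<^esub> \<in> U" using e by (simp add: U_def E.topspace_eq)
    ultimately obtain V where V: "openin ?TH V" "\<one>\<^bsub>G\<^esub> \<in> V"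
        "\<forall>a\<in>V. \<forall>g\<in>H. \<pi> (a \<otimes>\<^bsub>G\<^esub> g) x0 \<ominus>\<^bsub>E\<^esub> \<pi> g x0 \<in> U"
      using x0_uc by blast
    have "\<bar>orb l (a \<otimes>\<^bsub>G\<^esub> g) - orb l g\<bar> < e" if a: "a \<in> V" and g: "g \<in> H" for a g
    proof -
      have aH: "a \<in> H" using openin_subset[OF V(1)] a by auto
      have "l (\<pi> (a \<otimes>\<^bsub>G\<^esub> g) x0 \<ominus>\<^bsub>E\<^esub> \<pi> g x0) = orb l (a \<otimes>\<^bsub>G\<^esub> g) - orb l g"
        unfolding orb_def by (rule dual_minus[OF E l]) (use \<pi>E S.H_mult aH g x0E in auto)
      moreover have "\<pi> (a \<otimes>\<^bsub>G\<^esub> g) x0 \<ominus>\<^bsub>E\<^esub> \<pi> g x0 \<in> U" using V(3) a g by blast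
      ultimately show ?thesis by (auto simp: U_def)
    qed
    then show "\<exists>U. openin ?TH U \<and> \<one>\<^bsub>?K\<^esub> \<in> U \<and>
        (\<forall>a\<in>U. \<forall>g\<in>carrier ?K. \<bar>orb l (a \<otimes>\<^bsub>?K\<^esub> g) - orb l g\<bar> < e)"
      using V(1,2) by auto
  qed
  have orb_bounded: "\<exists>B. \<forall>h\<in>H. \<bar>orb l h\<bar> \<le> B" if l: "l \<in> ?D" for l
  proof -
    define U where "U = {x \<in> topspace TE. l x \<in> {-1<..<1}}"
    have "openin TE U" unfolding U_def using dual_continuous[OF l] by (rule openin_continuous_map_preimage) auto
    moreover have "l \<zero>\<^bsub>E\<^esub> = 0" using dual_smult[OF l E.M.zero_closed, of 0] by simp
    then have "\<zero>\<^bsub>E\<^esub> \<in> U" by (simp add: U_def E.topspace_eq)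
    ultimately obtain r where r: "r > 0" "\<forall>t. r \<le> \<bar>t\<bar> \<longrightarrow> (\<lambda>g. \<pi> g x0) ` H \<subseteq> (\<lambda>x. t \<odot>\<^bsub>E\<^esub> x) ` U"
      using x0(3) unfolding bounded_in_def by blast
    have "\<bar>orb l h\<bar> \<le> r" if h: "h \<in> H" for h
    proof -
      have "(\<lambda>g. \<pi> g x0) ` H \<subseteq> (\<lambda>x. r \<odot>\<^bsub>E\<^esub> x) ` U" using r by simp
      then have "\<pi> h x0 \<in> (\<lambda>x. r \<odot>\<^bsub>E\<^esub> x) ` U" using h by blast
      then obtain y where y: "\<pi> h x0 = r \<odot>\<^bsub>E\<^esub> y" "y \<in> U" by blast
      then have "y \<in> carrier E" "\<bar>l y\<bar> < 1" by (auto simp: U_def E.topspace_eq)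
      then show ?thesis using y(1) r(1) dual_smult[OF l, of y r] by (simp add: orb_def abs_mult)
    qed
    then show ?thesis by blast
  qed
  have orb_dominated: "orb l \<in> S.K.dominated f" if l: "l \<in> ?D" for l
  proof -
    obtain gs where gs: "set gs \<subseteq> H" "\<forall>x\<in>C. \<bar>l x\<bar> \<le> (\<Sum>g\<leftarrow>gs. l1 (\<pi> (inv\<^bsub>G\<^esub> g) x))"
      using dom1[OF l] by blast
    have "\<bar>orb l h\<bar> \<le> (\<Sum>g\<leftarrow>gs. f (inv\<^bsub>?K\<^esub> g \<otimes>\<^bsub>?K\<^esub> h))" if h: "h \<in> H" for h
    proof -
      have "(\<Sum>g\<leftarrow>gs. l1 (\<pi> (inv\<^bsub>G\<^esub> g) (\<pi> h x0))) = (\<Sum>g\<leftarrow>gs. f (inv\<^bsub>?K\<^esub> g \<otimes>\<^bsub>?K\<^esub> h))"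
        using gs(1) h x0E S.H_inv
        by (intro arg_cong[of _ _ sum_list] map_cong refl) (auto simp: f_def orb_def \<pi>_mult subset_eq)
      with bspec[OF gs(2) \<pi>C[OF h x0(1)]] show ?thesis by (simp only: orb_def[of l h])
    qed
    then show ?thesis
      using orb_uc[OF l] orb_bounded[OF l] gs(1) unfolding S.K.dominated_def by auto
  qed
  have f0: "0 \<le> f h" if "h \<in> H" for h
    using l1_0[OF \<pi>C[OF that x0(1)]] by (simp add: f_def orb_def)
  \<comment> \<open>Some continuous \<open>l\<close> is non-zero at \<open>x0\<close>, and
    \<open>\<bar>l x0\<bar>\<close> is at most a finite sum of values of \<open>f\<close>, so
    \<open>f\<close> cannot vanish on \<open>H\<close>.\<close>
  obtain t where t: "t \<in> H" "0 < f t"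
  proof -
    obtain l where l: "l \<in> ?D" "l x0 \<noteq> 0" using dual_separates_points[OF E x0E x0(2)] by blast
    obtain gs where gs: "set gs \<subseteq> H" "\<forall>x\<in>C. \<bar>l x\<bar> \<le> (\<Sum>g\<leftarrow>gs. l1 (\<pi> (inv\<^bsub>G\<^esub> g) x))"
      using dom1[OF l(1)] by blast
    have "\<exists>g\<in>set gs. f (inv\<^bsub>G\<^esub> g) \<noteq> 0"
    proof (rule ccontr)
      assume "\<not> ?thesis"
      then have "(\<Sum>g\<leftarrow>gs. l1 (\<pi> (inv\<^bsub>G\<^esub> g) x0)) = (\<Sum>g\<leftarrow>gs. 0)"
        by (intro arg_cong[of _ _ sum_list] map_cong refl) (simp add: f_def orb_def)
      then show False using gs(2) x0(1) l(2) by force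
    qed
    then obtain g where "g \<in> set gs" "f (inv\<^bsub>G\<^esub> g) \<noteq> 0" by blast
    then show thesis using that[of "inv\<^bsub>G\<^esub> g"] f0[of "inv\<^bsub>G\<^esub> g"] gs(1) S.H_inv by force
  qed
  have td: "translate_dominated ?K ?TH f t"
  proof (unfold_locales)
    show "S.K.right_uc f" unfolding f_def by (rule orb_uc[OF l1])
    show "\<exists>B. \<forall>x\<in>carrier ?K. \<bar>f x\<bar> \<le> B" unfolding f_def using orb_bounded[OF l1] by simp
  qed (use t f0 in auto)
  obtain \<Lambda> where \<Lambda>: "0 < \<Lambda> f"
    "\<And>k F. k \<in> H \<Longrightarrow> F \<in> S.K.dominated f \<Longrightarrow> \<Lambda> (\<lambda>h. F (k \<otimes>\<^bsub>G\<^esub> h)) = \<Lambda> F"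
    "\<And>F F'. F \<in> S.K.dominated f \<Longrightarrow> F' \<in> S.K.dominated f \<Longrightarrow> (\<And>h. h \<in> H \<Longrightarrow> F h = F' h) \<Longrightarrow> \<Lambda> F = \<Lambda> F'"
    "\<And>Q e. finite Q \<Longrightarrow> Q \<subseteq> S.K.dominated f \<Longrightarrow> 0 < e \<Longrightarrow>
       \<exists>rs. (\<forall>r\<in>set rs. 0 \<le> fst r \<and> snd r \<in> H) \<and> (\<forall>F\<in>Q. \<bar>\<Lambda> F - (\<Sum>r\<leftarrow>rs. fst r * F (snd r))\<bar> < e)"
    by (rule S.subgroup_invariant_functional[OF assms(2) td]) blast
  \<comment> \<open>The same combination, with orbit points of \<open>x0\<close> in place of
    evaluations, lies in \<open>C\<close>; the empty list is represented by zero times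
    \<open>x0\<close>.\<close>
  have orb_comb: "\<exists>c\<in>C. \<forall>l\<in>?D. l c = (\<Sum>r\<leftarrow>rs. fst r * orb l (snd r))"
    if "\<forall>r\<in>set rs. 0 \<le> fst r \<and> snd r \<in> H" for rs
    using that
  proof (induction rs)
    case Nil
    have "0 \<odot>\<^bsub>E\<^esub> x0 \<in> C" using C_smult x0(1) by simp
    then show ?case using dual_smult[of _ E TE x0 0] x0E by (intro bexI[of _ "0 \<odot>\<^bsub>E\<^esub> x0"]) auto
  next
    case (Cons r rs)
    then obtain c where c: "c \<in> C" "\<forall>l\<in>?D. l c = (\<Sum>r\<leftarrow>rs. fst r * orb l (snd r))" by auto
    have r: "0 \<le> fst r" "snd r \<in> H" using Cons.prems by auto
    have p: "\<pi> (snd r) x0 \<in> C" by (rule \<pi>C[OF r(2) x0(1)])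
    have "l (fst r \<odot>\<^bsub>E\<^esub> \<pi> (snd r) x0 \<oplus>\<^bsub>E\<^esub> c) = (\<Sum>r\<leftarrow>r # rs. fst r * orb l (snd r))" if l: "l \<in> ?D" for l
    proof -
      have "\<pi> (snd r) x0 \<in> carrier E" "c \<in> carrier E" using p c(1) CE by auto
      then show ?thesis using dual_add[OF l] dual_smult[OF l] c(2) l by (simp add: orb_def)
    qed
    then show ?case using C_add[OF C_smult[OF r(1) p] c(1)] by blast
  qed
  have "\<exists>c\<in>C. \<forall>l\<in>?D. l c = \<Lambda> (orb l)"
  proof (rule weak_limit_in_cone[OF E CE Cc])
    fix L and e :: real assume L: "finite L" "L \<subseteq> ?D" "0 < e"
    have "finite (orb ` L)" "orb ` L \<subseteq> S.K.dominated f" using L orb_dominated by auto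
    then obtain rs where rs: "\<forall>r\<in>set rs. 0 \<le> fst r \<and> snd r \<in> H"
        "\<forall>F\<in>orb ` L. \<bar>\<Lambda> F - (\<Sum>r\<leftarrow>rs. fst r * F (snd r))\<bar> < e"
      using \<Lambda>(4)[OF _ _ L(3)] by blast
    obtain c where c: "c \<in> C" "\<forall>l\<in>?D. l c = (\<Sum>r\<leftarrow>rs. fst r * orb l (snd r))"
      using orb_comb[OF rs(1)] by blast
    have "\<bar>l c - \<Lambda> (orb l)\<bar> < e" if l: "l \<in> L" for l
    proof -
      have "l c = (\<Sum>r\<leftarrow>rs. fst r * orb l (snd r))" using c(2) l L(2) by blast
      moreover have "\<bar>\<Lambda> (orb l) - (\<Sum>r\<leftarrow>rs. fst r * orb l (snd r))\<bar> < e" using rs(2) l by blast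
      ultimately show ?thesis by (simp add: abs_minus_commute)
    qed
    then show "\<exists>c\<in>C. \<forall>l\<in>L. \<bar>l c - \<Lambda> (orb l)\<bar> < e" using c(1) by blast
  qed
  then obtain c where c: "c \<in> C" "\<And>l. l \<in> ?D \<Longrightarrow> l c = \<Lambda> (orb l)" by blast
  have cE: "c \<in> carrier E" using c(1) CE by blast
  \<comment> \<open>The value is \<open>\<Lambda> f\<close>, since \<open>f\<close> is the orbit
    function of \<open>l1\<close>.\<close>
  have "l1 c \<noteq> 0" using c(2)[OF l1] \<Lambda>(1) by (simp add: f_def)
  moreover have "l1 \<zero>\<^bsub>E\<^esub> = 0" using dual_smult[OF l1 E.M.zero_closed, of 0] by simp
  ultimately have "c \<noteq> \<zero>\<^bsub>E\<^esub>" by blast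
  moreover have "\<pi> h c = c" if h: "h \<in> H" for h
  proof (rule ccontr)
    assume neq: "\<pi> h c \<noteq> c"
    have hc: "\<pi> h c \<in> carrier E" by (rule \<pi>E[OF h cE])
    have "\<pi> h c \<ominus>\<^bsub>E\<^esub> c \<noteq> \<zero>\<^bsub>E\<^esub>" using neq hc cE E.M.r_neg1[OF cE hc] E.M.a_comm
      by (metis E.M.a_inv_closed E.M.minus_equality E.M.minus_minus a_minus_def)
    then obtain l where l: "l \<in> ?D" "l (\<pi> h c \<ominus>\<^bsub>E\<^esub> c) \<noteq> 0"
      using dual_separates_points[OF E, of "\<pi> h c \<ominus>\<^bsub>E\<^esub> c"] hc cE by (auto simp: E.M.minus_closed)
    \<comment> \<open>Applying the defining property of \<open>c\<close> to \<open>l\<close>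
      composed with \<open>\<pi> h\<close> turns the action on \<open>c\<close> into a left
      translation of the orbit function, under which \<open>\<Lambda>\<close> is invariant.\<close>
    have "l (\<pi> h c) = \<Lambda> (orb (\<lambda>x. l (\<pi> h x)))" by (rule c(2)[OF dual_\<pi>[OF l(1) h]])
    also have "\<dots> = \<Lambda> (\<lambda>k. orb l (h \<otimes>\<^bsub>G\<^esub> k))"
    proof (rule \<Lambda>(3)[OF orb_dominated[OF dual_\<pi>[OF l(1) h]]])
      interpret D: translate_dominated ?K ?TH f t by (rule td)
      show "(\<lambda>k. orb l (h \<otimes>\<^bsub>G\<^esub> k)) \<in> S.K.dominated f"
        using D.V_ltrans[OF orb_dominated[OF l(1)], of h] h by simp
      show "orb (\<lambda>x. l (\<pi> h x)) k = orb l (h \<otimes>\<^bsub>G\<^esub> k)" if "k \<in> H" for k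
        using \<pi>_mult[OF h that x0E] by (simp add: orb_def)
    qed
    also have "\<dots> = \<Lambda> (orb l)" by (rule \<Lambda>(2)[OF h orb_dominated[OF l(1)]])
    also have "\<dots> = l c" by (rule c(2)[OF l(1), symmetric])
    finally show False using l(2) dual_minus[OF E l(1) hc cE] by simp
  qed
  ultimately show "\<exists>x\<in>C. x \<noteq> \<zero>\<^bsub>E\<^esub> \<and> (\<forall>g\<in>carrier ?K. \<pi> g x = x)" using c(1) by auto
qed

end
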